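(* Let $(R,\mathfrak m)$ be a local Noetherian ring of dimension $d>0$ with infinite residue field and let $I$ be an $\mathfrak m$-primary ideal. Then for any minimal reduction $J$ of $I$, the multiplicity $f_0(I)$ of the special fiber ring $\mathcal F(I)$ of $I$ satisfies $$f_0(I)\le e_1(I)-e_0(I)-e_1(J)+\lambda(R/I)+\mu(I)-d+1.$$
   Context: Let $\lambda(\cdot)$ denote length and $\mu(\cdot)$ the minimal number of generators. For an $\mathfrak m$-primary ideal $I$ of a local Noetherian ring $(R,\mathfrak m)$ of dimension $d>0$, the Hilbert coefficients $e_0(I),\dots,e_d(I)$ are the integers such that, for $n\gg 0$, $\lambda(R/I^n)=e_0(I)\binom{n+d-1}{d}-e_1(I)\binom{n+d-2}{d-1}+\cdots+(-1)^d e_d(I)$. A minimal reduction $J$ of $I$ is an ideal $J\subseteq I$ generated by $d$ elements such that $I^{r+1}=JI^r$ for some integer $r\ge 0$ (so $J$ is itself $\mathfrak m$-primary and $e_i(J)$ is defined). The special fiber ring of $I$ is $\mathcal F(I)=\mathcal R(I)\otimes_R R/\mathfrak m=\bigoplus_{n\ge 0}I^n/\mathfrak m I^n$, where $\mathcal R(I)=\bigoplus_{n\ge0}I^nt^n$ is the Rees algebra; it is a standard graded algebra of dimension $d$ over the residue field, and $f_0(I)$ denotes its multiplicity, i.e. $(d-1)!$ times the leading coefficient of its Hilbert polynomial. *)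

theory Defs
  imports
    "HOL-Library.Extended_Nat"
    "HOL-Computational_Algebra.Polynomial"
    "HOL-Algebra.Ring_Divisibility"
    "HOL-Algebra.Ideal_Product"
    "HOL-Algebra.Embedded_Algebras"
    "HOL-Algebra.UnivPoly"
begin

locale noetherian_local_ring = cring R + noetherian_ring R + maximalideal \<mm> R
  for R (structure) and \<mm> +
  assumes maximal_unique: "maximalideal M R \<Longrightarrow> M = \<mm>"

definition krull_dim :: "('a, 'b) ring_scheme \<Rightarrow> enat" where
  "krull_dim R = Sup {enat n | n. \<exists>P. (\<forall>i\<le>n. primeideal (P i) R) \<and> (\<forall>i<n. P i \<subset> P (Suc i))}"

definition radical :: "('a, 'b) ring_scheme \<Rightarrow> 'a set \<Rightarrow> 'a set" where
  "radical R I = {a \<in> carrier R. \<exists>n::nat. a [^]\<^bsub>R\<^esub> n \<in> I}"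

definition primary_ideal :: "('a, 'b) ring_scheme \<Rightarrow> 'a set \<Rightarrow> bool" where
  "primary_ideal R I \<longleftrightarrow> ideal I R \<and> I \<noteq> carrier R \<and>
     (\<forall>a\<in>carrier R. \<forall>b\<in>carrier R. a \<otimes>\<^bsub>R\<^esub> b \<in> I \<longrightarrow> a \<in> I \<or> b \<in> radical R I)"

text \<open>\<open>P_primary R P I\<close>: the ideal \<open>I\<close> is \<open>P\<close>-primary.\<close>

definition P_primary :: "('a, 'b) ring_scheme \<Rightarrow> 'a set \<Rightarrow> 'a set \<Rightarrow> bool" where
  "P_primary R P I \<longleftrightarrow> primary_ideal R I \<and> radical R I = P"

text \<open>The power is taken in the semiring of ideals, so \<open>ideal_power R I 0\<close> is the unit ideal.\<close>

abbreviation ideal_power :: "('a, 'b) ring_scheme \<Rightarrow> 'a set \<Rightarrow> nat \<Rightarrow> 'a set" where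
  "ideal_power R I n \<equiv> I [^]\<^bsub>ideals_set R\<^esub> n"

definition min_gens :: "('a, 'b) ring_scheme \<Rightarrow> 'a set \<Rightarrow> nat" where
  "min_gens R I = (LEAST n. \<exists>S. S \<subseteq> carrier R \<and> finite S \<and> card S = n \<and> I = genideal R S)"

definition module_length ::
    "('a, 'b) ring_scheme \<Rightarrow> ('a, 'c, 'd) module_scheme \<Rightarrow> enat" where
  "module_length R M =
     Sup {enat n | n. \<exists>N. (\<forall>i\<le>n. submodule (N i) R M) \<and> (\<forall>i<n. N i \<subset> N (Suc i))}"

text \<open>The quotient \<open>R / A\<close> as an \<open>R\<close>-module.\<close>

definition quot_module :: "('a, 'b) ring_scheme \<Rightarrow> 'a set \<Rightarrow> ('a, 'a set) module" where
  "quot_module R A =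
     \<lparr>carrier = carrier (R Quot A), mult = mult (R Quot A), one = one (R Quot A),
      zero = zero (R Quot A), add = add (R Quot A),
      smult = (\<lambda>r X. (A +>\<^bsub>R\<^esub> r) \<otimes>\<^bsub>R Quot A\<^esub> X)\<rparr>"

text \<open>The length of \<open>R / A\<close>, meaningful when it is finite.\<close>

definition colength :: "('a, 'b) ring_scheme \<Rightarrow> 'a set \<Rightarrow> nat" where
  "colength R A = the_enat (module_length R (quot_module R A))"

text \<open>
  In the following definitions \<open>d\<close> is meant to be the Krull dimension of \<open>R\<close>.  The Hilbert
  coefficients are only indexed by \<open>0, \<dots>, d\<close>; the value \<open>0\<close> beyond \<open>d\<close> makes them unique
  as a function.  No natural subtraction truncates once \<open>n \<ge> 1\<close>.
\<close>

definition hilbert_coeff :: "('a, 'b) ring_scheme \<Rightarrow> nat \<Rightarrow> 'a set \<Rightarrow> nat \<Rightarrow> int" where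
  "hilbert_coeff R d I = (THE e. (\<forall>i>d. e i = 0) \<and>
     (\<forall>\<^sub>F n in sequentially. int (colength R (ideal_power R I n)) =
        (\<Sum>i\<le>d. (-1) ^ i * e i * int ((n + d - 1 - i) choose (d - i)))))"

definition minimal_reduction ::
    "('a, 'b) ring_scheme \<Rightarrow> nat \<Rightarrow> 'a set \<Rightarrow> 'a set \<Rightarrow> bool" where
  "minimal_reduction R d I J \<longleftrightarrow> ideal J R \<and> J \<subseteq> I \<and>
     (\<exists>S. S \<subseteq> carrier R \<and> finite S \<and> card S = d \<and> J = genideal R S) \<and>
     (\<exists>r. ideal_power R I (r + 1) = J \<cdot>\<^bsub>R\<^esub> ideal_power R I r)"

text \<open>The Rees algebra is the subring of \<open>R[t]\<close> of the polynomials whose coefficient at \<open>t\<^sup>n\<close>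
  lies in the \<open>n\<close>-th power of \<open>I\<close>.\<close>

definition rees_algebra :: "('a, 'b) ring_scheme \<Rightarrow> 'a set \<Rightarrow> ('a, nat \<Rightarrow> 'a) up_ring" where
  "rees_algebra R I = (UP R)
     \<lparr>carrier := {p \<in> carrier (UP R). \<forall>n. up_ring.coeff (UP R) p n \<in> ideal_power R I n}\<rparr>"

text \<open>The extension of \<open>\<mm>\<close> to the Rees algebra.  Tensoring the Rees algebra with \<open>R / \<mm>\<close>
  amounts to dividing it by this ideal.\<close>

definition rees_extension :: "('a, 'b) ring_scheme \<Rightarrow> 'a set \<Rightarrow> 'a set \<Rightarrow> (nat \<Rightarrow> 'a) set" where
  "rees_extension R \<mm> I = genideal (rees_algebra R I) ((\<lambda>a. up_ring.monom (UP R) a 0) ` \<mm>)"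

definition special_fiber :: "('a, 'b) ring_scheme \<Rightarrow> 'a set \<Rightarrow> 'a set \<Rightarrow> (nat \<Rightarrow> 'a) set ring" where
  "special_fiber R \<mm> I = rees_algebra R I Quot rees_extension R \<mm> I"

text \<open>The graded component of degree \<open>n\<close>, i.e. the classes of the elements \<open>a t\<^sup>n\<close>; it is a copy
  of \<open>I\<^sup>n / \<mm>I\<^sup>n\<close>, and for \<open>n = 0\<close> it is the residue field as a subfield of the fiber ring.\<close>

definition special_fiber_component ::
    "('a, 'b) ring_scheme \<Rightarrow> 'a set \<Rightarrow> 'a set \<Rightarrow> nat \<Rightarrow> (nat \<Rightarrow> 'a) set set" where
  "special_fiber_component R \<mm> I n =
     (\<lambda>a. rees_extension R \<mm> I +>\<^bsub>rees_algebra R I\<^esub> up_ring.monom (UP R) a n) ` ideal_power R I n"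

definition special_fiber_hilbert_fun ::
    "('a, 'b) ring_scheme \<Rightarrow> 'a set \<Rightarrow> 'a set \<Rightarrow> nat \<Rightarrow> nat" where
  "special_fiber_hilbert_fun R \<mm> I n =
     ring.dim (special_fiber R \<mm> I)
       (special_fiber_component R \<mm> I 0) (special_fiber_component R \<mm> I n)"

definition hilbert_poly :: "(nat \<Rightarrow> nat) \<Rightarrow> real poly" where
  "hilbert_poly H = (THE p. \<forall>\<^sub>F n in sequentially. real (H n) = poly p (real n))"

definition special_fiber_multiplicity ::
    "('a, 'b) ring_scheme \<Rightarrow> 'a set \<Rightarrow> nat \<Rightarrow> 'a set \<Rightarrow> real" where
  "special_fiber_multiplicity R \<mm> d I =
     fact (d - 1) * lead_coeff (hilbert_poly (special_fiber_hilbert_fun R \<mm> I))"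

end

theory Submission
  imports Defs "HOL-Library.Fun_Lexorder"
begin

text \<open>
  Write \<open>I = J + (G)\<close> with \<open>|G| \<le> \<mu>(I) - d\<close>, which is possible because the \<open>d\<close> generators of \<open>J\<close>
  are part of a minimal generating set of \<open>I\<close>: otherwise \<open>d - 1\<close> elements would generate an
  \<open>\<mm>\<close>-primary ideal. Modulo \<open>\<mm>I\<^sup>n\<close> the ideal \<open>J\<^sup>n\<^sup>-\<^sup>1I\<close> is spanned by the monomials of degree \<open>n\<close> in the
  generators of \<open>J\<close> and the products of monomials of degree \<open>n - 1\<close> with elements of \<open>G\<close>, and
  \<open>I\<^sup>n / J\<^sup>n\<^sup>-\<^sup>1I\<close> is a component of the Sally module. Since \<open>\<lambda>(J\<^sup>n\<^sup>-\<^sup>1 / J\<^sup>n\<^sup>-\<^sup>1I)\<close> is at most \<open>\<lambda>(R/I)\<close>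
  times the number of monomials of degree \<open>n - 1\<close>, this bounds \<open>\<lambda>(I\<^sup>n / \<mm>I\<^sup>n)\<close> by a polynomial in \<open>n\<close>
  plus \<open>\<lambda>(R/J\<^sup>n\<^sup>-\<^sup>1) - \<lambda>(R/I\<^sup>n)\<close>, and comparing the coefficients of \<open>n\<^sup>d\<^sup>-\<^sup>1\<close> gives the claim, because
  \<open>e\<^sub>0(I) = e\<^sub>0(J)\<close>.

  Two points need care. The Hilbert functions have to be eventually polynomial: filtering \<open>I\<^sup>n\<close> by the
  lexicographically ordered monomials in generators of \<open>I\<close> turns them into sums of a function that
  reverses the order of exponent vectors, and such sums are eventually polynomial by Dickson's lemma.
  The Hilbert polynomial of the fiber has to have degree exactly \<open>d - 1\<close>; this and the claim on
  generators follow from the growth of \<open>\<lambda>(R/Q\<^sup>n)\<close> being at least of order \<open>n\<^sup>d\<close> for \<open>\<mm>\<close>-primary \<open>Q\<close>, which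
  is proved along a chain of primes with the Artin-Rees lemma.
\<close>

section \<open>Sums of order-reversing functions over exponent vectors\<close>

text \<open>Lengths of modules enter only as colengths of ideals: for ideals N \<subseteq> M the
  quotient M/N has length \<lambda>(R/N) - \<lambda>(R/M), and one exact sequence, 0 \<rightarrow>
  R/(A : x) \<rightarrow> R/A \<rightarrow> R/(A + (x)) \<rightarrow> 0, carries the length
  computations. Adjoining generators one at a time thus takes the place of graded modules, the Sally
  module included. The constant arises as follows. Divided by n^(d-1)/(d-1)!, the number of
  monomials of degree n or n - 1 tends to 1, so the spanning set contributes 1 + |G|, and
  J^(n-1)/J^(n-1)I contributes \<lambda>(R/I). The difference \<lambda>(R/J^(n-1)) -
  \<lambda>(R/I^n) contributes e_1(I) - e_1(J) and, because of the shift from n to n - 1, also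
  -e_0(I). The multiplicity is defined by the actual leading coefficient of the Hilbert polynomial,
  whatever its degree. A bound on the coefficient of n^(d-1) therefore says nothing unless that
  coefficient is nonzero, which is why an upper bound needs lower bounds on growth.\<close>

definition exps :: "nat \<Rightarrow> nat \<Rightarrow> (nat \<Rightarrow> nat) set" where
  "exps k n = {a. (\<forall>i\<ge>k. a i = 0) \<and> (\<Sum>i<k. a i) = n}"

lemma exps_0: "exps 0 n = (if n = 0 then {\<lambda>_. 0} else {})"
  by (auto simp: exps_def)

text \<open>Splitting off the last exponent: since vectors are extended by zero, updating at
  \<open>k\<close> identifies vectors in \<open>k\<close> variables with the slice
  \<open>a k = j\<close>. The inductions on the number of variables run through this.\<close>

lemma exps_Suc: "exps (Suc k) n = (\<Union>j\<le>n. (\<lambda>a. a(k := j)) ` exps k (n - j))"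
proof (intro equalityI subsetI)
  fix a assume a: "a \<in> exps (Suc k) n"
  have s: "(\<Sum>i<k. (a(k := 0)) i) = (\<Sum>i<k. a i)" by (rule sum.cong) auto
  have "(\<Sum>i<k. a i) + a k = n" using a by (auto simp: exps_def)
  then have "a k \<le> n" "a(k := 0) \<in> exps k (n - a k)"
    using a s by (auto simp: exps_def le_Suc_eq Suc_le_eq)
  moreover have "a = (a(k := 0))(k := a k)" by auto
  ultimately show "a \<in> (\<Union>j\<le>n. (\<lambda>a. a(k := j)) ` exps k (n - j))" by blast
next
  fix a assume "a \<in> (\<Union>j\<le>n. (\<lambda>a. a(k := j)) ` exps k (n - j))"
  then obtain j b where j: "j \<le> n" "b \<in> exps k (n - j)" and a: "a = b(k := j)" by blast
  have s: "(\<Sum>i<k. (b(k := j)) i) = (\<Sum>i<k. b i)" by (rule sum.cong) auto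
  show "a \<in> exps (Suc k) n" using j s by (auto simp: exps_def a)
qed

lemma inj_on_upd_exps: "inj_on (\<lambda>a. a(k := j)) (exps k n)"
proof (rule inj_onI)
  fix a b assume ab: "a \<in> exps k n" "b \<in> exps k n" and e: "a(k := j) = b(k := j)"
  show "a = b"
  proof
    fix i show "a i = b i"
      using fun_cong[OF e, of i] ab by (cases "i = k") (auto simp: exps_def)
  qed
qed

lemma finite_exps: "finite (exps k n)"
  by (induction k arbitrary: n) (auto simp: exps_0 exps_Suc)

lemma sum_exps_Suc:
  "(\<Sum>a\<in>exps (Suc k) n. g a) = (\<Sum>j\<le>n. \<Sum>a\<in>exps k (n - j). g (a(k := j)))"
proof -
  have "(\<Sum>a\<in>exps (Suc k) n. g a) = (\<Sum>j\<le>n. sum g ((\<lambda>a. a(k := j)) ` exps k (n - j)))"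
    unfolding exps_Suc
  proof (rule sum.UNION_disjoint)
    show "\<forall>i\<in>{..n}. \<forall>j\<in>{..n}. i \<noteq> j \<longrightarrow>
        (\<lambda>a. a(k := i)) ` exps k (n - i) \<inter> (\<lambda>a. a(k := j)) ` exps k (n - j) = {}"
      by (auto dest: fun_cong[where x = k])
  qed (auto simp: finite_exps)
  also have "\<dots> = (\<Sum>j\<le>n. \<Sum>a\<in>exps k (n - j). g (a(k := j)))"
    by (rule sum.cong) (auto simp: sum.reindex[OF inj_on_upd_exps])
  finally show ?thesis .
qed

lemma sum_exps_Suc':
  "(\<Sum>a\<in>exps (Suc k) n. g a) = (\<Sum>j\<le>n. \<Sum>a\<in>exps k j. g (a(k := n - j)))"
  unfolding sum_exps_Suc
  by (rule sum.reindex_bij_witness[where i = "\<lambda>j. n - j" and j = "\<lambda>j. n - j"]) auto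

lemma card_exps: "card (exps (Suc k) n) = (n + k) choose k"
proof (induction k arbitrary: n)
  case 0
  have "exps (Suc 0) n = {\<lambda>i. if i = 0 then n else 0}"
    by (auto simp: exps_def fun_eq_iff)
  then show ?case by simp
next
  case (Suc k)
  have "card (exps (Suc (Suc k)) n) = (\<Sum>j\<le>n. card (exps (Suc k) j))"
    using sum_exps_Suc'[of "\<lambda>_. 1::nat" "Suc k" n] by simp
  also have "\<dots> = (\<Sum>j\<le>n. (k + j) choose k)" by (simp add: Suc add.commute)
  also have "\<dots> = Suc (k + n) choose n" using sum_choose_lower[of k n]
    by (simp add: binomial_symmetric[of k] )
  also have "\<dots> = (n + Suc k) choose Suc k"
    by (subst binomial_symmetric) (auto simp: ac_simps)
  finally show ?case .
qed

lemma card_exps_sum: "(\<Sum>j<n. card (exps k j)) \<le> card (exps (Suc k) n)"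
proof -
  have "(\<Sum>j<n. card (exps k j)) \<le> (\<Sum>j\<le>n. card (exps k j))"
    by (rule sum_mono2) auto
  also have "\<dots> = card (exps (Suc k) n)"
    using sum_exps_Suc'[of "\<lambda>_. 1::nat" k n] by simp
  finally show ?thesis .
qed

text \<open>The rising factorial n(n+1)...(n+j-1) divided by j!. For \<open>j = d - i\<close> it is
  the binomial that multiplies \<open>e i\<close> in \<open>hilbert_coeff\<close>, so coefficients
  in this basis are Hilbert coefficients up to sign and order.\<close>

definition mchoose :: "nat \<Rightarrow> nat \<Rightarrow> nat" where
  "mchoose j n = (n + j - 1) choose j"

lemma mchoose_0: "mchoose 0 n = 1" by (simp add: mchoose_def)

lemma mchoose_Suc_Suc: "mchoose (Suc j) (Suc n) = mchoose (Suc j) n + mchoose j (Suc n)"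
  by (cases n) (auto simp: mchoose_def)

text \<open>The functions \<open>mchoose j\<close> form a basis of the integer-valued polynomials which is closed
  under summation and backward shifts.\<close>

definition ev_int_poly :: "nat \<Rightarrow> (nat \<Rightarrow> int) \<Rightarrow> bool" where
  "ev_int_poly k f \<longleftrightarrow> (\<exists>c::nat \<Rightarrow> int. \<forall>\<^sub>F n in sequentially. f n = (\<Sum>j<k. c j * int (mchoose j n)))"

lemma ev_int_poly_cong:
  assumes "ev_int_poly k f" "\<forall>\<^sub>F n in sequentially. f n = g n" shows "ev_int_poly k g"
proof -
  obtain c where "\<forall>\<^sub>F n in sequentially. f n = (\<Sum>j<k. c j * int (mchoose j n))"
    using assms(1) by (auto simp: ev_int_poly_def)
  then have "\<forall>\<^sub>F n in sequentially. g n = (\<Sum>j<k. c j * int (mchoose j n))"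
    using assms(2) by eventually_elim auto
  then show ?thesis by (auto simp: ev_int_poly_def)
qed

lemma ev_int_poly_add:
  assumes "ev_int_poly k f" "ev_int_poly k g" shows "ev_int_poly k (\<lambda>n. f n + g n)"
proof -
  obtain c d where "\<forall>\<^sub>F n in sequentially. f n = (\<Sum>j<k. c j * int (mchoose j n))"
    "\<forall>\<^sub>F n in sequentially. g n = (\<Sum>j<k. d j * int (mchoose j n))"
    using assms by (auto simp: ev_int_poly_def)
  then have "\<forall>\<^sub>F n in sequentially. f n + g n = (\<Sum>j<k. (c j + d j) * int (mchoose j n))"
    by eventually_elim (auto simp: algebra_simps sum.distrib)
  then show ?thesis unfolding ev_int_poly_def by (intro exI[of _ "\<lambda>j. c j + d j"])
qed

lemma ev_int_poly_0: "ev_int_poly k (\<lambda>_. 0)"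
  unfolding ev_int_poly_def by (rule exI[of _ "\<lambda>_. 0"]) simp

lemma ev_int_poly_sum:
  assumes "finite A" "\<And>x. x \<in> A \<Longrightarrow> ev_int_poly k (f x)" shows "ev_int_poly k (\<lambda>n. \<Sum>x\<in>A. f x n)"
  using assms by (induction rule: finite_induct) (auto simp: ev_int_poly_0 intro: ev_int_poly_add)

lemma ev_int_poly_mono:
  assumes "ev_int_poly k f" "k \<le> l" shows "ev_int_poly l f"
proof -
  obtain c where c: "\<forall>\<^sub>F n in sequentially. f n = (\<Sum>j<k. c j * int (mchoose j n))"
    using assms by (auto simp: ev_int_poly_def)
  have "(\<Sum>j<l. (if j < k then c j else 0) * int (mchoose j n)) = (\<Sum>j<k. c j * int (mchoose j n))" for n
    using assms(2) by (intro sum.mono_neutral_cong_right) auto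
  then show ?thesis using c unfolding ev_int_poly_def
    by (intro exI[of _ "\<lambda>j. if j < k then c j else 0"]) simp
qed

text \<open>By Pascal's rule the backward shift subtracts from every coefficient the next one and
  keeps the top one. In the final estimate this turns \<open>cJ D\<close> into
  \<open>cJ D - cJ d\<close>, the source of the term -e_0.\<close>

lemma mchoose_comb_pred:
  "(\<Sum>j<l. c j * int (mchoose j n)) =
    (\<Sum>j<l. (c j - (if Suc j < l then c (Suc j) else 0)) * int (mchoose j (Suc n)))"
proof (cases l)
  case (Suc m)
  have "(\<Sum>j<Suc m. c j * int (mchoose j n)) =
      c 0 + (\<Sum>j<m. c (Suc j) * (int (mchoose (Suc j) (Suc n)) - int (mchoose j (Suc n))))"
    unfolding sum.lessThan_Suc_shift by (simp add: mchoose_0 mchoose_Suc_Suc)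
  also have "\<dots> = (\<Sum>j<Suc m. c j * int (mchoose j (Suc n))) - (\<Sum>j<m. c (Suc j) * int (mchoose j (Suc n)))"
    unfolding sum.lessThan_Suc_shift by (simp add: mchoose_0 algebra_simps sum_subtractf)
  also have "(\<Sum>j<m. c (Suc j) * int (mchoose j (Suc n))) =
      (\<Sum>j<Suc m. (if j < m then c (Suc j) else 0) * int (mchoose j (Suc n)))" by simp
  finally show ?thesis by (simp add: Suc algebra_simps sum_subtractf)
qed simp

lemma eventually_mchoose_comb_pred:
  assumes "\<forall>\<^sub>F n in sequentially. f n = (\<Sum>j<k. c j * int (mchoose j n))"
  shows "\<forall>\<^sub>F n in sequentially. f (n - 1) =
    (\<Sum>j<k. (c j - (if Suc j < k then c (Suc j) else 0)) * int (mchoose j n))"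
proof -
  have "\<forall>\<^sub>F n in sequentially. f (n - 1) = (\<Sum>j<k. c j * int (mchoose j (n - 1)))"
    using assms unfolding eventually_sequentially
    by (metis le_diff_conv2 le_add2 order_trans add.commute)
  then show ?thesis using eventually_gt_at_top[of 0]
  proof eventually_elim
    case (elim n)
    then show ?case using mchoose_comb_pred[of c "n - 1" k] by simp
  qed
qed

lemma ev_int_poly_pred:
  assumes "ev_int_poly k f" shows "ev_int_poly k (\<lambda>n. f (n - 1))"
  using assms eventually_mchoose_comb_pred unfolding ev_int_poly_def by meson

lemma ev_int_poly_shift:
  assumes "ev_int_poly k f" shows "ev_int_poly k (\<lambda>n. f (n - m))"
proof (induction m)
  case (Suc m)
  from ev_int_poly_pred[OF this] show ?case by (simp add: diff_diff_add)
qed (simp add: assms)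

text \<open>Pascal's rule makes \<open>mchoose (Suc j)\<close> an antidifference of
  \<open>mchoose j\<close>, so the coefficients move up by one index and the constant of summation
  becomes the coefficient of \<open>mchoose 0\<close>.\<close>

lemma ev_int_poly_antidifference:
  assumes "ev_int_poly k (\<lambda>n. f (Suc n) - f n)" shows "ev_int_poly (Suc k) f"
proof -
  \<comment> \<open>Pascal's rule evaluates \<open>mchoose j\<close> at \<open>Suc n\<close>;
    expanding the difference at \<open>n - 1\<close> makes the arguments agree.\<close>
  have "ev_int_poly k (\<lambda>n. f (Suc (n - 1)) - f (n - 1))"
    using ev_int_poly_pred[OF assms] by simp
  then obtain c where "\<forall>\<^sub>F n in sequentially. f (Suc (n - 1)) - f (n - 1) = (\<Sum>j<k. c j * int (mchoose j n))"
    by (auto simp: ev_int_poly_def)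
  then obtain N where N: "\<And>n. n \<ge> N \<Longrightarrow> f (Suc (n - 1)) - f (n - 1) = (\<Sum>j<k. c j * int (mchoose j n))"
    unfolding eventually_sequentially by blast
  define K where "K = f N - (\<Sum>j<k. c j * int (mchoose (Suc j) N))"
  have "f n = K + (\<Sum>j<k. c j * int (mchoose (Suc j) n))" if "n \<ge> N" for n
    using that
  proof (induction n rule: dec_induct)
    case (step n)
    have "f (Suc n) = f n + (\<Sum>j<k. c j * int (mchoose j (Suc n)))" using N[of "Suc n"] step by simp
    then show ?case using step by (simp add: mchoose_Suc_Suc algebra_simps sum.distrib)
  qed (simp add: K_def)
  then have "\<forall>n\<ge>N. f n = (\<Sum>j<Suc k. (case j of 0 \<Rightarrow> K | Suc i \<Rightarrow> c i) * int (mchoose j n))"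
    unfolding sum.lessThan_Suc_shift by (simp add: mchoose_0)
  then show ?thesis unfolding ev_int_poly_def eventually_sequentially by blast
qed

text \<open>One coordinate is treated at a time: a subsequence is monotone in the new coordinate,
  and if it is antitone there, then it is constant from the point where its minimum is attained, so
  a tail of it is still nondecreasing.\<close>

lemma Dickson:
  fixes a :: "nat \<Rightarrow> nat \<Rightarrow> nat"
  shows "\<exists>\<phi>::nat \<Rightarrow> nat. strict_mono \<phi> \<and> (\<forall>i<k. mono (\<lambda>j. a (\<phi> j) i))"
proof (induction k)
  case 0
  then show ?case by (auto intro!: exI[of _ id] simp: strict_mono_def)
next
  case (Suc k)
  then obtain \<phi> :: "nat \<Rightarrow> nat" where \<phi>: "strict_mono \<phi>" "\<forall>i<k. mono (\<lambda>j. a (\<phi> j) i)" by blast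
  obtain g where g: "strict_mono g" "monoseq (\<lambda>j. a (\<phi> (g j)) k)"
    using seq_monosub[of "\<lambda>j. a (\<phi> j) k"] by (auto simp: o_def)
  have "\<exists>h::nat \<Rightarrow> nat. strict_mono h \<and> mono (\<lambda>j. a (\<phi> (g (h j))) k)"
  proof -
    obtain N where N: "\<And>n. n \<ge> N \<Longrightarrow> a (\<phi> (g n)) k \<ge> a (\<phi> (g N)) k"
      using ex_has_least_nat[of "\<lambda>_. True" 0 "\<lambda>n. a (\<phi> (g n)) k"] by auto
    show ?thesis using g(2) unfolding monoseq_def
    proof
      assume "\<forall>m. \<forall>n\<ge>m. a (\<phi> (g m)) k \<le> a (\<phi> (g n)) k"
      then show ?thesis by (intro exI[of _ "\<lambda>j. j"]) (auto simp: strict_mono_def mono_def)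
    next
      assume "\<forall>m. \<forall>n\<ge>m. a (\<phi> (g n)) k \<le> a (\<phi> (g m)) k"
      then have "a (\<phi> (g n)) k = a (\<phi> (g N)) k" if "n \<ge> N" for n using N that by (simp add: antisym)
      then have "mono (\<lambda>j. a (\<phi> (g (j + N))) k)" 
      proof (intro monoI)
        fix i j :: nat
        show "a (\<phi> (g (i + N))) k \<le> a (\<phi> (g (j + N))) k"
          using \<open>\<And>n. n \<ge> N \<Longrightarrow> a (\<phi> (g n)) k = a (\<phi> (g N)) k\<close>[of "i + N"]
            \<open>\<And>n. n \<ge> N \<Longrightarrow> a (\<phi> (g n)) k = a (\<phi> (g N)) k\<close>[of "j + N"] by simp
      qed
      moreover have "strict_mono (\<lambda>j. j + N)" by (simp add: strict_mono_def)
      ultimately show ?thesis by blast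
    qed
  qed
  then obtain h :: "nat \<Rightarrow> nat" where h: "strict_mono h" "mono (\<lambda>j. a (\<phi> (g (h j))) k)" by blast
  have gh: "strict_mono (g \<circ> h)" using g(1) h(1) by (simp add: strict_mono_o)
  have "mono (\<lambda>j. a (\<phi> (g (h j))) i)" if "i < Suc k" for i
  proof (cases "i = k")
    case False
    then have "mono (\<lambda>j. a (\<phi> j) i)" using that \<phi>(2) by simp
    then show ?thesis using strict_mono_mono[OF gh] by (auto simp: mono_def)
  qed (use h in simp)
  moreover have "strict_mono (\<phi> \<circ> (g \<circ> h))" using \<phi>(1) gh by (rule strict_mono_o)
  ultimately show ?case by (intro exI[of _ "\<phi> \<circ> (g \<circ> h)"]) (auto simp: o_def)
qed

text \<open>If the dependence on the index never stopped, iterating counterexamples would give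
  indices and vectors at which the value drops strictly. On a subsequence that is monotone in all
  coordinates these drops chain up to an infinite descent in the naturals. The point is that one
  \<open>j0\<close> works for all of \<open>S\<close>.\<close>

lemma antitone_stationary:
  fixes g :: "nat \<Rightarrow> (nat \<Rightarrow> nat) \<Rightarrow> nat"
  assumes anti: "\<And>i j a b. i \<le> j \<Longrightarrow> \<forall>l<k. a l \<le> b l \<Longrightarrow> a \<in> S \<Longrightarrow> b \<in> S \<Longrightarrow> g j b \<le> g i a"
  shows "\<exists>j0. \<forall>j\<ge>j0. \<forall>a\<in>S. g j a = g j0 a"
proof (rule ccontr)
  assume "\<not> ?thesis"
  then have "\<forall>j0. \<exists>j a. j \<ge> j0 \<and> a \<in> S \<and> g j a \<noteq> g j0 a" by blast
  then have "\<forall>j0. \<exists>j a. j \<ge> j0 \<and> a \<in> S \<and> g j a < g j0 a"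
    using anti by (metis le_neq_implies_less order_refl)
  \<comment> \<open>\<open>J j\<close> and \<open>A j\<close> witness a strict drop after the index
    \<open>j\<close>; \<open>s\<close> iterates \<open>J\<close>, so each drop starts at the index
    where the former ended.\<close>
  then obtain J A where JA: "\<And>j. J j \<ge> j" "\<And>j. A j \<in> S" "\<And>j. g (J j) (A j) < g j (A j)" by metis
  define s where "s = rec_nat 0 (\<lambda>_. J)"
  have s: "s (Suc n) = J (s n)" for n by (simp add: s_def)
  have "mono s" unfolding mono_iff_le_Suc by (auto simp: s JA)
  obtain \<phi> :: "nat \<Rightarrow> nat" where \<phi>: "strict_mono \<phi>" "\<forall>i<k. mono (\<lambda>j. A (s (\<phi> j)) i)"
    using Dickson[of k "\<lambda>n. A (s n)"] by blast
  have "g (s (\<phi> (Suc n))) (A (s (\<phi> (Suc n)))) < g (s (\<phi> n)) (A (s (\<phi> n)))" for n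
  proof -
    have "Suc (\<phi> n) \<le> \<phi> (Suc n)" using \<phi>(1) by (simp add: strict_mono_Suc_iff Suc_le_eq)
    then have "J (s (\<phi> n)) \<le> s (\<phi> (Suc n))" using \<open>mono s\<close> s by (metis monoD)
    then have "g (s (\<phi> (Suc n))) (A (s (\<phi> (Suc n)))) \<le> g (J (s (\<phi> n))) (A (s (\<phi> n)))"
      using \<phi>(2) by (intro anti) (auto simp: JA mono_def)
    also have "\<dots> < g (s (\<phi> n)) (A (s (\<phi> n)))" by (rule JA)
    finally show ?thesis .
  qed
  then show False
    using wf_no_infinite_down_chainE[OF wf_less, of "\<lambda>n. g (s (\<phi> n)) (A (s (\<phi> n)))"] by auto
qed

text \<open>Induction on the number of variables. Once the last exponent is at least
  \<open>j0\<close> the summand no longer depends on it, so these slices add up to an antidifference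
  of a function in one variable fewer; the finitely many other slices are shifts of such
  functions.\<close>

proposition ev_int_poly_sum_exps:
  fixes g :: "(nat \<Rightarrow> nat) \<Rightarrow> nat"
  assumes "\<And>a b. \<forall>i\<ge>k. a i = 0 \<Longrightarrow> \<forall>i\<ge>k. b i = 0 \<Longrightarrow> (\<And>i. a i \<le> b i) \<Longrightarrow> g b \<le> g a"
  shows "ev_int_poly k (\<lambda>n. \<Sum>a\<in>exps k n. int (g a))"
  using assms
proof (induction k arbitrary: g)
  case 0
  have "\<forall>\<^sub>F n in sequentially. 0 = (\<Sum>a\<in>exps 0 n. int (g a))"
    using eventually_gt_at_top[of 0] by eventually_elim (auto simp: exps_0)
  then show ?case by (rule ev_int_poly_cong[OF ev_int_poly_0])
next
  case (Suc k)
  define S where "S = {a::nat \<Rightarrow> nat. \<forall>i\<ge>k. a i = 0}"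
  have anti: "g (b(k := j)) \<le> g (a(k := i))"
    if "i \<le> j" "\<forall>l<k. a l \<le> b l" "a \<in> S" "b \<in> S" for i j a b
  proof (rule Suc.prems)
    show "(a(k := i)) l \<le> (b(k := j)) l" for l
      using that by (cases l k rule: linorder_cases) (auto simp: S_def)
  qed (use that in \<open>auto simp: S_def\<close>)
  obtain j1 where j1: "\<And>j a. j \<ge> j1 \<Longrightarrow> a \<in> S \<Longrightarrow> g (a(k := j)) = g (a(k := j1))"
    using antitone_stationary[where g = "\<lambda>j a. g (a(k := j))" and k = k and S = S] anti by blast
  \<comment> \<open>One beyond the threshold, so that \<open>G (n - j1)\<close>, a sum strictly
    below \<open>n - j1\<close>, runs over exactly the degrees up to \<open>n - j0\<close>.\<close>
  define j0 where "j0 = Suc j1"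
  have j0: "g (a(k := j)) = g (a(k := j0))" if "j \<ge> j0" "a \<in> S" for j a
    using j1[of j a] j1[of j0 a] that by (simp add: j0_def)
  have hp: "ev_int_poly k (\<lambda>n. \<Sum>a\<in>exps k n. int (g (a(k := j))))" for j
    by (rule Suc.IH, rule anti) (auto simp: S_def)
  have sS: "a \<in> S" if "a \<in> exps k n" for a n using that by (auto simp: S_def exps_def)
  define G where "G n = (\<Sum>m<n. \<Sum>a\<in>exps k m. int (g (a(k := j0))))" for n
  have hG: "ev_int_poly (Suc k) G"
    by (rule ev_int_poly_antidifference) (use hp in \<open>simp add: G_def\<close>)
  have "\<forall>\<^sub>F n in sequentially. (\<Sum>j<j0. \<Sum>a\<in>exps k (n - j). int (g (a(k := j)))) + G (n - j1)
      = (\<Sum>a\<in>exps (Suc k) n. int (g a))"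
    using eventually_ge_at_top[of j0]
  proof eventually_elim
    case (elim n)
    have "{..n} = {..<j0} \<union> {j0..n}" using elim by auto
    then have "(\<Sum>a\<in>exps (Suc k) n. int (g a)) = (\<Sum>j<j0. \<Sum>a\<in>exps k (n - j). int (g (a(k := j))))
        + (\<Sum>j=j0..n. \<Sum>a\<in>exps k (n - j). int (g (a(k := j))))"
      unfolding sum_exps_Suc by (auto simp: intro!: sum.union_disjoint)
    also have "(\<Sum>j=j0..n. \<Sum>a\<in>exps k (n - j). int (g (a(k := j)))) = G (n - j1)"
    proof -
      have *: "{..<n - j1} = {..n - j0}" using elim by (auto simp: j0_def)
      have "(\<Sum>j=j0..n. \<Sum>a\<in>exps k (n - j). int (g (a(k := j))))
          = (\<Sum>j=j0..n. \<Sum>a\<in>exps k (n - j). int (g (a(k := j0))))"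
        by (intro sum.cong refl arg_cong[where f = int] j0) (auto dest: sS)
      also have "\<dots> = G (n - j1)" unfolding G_def *
        by (rule sum.reindex_bij_witness[where i = "\<lambda>m. n - m" and j = "\<lambda>j. n - j"])
           (use elim in auto)
      finally show ?thesis .
    qed
    finally show ?case ..
  qed
  moreover have "ev_int_poly (Suc k) (\<lambda>n. (\<Sum>j<j0. \<Sum>a\<in>exps k (n - j). int (g (a(k := j)))) + G (n - j1))"
  proof (intro ev_int_poly_add ev_int_poly_sum)
    show "ev_int_poly (Suc k) (\<lambda>n. \<Sum>a\<in>exps k (n - j). int (g (a(k := j))))" for j
      using ev_int_poly_mono[OF ev_int_poly_shift[OF hp[of j], of j]] by simp
    show "ev_int_poly (Suc k) (\<lambda>n. G (n - j1))" by (rule ev_int_poly_shift[OF hG])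
  qed simp
  ultimately show ?case by (rule ev_int_poly_cong[rotated])
qed

section \<open>Integer-valued polynomials and their growth\<close>

lemma mchoose_real: "real (mchoose j n) = (\<Prod>i<j. real n + real i) / fact j"
proof (induction j)
  case (Suc j)
  have "Suc j * mchoose (Suc j) n = (n + j) * mchoose j n"
    unfolding mchoose_def
  proof (cases n)
    case 0
    then show "Suc j * ((n + Suc j - 1) choose Suc j) = (n + j) * ((n + j - 1) choose j)"
      by (cases j) (auto simp: binomial_eq_0)
  next
    case (Suc m)
    then show "Suc j * ((n + Suc j - 1) choose Suc j) = (n + j) * ((n + j - 1) choose j)"
      using Suc_times_binomial[of j "m + j"] by simp
  qed
  then have "real (Suc j) * real (mchoose (Suc j) n) = real (n + j) * real (mchoose j n)"
    by (metis of_nat_mult)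
  then have "real (mchoose (Suc j) n) = real (n + j) * real (mchoose j n) / real (Suc j)"
    by (simp add: eq_divide_eq mult.commute del: of_nat_Suc)
  then show ?case unfolding Suc by (simp add: mult.commute)
qed (simp add: mchoose_0)

definition mchoose_poly :: "nat \<Rightarrow> real poly" where
  "mchoose_poly j = Polynomial.smult (1 / fact j) (\<Prod>i<j. [:real i, 1:])"

lemma poly_mchoose_poly: "poly (mchoose_poly j) (real n) = real (mchoose j n)"
  by (simp add: mchoose_poly_def mchoose_real poly_prod add.commute)

lemma degree_mchoose_poly: "degree (mchoose_poly j) = j"
  by (simp add: mchoose_poly_def degree_prod_eq_sum_degree)

lemma coeff_mchoose_poly_top: "Polynomial.coeff (mchoose_poly j) j = 1 / fact j"
proof -
  have "lead_coeff (mchoose_poly j) = 1 / fact j"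
    by (simp add: mchoose_poly_def lead_coeff_smult lead_coeff_prod)
  then show ?thesis by (simp add: degree_mchoose_poly)
qed

lemma tendsto_poly_div_power:
  assumes "degree (p::real poly) \<le> D"
  shows "(\<lambda>n. poly p (real n) / real n ^ D) \<longlonglongrightarrow> Polynomial.coeff p D"
proof -
  have "(\<lambda>n. real n ^ i / real n ^ D) \<longlonglongrightarrow> (if i = D then 1 else 0)" if "i \<le> D" for i
  proof (cases "i = D")
    case True
    then show ?thesis
      by (auto intro!: tendsto_eventually eventually_mono[OF eventually_gt_at_top[of 0]])
  next
    case False
    then have "(\<lambda>n. inverse (real n) ^ (D - i)) \<longlonglongrightarrow> 0 ^ (D - i)"
      by (intro tendsto_power lim_inverse_n)
    then have "(\<lambda>n. inverse (real n) ^ (D - i)) \<longlonglongrightarrow> 0" using that False by (simp add: power_0_left)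
    moreover have "\<forall>\<^sub>F n in sequentially. inverse (real n) ^ (D - i) = real n ^ i / real n ^ D"
      using eventually_gt_at_top[of 0]
    proof eventually_elim
      case (elim n)
      then show ?case using that by (simp add: power_diff field_simps power_inverse)
    qed
    ultimately show ?thesis using False by (simp add: tendsto_cong)
  qed
  then have "(\<lambda>n. \<Sum>i\<le>D. Polynomial.coeff p i * (real n ^ i / real n ^ D)) \<longlonglongrightarrow> (\<Sum>i\<le>D. Polynomial.coeff p i * (if i = D then 1 else 0))"
    by (intro tendsto_sum tendsto_mult tendsto_const) auto
  moreover have "(\<Sum>i\<le>D. Polynomial.coeff p i * (if i = D then 1 else 0)) = Polynomial.coeff p D"
    by (subst sum.remove[of _ D]) auto
  moreover have "(\<Sum>i\<le>D. Polynomial.coeff p i * (real n ^ i / real n ^ D)) = poly p (real n) / real n ^ D" for n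
    unfolding poly_altdef sum_divide_distrib
    by (rule sum.mono_neutral_cong_right) (use assms in \<open>auto simp: coeff_eq_0\<close>)
  ultimately show ?thesis by simp
qed

definition mchoose_comb :: "nat \<Rightarrow> (nat \<Rightarrow> int) \<Rightarrow> real poly" where
  "mchoose_comb D c = (\<Sum>j\<le>D. Polynomial.smult (of_int (c j)) (mchoose_poly j))"

lemma poly_mchoose_comb: "poly (mchoose_comb D c) (real n) = of_int (\<Sum>j<Suc D. c j * int (mchoose j n))"
  by (simp add: mchoose_comb_def poly_sum poly_mchoose_poly lessThan_Suc_atMost)

lemma degree_mchoose_comb: "degree (mchoose_comb D c) \<le> D"
  unfolding mchoose_comb_def
  by (rule degree_sum_le) (auto intro: order_trans[OF degree_smult_le] simp: degree_mchoose_poly)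

lemma coeff_mchoose_comb: "Polynomial.coeff (mchoose_comb D c) D = of_int (c D) / fact D"
proof -
  have "Polynomial.coeff (mchoose_comb D c) D = (\<Sum>j\<le>D. of_int (c j) * Polynomial.coeff (mchoose_poly j) D)"
    by (simp add: mchoose_comb_def coeff_sum)
  also have "\<dots> = of_int (c D) * Polynomial.coeff (mchoose_poly D) D"
    by (subst sum.remove[of _ D]) (auto intro!: sum.neutral coeff_eq_0 simp: degree_mchoose_poly)
  finally show ?thesis by (simp add: coeff_mchoose_poly_top)
qed

lemma tendsto_mchoose_comb:
  assumes "\<forall>\<^sub>F n in sequentially. f n = (\<Sum>j<Suc D. c j * int (mchoose j n))"
  shows "(\<lambda>n. of_int (f n) / real n ^ D) \<longlonglongrightarrow> of_int (c D) / fact D"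
proof -
  have "\<forall>\<^sub>F n in sequentially. poly (mchoose_comb D c) (real n) / real n ^ D = of_int (f n) / real n ^ D"
    using assms by eventually_elim (simp only: poly_mchoose_comb)
  then show ?thesis
    using tendsto_poly_div_power[OF degree_mchoose_comb, of D c] unfolding coeff_mchoose_comb
    by (rule Lim_transform_eventually[rotated])
qed

text \<open>The quotient of \<open>f n\<close> by \<open>n ^ k\<close> tends to the top coefficient
  divided by k!, but to 0 when k exceeds d, so surplus coefficients vanish one after the other. This
  is needed because filtering by monomials bounds the degree only by the number of
  generators.\<close>

lemma ev_int_poly_reduce:
  assumes "ev_int_poly k f" and bound: "\<forall>\<^sub>F n in sequentially. \<bar>real_of_int (f n)\<bar> \<le> C * real n ^ d"
  shows "ev_int_poly (Suc d) f"
  using assms(1)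
proof (induction k)
  case 0
  then show ?case by (rule ev_int_poly_mono) simp
next
  case (Suc k)
  show ?case
  proof (cases "k \<le> d")
    case True
    then show ?thesis using Suc.prems by (auto intro: ev_int_poly_mono)
  next
    case False
    obtain c where c: "\<forall>\<^sub>F n in sequentially. f n = (\<Sum>j<Suc k. c j * int (mchoose j n))"
      using Suc.prems by (auto simp: ev_int_poly_def)
    have l: "(\<lambda>n. of_int (f n) / real n ^ k) \<longlonglongrightarrow> of_int (c k) / fact k"
      by (rule tendsto_mchoose_comb[OF c])
    have "(\<lambda>n. of_int (f n) / real n ^ k) \<longlonglongrightarrow> 0"
    proof (rule tendsto_0_le[where K = 1])
      show "\<forall>\<^sub>F n in sequentially. norm (of_int (f n) / real n ^ k) \<le> norm (C * inverse (real n)) * 1"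
        using bound eventually_gt_at_top[of 0]
      proof eventually_elim
        case (elim n)
        have C: "C * real n ^ d \<ge> 0" using elim(1) by linarith
        obtain m where m: "k = d + Suc m" using False less_imp_Suc_add[of d k] by auto
        have n1: "real n ^ m \<ge> 1" using elim(2) by simp
        have "\<bar>real_of_int (f n)\<bar> \<le> C * real n ^ d * real n ^ m"
          using mult_left_mono[OF n1 C] elim(1) by simp
        then have "norm (of_int (f n) / real n ^ k) \<le> C * inverse (real n)"
          using elim(2) by (simp add: m power_add divide_simps ac_simps)
        then show ?case by simp
      qed
      show "(\<lambda>n. C * inverse (real n)) \<longlonglongrightarrow> 0"
        by (intro tendsto_mult_right_zero lim_inverse_n)
    qed
    from LIMSEQ_unique[OF l this] have "c k = 0" by simp
    then have "ev_int_poly k f" using c by (auto simp: ev_int_poly_def)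
    then show ?thesis by (rule Suc.IH)
  qed
qed

section \<open>Reading off Hilbert coefficients and Hilbert polynomials\<close>

lemma mchoose_comb_unique:
  assumes "\<forall>\<^sub>F n in sequentially. (\<Sum>j<k. c j * int (mchoose j n)) = (\<Sum>j<k. c' j * int (mchoose j n))"
  shows "\<forall>j<k. c j = c' j"
  using assms
proof (induction k)
  case (Suc k)
  have "\<forall>\<^sub>F n in sequentially. 0 = (\<Sum>j<Suc k. (c j - c' j) * int (mchoose j n))"
    using Suc.prems by eventually_elim (simp add: left_diff_distrib sum_subtractf)
  from tendsto_mchoose_comb[OF this] have "(\<lambda>n. 0) \<longlonglongrightarrow> real_of_int (c k - c' k) / fact k" by simp
  then have "c k = c' k" using LIMSEQ_unique[OF tendsto_const] by fastforce
  moreover from this Suc.prems have "\<forall>\<^sub>F n in sequentially. (\<Sum>j<k. c j * int (mchoose j n)) = (\<Sum>j<k. c' j * int (mchoose j n))"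
    by simp
  ultimately show ?case using Suc.IH less_Suc_eq by auto
qed simp

text \<open>Uniqueness of the expansion in the basis \<open>mchoose\<close> resolves the definite
  description; the index is reversed because \<open>e i\<close> belongs to the binomial of degree
  \<open>d - i\<close>.\<close>

lemma hilbert_coeff_eqI:
  fixes R :: "('a, 'b) ring_scheme"
  assumes c: "\<forall>\<^sub>F n in sequentially. int (colength R (ideal_power R I n)) = (\<Sum>j<Suc d. c j * int (mchoose j n))"
    and i: "i \<le> d"
  shows "hilbert_coeff R d I i = (-1) ^ i * c (d - i)"
proof -
  define e0 where "e0 i = (if i \<le> d then (-1) ^ i * c (d - i) else 0)" for i
  have *: "(\<Sum>i\<le>d. (-1) ^ i * e i * int ((n + d - 1 - i) choose (d - i)))
      = (\<Sum>j<Suc d. ((-1) ^ (d - j) * e (d - j)) * int (mchoose j n))" for e n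
    by (rule sum.reindex_bij_witness[where i = "\<lambda>j. d - j" and j = "\<lambda>j. d - j"])
       (auto simp: mchoose_def)
  have "hilbert_coeff R d I = e0"
    unfolding hilbert_coeff_def
  proof (rule the_equality, intro conjI allI impI)
    have "(\<Sum>j<Suc d. ((-1) ^ (d - j) * e0 (d - j)) * int (mchoose j n)) = (\<Sum>j<Suc d. c j * int (mchoose j n))" for n
      by (rule sum.cong) (auto simp: e0_def mult.assoc[symmetric] power_add[symmetric])
    then show "\<forall>\<^sub>F n in sequentially. int (colength R (ideal_power R I n)) =
        (\<Sum>i\<le>d. (-1) ^ i * e0 i * int ((n + d - 1 - i) choose (d - i)))"
      unfolding * using c by simp
  next
    fix e :: "nat \<Rightarrow> int"
    assume e: "(\<forall>i>d. e i = 0) \<and>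
     (\<forall>\<^sub>F n in sequentially. int (colength R (ideal_power R I n)) =
        (\<Sum>i\<le>d. (-1) ^ i * e i * int ((n + d - 1 - i) choose (d - i))))"
    have "\<forall>\<^sub>F n in sequentially. (\<Sum>j<Suc d. c j * int (mchoose j n))
        = (\<Sum>j<Suc d. ((-1) ^ (d - j) * e (d - j)) * int (mchoose j n))"
      using c conjunct2[OF e] by eventually_elim (simp only: *)
    then have u: "\<forall>j<Suc d. c j = (-1) ^ (d - j) * e (d - j)" by (rule mchoose_comb_unique)
    show "e = e0"
    proof
      fix i show "e i = e0 i"
      proof (cases "i \<le> d")
        case True
        then have "c (d - i) = (-1) ^ i * e i" using u[rule_format, of "d - i"] by simp
        then show ?thesis using True by (simp add: e0_def mult.assoc[symmetric] power_add[symmetric])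
      qed (use e in \<open>auto simp: e0_def\<close>)
    qed
  qed (simp add: e0_def)
  then show ?thesis using i by (simp add: e0_def)
qed

lemma hilbert_poly_eqI:
  assumes "\<forall>\<^sub>F n in sequentially. real (H n) = poly p (real n)"
  shows "hilbert_poly H = p"
  unfolding hilbert_poly_def
proof (rule the_equality)
  show "\<forall>\<^sub>F n in sequentially. real (H n) = poly p (real n)" by (rule assms)
next
  fix q :: "real poly" assume "\<forall>\<^sub>F n in sequentially. real (H n) = poly q (real n)"
  then have "\<forall>\<^sub>F n in sequentially. poly (q - p) (real n) = 0" using assms by eventually_elim simp
  then obtain N where N: "\<forall>n\<ge>N. poly (q - p) (real n) = 0" by (auto simp: eventually_sequentially)
  have "q - p = 0"
  proof (rule ccontr)
    assume "q - p \<noteq> 0"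
    then have "finite {x. poly (q - p) x = 0}" by (rule poly_roots_finite)
    moreover have "real ` {N..} \<subseteq> {x. poly (q - p) x = 0}" using N by auto
    ultimately have "finite (real ` {N..})" by (rule finite_subset[rotated])
    then show False using finite_imageD[of real "{N..}"] infinite_Ici by (auto simp: inj_on_def)
  qed
  then show "q = p" by simp
qed

section \<open>Colength of ideals\<close>

definition set_chain :: "'x set set \<Rightarrow> nat \<Rightarrow> (nat \<Rightarrow> 'x set) \<Rightarrow> bool" where
  "set_chain F n C \<longleftrightarrow> (\<forall>i\<le>n. C i \<in> F) \<and> (\<forall>i<n. C i \<subset> C (Suc i))"

text \<open>Common form of the Krull dimension, with the primes as family, and of the length of a
  module, with its submodules as family. The length of R/A is later computed from the family of
  ideals above A.\<close>

definition height :: "'x set set \<Rightarrow> enat" where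
  "height F = Sup {enat n | n. \<exists>C. set_chain F n C}"

lemma height_leI: "(\<And>n C. set_chain F n C \<Longrightarrow> enat n \<le> h) \<Longrightarrow> height F \<le> h"
  unfolding height_def by (rule Sup_least) auto

lemma le_height: "set_chain F n C \<Longrightarrow> enat n \<le> height F"
  unfolding height_def by (rule Sup_upper) auto

lemma height_attained:
  assumes "height F = enat n" "F \<noteq> {}" shows "\<exists>C. set_chain F n C"
proof (rule ccontr)
  assume no: "\<not> ?thesis"
  obtain A where A: "A \<in> F" using assms by auto
  then have "set_chain F 0 (\<lambda>_. A)" by (simp add: set_chain_def)
  then have "n > 0" using no by (cases n) auto
  have "height F \<le> enat (n - 1)"
  proof (rule height_leI)
    fix m C assume C: "set_chain F m C"
    then have "m \<le> n" using le_height[OF C] assms by simp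
    moreover have "m \<noteq> n" using C no by blast
    ultimately show "enat m \<le> enat (n - 1)" by simp
  qed
  then show False using \<open>n > 0\<close> assms by simp
qed

lemma set_chain_map:
  assumes "set_chain F n C" "\<And>A. A \<in> F \<Longrightarrow> f A \<in> G"
    "\<And>A B. A \<in> F \<Longrightarrow> B \<in> F \<Longrightarrow> A \<subset> B \<Longrightarrow> f A \<subset> f B"
  shows "set_chain G n (\<lambda>i. f (C i))"
  using assms unfolding set_chain_def by (metis Suc_leI less_imp_le)

lemma height_mono_map:
  assumes "\<And>A. A \<in> F \<Longrightarrow> f A \<in> G"
    "\<And>A B. A \<in> F \<Longrightarrow> B \<in> F \<Longrightarrow> A \<subset> B \<Longrightarrow> f A \<subset> f B"
  shows "height F \<le> height G"
proof (rule height_leI)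
  fix n C assume "set_chain F n C"
  then have "set_chain G n (\<lambda>i. f (C i))" using assms by (rule set_chain_map)
  then show "enat n \<le> height G" by (rule le_height)
qed

text \<open>Repetitions are dropped from a weakly increasing chain. The clause on the last member is
  what lets the induction append the next set.\<close>

lemma set_chain_of_weak:
  assumes "\<And>i. i \<le> n \<Longrightarrow> C i \<in> F" "\<And>i. i < n \<Longrightarrow> C i \<subseteq> C (Suc i)"
  shows "\<exists>D. set_chain F (card {i. i < n \<and> C i \<noteq> C (Suc i)}) D
    \<and> D (card {i. i < n \<and> C i \<noteq> C (Suc i)}) = C n"
  using assms
proof (induction n)
  case 0
  then show ?case by (auto simp: set_chain_def)
next
  case (Suc n)
  define k where "k = card {i. i < n \<and> C i \<noteq> C (Suc i)}"
  have "\<exists>D. set_chain F k D \<and> D k = C n"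
    unfolding k_def using Suc.prems by (intro Suc.IH) auto
  then obtain D where D: "set_chain F k D" "D k = C n" by blast
  show ?case
  proof (cases "C n = C (Suc n)")
    case True
    then have "{i. i < Suc n \<and> C i \<noteq> C (Suc i)} = {i. i < n \<and> C i \<noteq> C (Suc i)}"
      using less_Suc_eq by auto
    then have "card {i. i < Suc n \<and> C i \<noteq> C (Suc i)} = k" by (simp add: k_def)
    then show ?thesis using D True by metis
  next
    case False
    then have "{i. i < Suc n \<and> C i \<noteq> C (Suc i)} = insert n {i. i < n \<and> C i \<noteq> C (Suc i)}"
      using less_Suc_eq by auto
    then have k: "card {i. i < Suc n \<and> C i \<noteq> C (Suc i)} = Suc k" by (simp add: k_def)
    have sub: "C n \<subset> C (Suc n)" using False Suc.prems(2)[of n] by auto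
    have "set_chain F (Suc k) (D(Suc k := C (Suc n)))"
      using D sub Suc.prems(1)[of "Suc n"] by (auto simp: set_chain_def le_Suc_eq less_Suc_eq)
    then show ?thesis unfolding k by (metis fun_upd_same)
  qed
qed

text \<open>Every step of a chain stays strict under \<open>f\<close> or under \<open>g\<close>, so
  its length is at most the number of strict steps in the two images together.\<close>

lemma height_le_add:
  assumes f: "\<And>A. A \<in> F \<Longrightarrow> f A \<in> G" "\<And>A B. A \<in> F \<Longrightarrow> B \<in> F \<Longrightarrow> A \<subset> B \<Longrightarrow> f A \<subseteq> f B"
    and g: "\<And>A. A \<in> F \<Longrightarrow> g A \<in> H" "\<And>A B. A \<in> F \<Longrightarrow> B \<in> F \<Longrightarrow> A \<subset> B \<Longrightarrow> g A \<subseteq> g B"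
    and fg: "\<And>A B. A \<in> F \<Longrightarrow> B \<in> F \<Longrightarrow> A \<subset> B \<Longrightarrow> f A \<noteq> f B \<or> g A \<noteq> g B"
  shows "height F \<le> height G + height H"
proof (rule height_leI)
  fix n C assume C: "set_chain F n C"
  then have CF: "\<And>i. i \<le> n \<Longrightarrow> C i \<in> F" "\<And>i. i < n \<Longrightarrow> C i \<subset> C (Suc i)" by (auto simp: set_chain_def)
  let ?f = "{i. i < n \<and> f (C i) \<noteq> f (C (Suc i))}" and ?g = "{i. i < n \<and> g (C i) \<noteq> g (C (Suc i))}"
  have "\<exists>D. set_chain G (card ?f) D"
    using set_chain_of_weak[of n "\<lambda>i. f (C i)" G] CF f by (metis Suc_leI less_imp_le)
  then have 1: "enat (card ?f) \<le> height G" using le_height by blast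
  have "\<exists>D. set_chain H (card ?g) D"
    using set_chain_of_weak[of n "\<lambda>i. g (C i)" H] CF g by (metis Suc_leI less_imp_le)
  then have 2: "enat (card ?g) \<le> height H" using le_height by blast
  have "{..<n} \<subseteq> ?f \<union> ?g" using fg CF by auto
  then have "n \<le> card (?f \<union> ?g)" using card_mono[of "?f \<union> ?g" "{..<n}"] by simp
  also have "\<dots> \<le> card ?f + card ?g" by (rule card_Un_le)
  finally have "enat n \<le> enat (card ?f) + enat (card ?g)" by simp
  also have "\<dots> \<le> height G + height H" using 1 2 by (rule add_mono)
  finally show "enat n \<le> height G + height H" .
qed

lemma height_add_le:
  assumes ne: "G \<noteq> {}" "H \<noteq> {}"
    and f: "\<And>A. A \<in> G \<Longrightarrow> f A \<in> F" "\<And>A B. A \<in> G \<Longrightarrow> B \<in> G \<Longrightarrow> A \<subset> B \<Longrightarrow> f A \<subset> f B"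
    and HF: "H \<subseteq> F" and fH: "\<And>A B. A \<in> G \<Longrightarrow> B \<in> H \<Longrightarrow> f A \<subseteq> B"
  shows "height G + height H \<le> height F"
proof (cases "height F")
  case (enat N)
  have "height G \<le> height F" by (rule height_mono_map[of G f]) (use f in auto)
  moreover have "height H \<le> height F" by (rule height_mono_map[of H "\<lambda>A. A"]) (use HF in auto)
  ultimately obtain n m where nm: "height G = enat n" "height H = enat m"
    using enat by (metis enat_ile)
  obtain C D where C: "set_chain G n C" and D: "set_chain H m D"
    using height_attained nm ne by metis
  \<comment> \<open>The top member \<open>f (C n)\<close> of the lower chain is replaced by
    \<open>D 0\<close>, which contains it. The step into \<open>D 0\<close> is then strict without
    any assumption at the joint, and the lengths add up.\<close>
  define E where "E i = (if i < n then f (C i) else D (i - n))" for i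
  have "set_chain F (n + m) E"
    unfolding set_chain_def
  proof (intro conjI allI impI)
    fix i assume "i \<le> n + m"
    then show "E i \<in> F" using C D f(1) HF by (auto simp: E_def set_chain_def)
  next
    fix i assume i: "i < n + m"
    consider "Suc i < n" | "Suc i = n" | "i \<ge> n" by linarith
    then show "E i \<subset> E (Suc i)"
    proof cases
      case 1 then show ?thesis using C f(2) by (auto simp: E_def set_chain_def)
    next
      case 2
      then have Ci: "C i \<in> G" "C (Suc i) \<in> G" "C i \<subset> C (Suc i)" "D 0 \<in> H"
        using C D unfolding set_chain_def by auto
      have "f (C i) \<subset> f (C (Suc i))" using Ci by (intro f(2))
      moreover have "f (C (Suc i)) \<subseteq> D 0" using Ci by (intro fH)
      moreover have "E i = f (C i)" "E (Suc i) = D 0" using 2 by (auto simp: E_def)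
      ultimately show ?thesis by simp
    next
      case 3 then show ?thesis using D i by (auto simp: E_def set_chain_def Suc_diff_le)
    qed
  qed
  from le_height[OF this] show ?thesis by (simp add: nm)
qed simp

lemma krull_dim_height: "krull_dim R = height {P. primeideal P R}"
  unfolding krull_dim_def height_def set_chain_def by simp

lemma module_length_height: "module_length R M = height {N. submodule N R M}"
  unfolding module_length_def height_def set_chain_def by simp

definition over_ideals :: "('a, 'b) ring_scheme \<Rightarrow> 'a set \<Rightarrow> 'a set set" where
  "over_ideals R A = {C. ideal C R \<and> A \<subseteq> C}"

definition colon :: "('a, 'b) ring_scheme \<Rightarrow> 'a set \<Rightarrow> 'a \<Rightarrow> 'a set" where
  "colon R A x = {r \<in> carrier R. r \<otimes>\<^bsub>R\<^esub> x \<in> A}"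

definition finite_colength :: "('a, 'b) ring_scheme \<Rightarrow> 'a set \<Rightarrow> bool" where
  "finite_colength R A \<longleftrightarrow> ideal A R \<and> height (over_ideals R A) \<noteq> \<infinity>"

section \<open>Ideals, colon ideals and additivity of length\<close>

context ring
begin

lemma ideal_subset_carrier: "ideal A R \<Longrightarrow> A \<subseteq> carrier R"
  by (auto intro: ideal.Icarr)

lemma ideal_carr: "ideal A R \<Longrightarrow> a \<in> A \<Longrightarrow> a \<in> carrier R"
  by (rule ideal.Icarr)

lemma ideal_add: "ideal A R \<Longrightarrow> a \<in> A \<Longrightarrow> b \<in> A \<Longrightarrow> a \<oplus> b \<in> A"
  by (simp add: additive_subgroup.a_closed ideal.axioms(1))

lemma ideal_zero: "ideal A R \<Longrightarrow> \<zero> \<in> A"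
  by (simp add: additive_subgroup.zero_closed ideal.axioms(1))

lemma ideal_neg: "ideal A R \<Longrightarrow> a \<in> A \<Longrightarrow> \<ominus> a \<in> A"
  by (simp add: additive_subgroup.a_inv_closed ideal.axioms(1) abelian_group.axioms)

lemma ideal_mult: "ideal A R \<Longrightarrow> a \<in> A \<Longrightarrow> r \<in> carrier R \<Longrightarrow> r \<otimes> a \<in> A"
  by (simp add: ideal.I_l_closed)

lemma ideal_mult_right: "ideal A R \<Longrightarrow> a \<in> A \<Longrightarrow> r \<in> carrier R \<Longrightarrow> a \<otimes> r \<in> A"
  by (simp add: ideal.I_r_closed)

end

lemma (in cring) idealI_comm:
  assumes "A \<subseteq> carrier R" "\<zero> \<in> A" "\<And>a b. a \<in> A \<Longrightarrow> b \<in> A \<Longrightarrow> a \<oplus> b \<in> A"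
    "\<And>a r. a \<in> A \<Longrightarrow> r \<in> carrier R \<Longrightarrow> r \<otimes> a \<in> A"
  shows "ideal A R"
proof (rule idealI)
  show "subgroup A (add_monoid R)"
  proof (rule add.subgroupI)
    fix a assume a: "a \<in> A"
    have "\<ominus> a = (\<ominus> \<one>) \<otimes> a" using a assms(1) by (auto simp: l_minus)
    then show "\<ominus> a \<in> A" using assms(4)[OF a, of "\<ominus> \<one>"] by simp
  qed (use assms in auto)
  show "a \<otimes> x \<in> A" if "a \<in> A" "x \<in> carrier R" for a x
    using that assms(1) assms(4)[of a x] m_comm[of a x] by auto
qed (use assms in \<open>auto intro: ring_axioms\<close>)

context cring
begin

lemma subset_Idl: "X \<subseteq> carrier R \<Longrightarrow> Y \<subseteq> X \<Longrightarrow> Y \<subseteq> Idl X"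
  using genideal_self[of X] by (rule subset_trans[rotated])

lemma Idl_of_ideal: "ideal A R \<Longrightarrow> Idl A = A"
  by (rule subset_antisym, rule genideal_minimal, assumption, rule subset_refl, rule subset_Idl)
     (simp_all add: ideal_subset_carrier)

lemma Idl_mono: "Y \<subseteq> carrier R \<Longrightarrow> X \<subseteq> Y \<Longrightarrow> Idl X \<subseteq> Idl Y"
  by (rule genideal_minimal[OF genideal_ideal subset_Idl])

lemma Idl_Un_Idl:
  assumes "X \<subseteq> carrier R" "Y \<subseteq> carrier R" shows "Idl (X \<union> Idl Y) = Idl (X \<union> Y)"
proof (rule subset_antisym)
  have XY: "X \<union> Y \<subseteq> carrier R" using assms by simp
  have Y: "Idl Y \<subseteq> carrier R" by (rule ideal_subset_carrier[OF genideal_ideal[OF assms(2)]])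
  show "Idl (X \<union> Idl Y) \<subseteq> Idl (X \<union> Y)"
    by (rule genideal_minimal[OF genideal_ideal[OF XY]], rule Un_least,
        rule subset_Idl[OF XY], simp, rule Idl_mono[OF XY], simp)
  show "Idl (X \<union> Y) \<subseteq> Idl (X \<union> Idl Y)"
    using assms Y subset_Idl[of Y Y] by (intro Idl_mono) auto
qed

lemma ideal_colon:
  assumes "ideal A R" "x \<in> carrier R" shows "ideal (colon R A x) R"
proof (rule idealI_comm)
  fix a r assume "a \<in> colon R A x" "r \<in> carrier R"
  then show "r \<otimes> a \<in> colon R A x"
    using assms by (auto simp: colon_def m_assoc ideal_mult)
qed (use assms in \<open>auto simp: colon_def l_distr ideal_add ideal_zero\<close>)

lemma subset_colon: "ideal A R \<Longrightarrow> x \<in> carrier R \<Longrightarrow> A \<subseteq> colon R A x"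
  using ideal_subset_carrier[of A] by (auto simp: colon_def ideal_mult_right)

lemma colon_mono: "A \<subseteq> B \<Longrightarrow> colon R A x \<subseteq> colon R B x"
  by (auto simp: colon_def)

lemma ideal_insert_form:
  assumes "ideal A R" "ideal E R" "x \<in> carrier R"
  shows "ideal {a \<oplus> e \<otimes> x | a e. a \<in> A \<and> e \<in> E} R"
proof (rule idealI_comm)
  have c: "A \<subseteq> carrier R" "E \<subseteq> carrier R" using assms by (simp_all add: ideal_subset_carrier)
  show "{a \<oplus> e \<otimes> x | a e. a \<in> A \<and> e \<in> E} \<subseteq> carrier R" using c assms by auto
  have "\<zero> = \<zero> \<oplus> \<zero> \<otimes> x" using assms by simp
  then show "\<zero> \<in> {a \<oplus> e \<otimes> x | a e. a \<in> A \<and> e \<in> E}"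
    using assms ideal_zero by blast
next
  have c: "A \<subseteq> carrier R" "E \<subseteq> carrier R" using assms by (simp_all add: ideal_subset_carrier)
  fix u v assume "u \<in> {a \<oplus> e \<otimes> x | a e. a \<in> A \<and> e \<in> E}" "v \<in> {a \<oplus> e \<otimes> x | a e. a \<in> A \<and> e \<in> E}"
  then obtain a e b f where *: "a \<in> A" "e \<in> E" "u = a \<oplus> e \<otimes> x" "b \<in> A" "f \<in> E" "v = b \<oplus> f \<otimes> x" by auto
  then have "u \<oplus> v = (a \<oplus> b) \<oplus> (e \<oplus> f) \<otimes> x"
    using c assms by (auto simp: l_distr a_ac subset_iff)
  then show "u \<oplus> v \<in> {a \<oplus> e \<otimes> x | a e. a \<in> A \<and> e \<in> E}"
    using * assms ideal_add by blast
next
  have c: "A \<subseteq> carrier R" "E \<subseteq> carrier R" using assms by (simp_all add: ideal_subset_carrier)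
  fix u r assume "u \<in> {a \<oplus> e \<otimes> x | a e. a \<in> A \<and> e \<in> E}" and r: "r \<in> carrier R"
  then obtain a e where *: "a \<in> A" "e \<in> E" "u = a \<oplus> e \<otimes> x" by auto
  then have "r \<otimes> u = (r \<otimes> a) \<oplus> (r \<otimes> e) \<otimes> x"
    using c assms r by (auto simp: r_distr m_assoc subset_iff)
  then show "r \<otimes> u \<in> {a \<oplus> e \<otimes> x | a e. a \<in> A \<and> e \<in> E}"
    using * assms r ideal_mult by blast
qed

lemma Idl_insert:
  assumes "ideal A R" "x \<in> carrier R"
  shows "Idl (insert x A) = {a \<oplus> e \<otimes> x | a e. a \<in> A \<and> e \<in> carrier R}"
proof (rule antisym)
  have c: "A \<subseteq> carrier R" using assms by (simp_all add: ideal_subset_carrier)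
  have "x = \<zero> \<oplus> \<one> \<otimes> x" using assms by simp
  then have 1: "x \<in> {a \<oplus> e \<otimes> x | a e. a \<in> A \<and> e \<in> carrier R}" using assms ideal_zero by blast
  have "a = a \<oplus> \<zero> \<otimes> x" if "a \<in> A" for a using assms c that by auto
  then have 2: "A \<subseteq> {a \<oplus> e \<otimes> x | a e. a \<in> A \<and> e \<in> carrier R}" by blast
  show "Idl (insert x A) \<subseteq> {a \<oplus> e \<otimes> x | a e. a \<in> A \<and> e \<in> carrier R}"
    using 1 2 ideal_insert_form[OF assms(1) oneideal assms(2)] by (intro genideal_minimal) auto
  have i: "ideal (Idl (insert x A)) R" using c assms by (auto intro!: genideal_ideal)
  have s: "insert x A \<subseteq> Idl (insert x A)" using c assms by (intro genideal_self) simp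
  show "{a \<oplus> e \<otimes> x | a e. a \<in> A \<and> e \<in> carrier R} \<subseteq> Idl (insert x A)"
    using s by (auto intro!: ideal_add[OF i] ideal_mult[OF i])
qed

text \<open>Additivity of length for 0 \<rightarrow> R/(A : x) \<rightarrow> R/A \<rightarrow> R/(A
  + (x)) \<rightarrow> 0, in terms of chains. For \<le>, a strict inclusion of ideals above A stays
  strict after adjoining x or after taking the colon by x. For \<ge>, the map sending E to A + Ex
  carries chains above (A : x) into the interval from A to A + (x), and a chain above A + (x) is
  stacked on top.\<close>

lemma height_over_ideals_insert:
  assumes A: "ideal A R" and x: "x \<in> carrier R"
  shows "height (over_ideals R A) = height (over_ideals R (Idl (insert x A))) + height (over_ideals R (colon R A x))"
proof (rule antisym)
  have c: "A \<subseteq> carrier R" using A by (simp add: ideal_subset_carrier)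
  have sc: "insert x C \<subseteq> carrier R" if "ideal C R" for C using that x by (simp add: ideal_subset_carrier)
  have mono: "Idl (insert x C) \<subseteq> Idl (insert x D)" if "ideal C R" "ideal D R" "C \<subseteq> D" for C D
    using that sc by (intro Idl_mono) auto
  show "height (over_ideals R A) \<le> height (over_ideals R (Idl (insert x A))) + height (over_ideals R (colon R A x))"
  proof (rule height_le_add[where f = "\<lambda>C. Idl (insert x C)" and g = "\<lambda>C. colon R C x"])
    fix C D assume CD: "C \<in> over_ideals R A" "D \<in> over_ideals R A" "C \<subset> D"
    then have i: "ideal C R" "ideal D R" by (auto simp: over_ideals_def)
    show "Idl (insert x C) \<noteq> Idl (insert x D) \<or> colon R C x \<noteq> colon R D x"
    proof (rule ccontr)
      assume "\<not> ?thesis"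
      then have e: "Idl (insert x C) = Idl (insert x D)" "colon R C x = colon R D x" by auto
      have "D \<subseteq> C"
      proof
        fix y assume y: "y \<in> D"
        have "y \<in> Idl (insert x C)" unfolding e using genideal_self[OF sc[OF i(2)]] y by auto
        then obtain a r where *: "a \<in> C" "r \<in> carrier R" "y = a \<oplus> r \<otimes> x" unfolding Idl_insert[OF i(1) x] by auto
        have ac: "a \<in> carrier R" "a \<in> D" using * i(1) CD(3) by (auto intro: ideal_carr)
        have "\<ominus> a \<oplus> y = r \<otimes> x" using * ac x by (simp add: r_neg1)
        then have "r \<otimes> x \<in> D" using ideal_add[OF i(2) ideal_neg[OF i(2) ac(2)] y] by simp
        then have "r \<in> colon R C x" unfolding e using * by (simp add: colon_def)
        then show "y \<in> C" using * i by (auto simp: colon_def ideal_add)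
      qed
      then show False using CD by auto
    qed
  qed (use A c sc mono x in \<open>auto simp: over_ideals_def intro!: genideal_ideal ideal_colon dest: colon_mono[THEN subsetD, rotated]\<close>)
  have "height (over_ideals R (colon R A x)) + height (over_ideals R (Idl (insert x A))) \<le> height (over_ideals R A)"
  proof (rule height_add_le[where f = "\<lambda>E. {a \<oplus> e \<otimes> x | a e. a \<in> A \<and> e \<in> E}"])
    show "over_ideals R (colon R A x) \<noteq> {}" using oneideal by (auto simp: over_ideals_def colon_def)
    show "over_ideals R (Idl (insert x A)) \<noteq> {}"
      using oneideal ideal_subset_carrier[OF genideal_ideal[OF sc[OF A]]] by (auto simp: over_ideals_def)
    have sub: "A \<subseteq> {a \<oplus> e \<otimes> x | a e. a \<in> A \<and> e \<in> E}" if "ideal E R" for E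
    proof
      fix a assume "a \<in> A"
      moreover have "a = a \<oplus> \<zero> \<otimes> x" using \<open>a \<in> A\<close> c x by auto
      ultimately show "a \<in> {a \<oplus> e \<otimes> x | a e. a \<in> A \<and> e \<in> E}" using ideal_zero[OF that] by blast
    qed
    then show "{a \<oplus> e \<otimes> x | a e. a \<in> A \<and> e \<in> E} \<in> over_ideals R A" if "E \<in> over_ideals R (colon R A x)" for E
      using that A x by (auto simp: over_ideals_def intro!: ideal_insert_form)
    show "{a \<oplus> e \<otimes> x | a e. a \<in> A \<and> e \<in> E} \<subset> {a \<oplus> e \<otimes> x | a e. a \<in> A \<and> e \<in> E'}"
      if E: "E \<in> over_ideals R (colon R A x)" "E' \<in> over_ideals R (colon R A x)" "E \<subset> E'" for E E'
    proof (rule psubsetI)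
      have i: "ideal E R" "ideal E' R" using E by (auto simp: over_ideals_def)
      show "{a \<oplus> e \<otimes> x | a e. a \<in> A \<and> e \<in> E} \<subseteq> {a \<oplus> e \<otimes> x | a e. a \<in> A \<and> e \<in> E'}" using E by auto
      show "{a \<oplus> e \<otimes> x | a e. a \<in> A \<and> e \<in> E} \<noteq> {a \<oplus> e \<otimes> x | a e. a \<in> A \<and> e \<in> E'}"
      proof
        assume eq: "{a \<oplus> e \<otimes> x | a e. a \<in> A \<and> e \<in> E} = {a \<oplus> e \<otimes> x | a e. a \<in> A \<and> e \<in> E'}"
        have "E' \<subseteq> E"
        proof
          fix f assume f: "f \<in> E'"
          have fc: "f \<in> carrier R" using f i(2) by (simp add: ideal_carr)
          have "f \<otimes> x = \<zero> \<oplus> f \<otimes> x" using fc x by simp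
          then have "f \<otimes> x \<in> {a \<oplus> e \<otimes> x | a e. a \<in> A \<and> e \<in> E}" unfolding eq using f ideal_zero[OF A] by blast
          then obtain a e where *: "a \<in> A" "e \<in> E" "f \<otimes> x = a \<oplus> e \<otimes> x" by auto
          have ec: "e \<in> carrier R" "a \<in> carrier R" using * i(1) c by (auto intro: ideal_carr)
          have "(f \<ominus> e) \<otimes> x = a"
            using * ec fc x by (simp add: minus_eq l_distr l_minus a_assoc r_neg)
          then have "f \<ominus> e \<in> colon R A x" using * ec fc by (simp add: colon_def)
          then have "f \<ominus> e \<in> E" using E by (auto simp: over_ideals_def)
          then have "(f \<ominus> e) \<oplus> e \<in> E" using * i ideal_add by metis
          then show "f \<in> E" using ec fc by (simp add: minus_eq a_assoc l_neg)
        qed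
        then show False using E by auto
      qed
    qed
    show "over_ideals R (Idl (insert x A)) \<subseteq> over_ideals R A"
      using genideal_self[OF sc[OF A]] by (auto simp: over_ideals_def)
    show "{a \<oplus> e \<otimes> x | a e. a \<in> A \<and> e \<in> E} \<subseteq> B"
      if "E \<in> over_ideals R (colon R A x)" "B \<in> over_ideals R (Idl (insert x A))" for E B
    proof -
      have "E \<subseteq> carrier R" using that by (simp add: over_ideals_def ideal_subset_carrier)
      then have "{a \<oplus> e \<otimes> x | a e. a \<in> A \<and> e \<in> E} \<subseteq> Idl (insert x A)"
        unfolding Idl_insert[OF A x] by auto
      then show ?thesis using that by (auto simp: over_ideals_def)
    qed
  qed
  then show "height (over_ideals R (Idl (insert x A))) + height (over_ideals R (colon R A x)) \<le> height (over_ideals R A)"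
    by (simp add: add.commute)
qed

lemma rcoset_eq_iff:
  assumes "ideal A R" "x \<in> carrier R" "y \<in> carrier R"
  shows "A +> x = A +> y \<longleftrightarrow> x \<ominus> y \<in> A"
  using quotient_eq_iff_same_a_r_cos[OF assms] by simp

text \<open>Correspondence theorem: preimage and image under the quotient map are strictly monotone
  between the submodules of R/A and the ideals above A, and strictly monotone maps in both
  directions force equal heights.\<close>

lemma module_length_quot:
  assumes A: "ideal A R"
  shows "module_length R (quot_module R A) = height (over_ideals R A)"
  unfolding module_length_height
proof (rule antisym)
  let ?M = "quot_module R A"
  interpret A: ideal A R by fact
  have carrM: "carrier ?M = (\<lambda>x. A +> x) ` carrier R"
    by (auto simp: quot_module_def FactRing_def A_RCOSETS_def' )
  have addM: "(A +> x) \<oplus>\<^bsub>?M\<^esub> (A +> y) = A +> (x \<oplus> y)" if "x \<in> carrier R" "y \<in> carrier R" for x y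
    using that by (simp add: quot_module_def FactRing_def A.a_rcos_sum)
  have zM: "\<zero>\<^bsub>?M\<^esub> = A +> \<zero>"
    using a_rcos_zero[OF A ideal_zero[OF A]] by (simp add: quot_module_def FactRing_def)
  have smM: "r \<odot>\<^bsub>?M\<^esub> (A +> y) = A +> (r \<otimes> y)" if "r \<in> carrier R" "y \<in> carrier R" for r y
    using that by (simp add: quot_module_def FactRing_def A.rcoset_mult_add)
  have grp: "comm_group (add_monoid ?M)"
  proof -
    show ?thesis
    proof (rule comm_groupI)
      show "\<exists>v\<in>carrier (add_monoid ?M). v \<otimes>\<^bsub>add_monoid ?M\<^esub> u = \<one>\<^bsub>add_monoid ?M\<^esub>"
        if u: "u \<in> carrier (add_monoid ?M)" for u
      proof -
        obtain x where x: "x \<in> carrier R" "u = A +> x" using u carrM by auto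
        then have "(A +> \<ominus> x) \<oplus>\<^bsub>?M\<^esub> u = \<zero>\<^bsub>?M\<^esub>" using addM[of "\<ominus> x" x] zM by (simp add: l_neg)
        then show ?thesis using x carrM by auto
      qed
    qed (auto simp: carrM addM zM a_ac)
  qed
  define pre where "pre N = {x \<in> carrier R. A +> x \<in> N}" for N
  have N1: "N \<subseteq> carrier ?M" "\<zero>\<^bsub>?M\<^esub> \<in> N" "\<And>u v. u \<in> N \<Longrightarrow> v \<in> N \<Longrightarrow> u \<oplus>\<^bsub>?M\<^esub> v \<in> N"
    "\<And>r u. r \<in> carrier R \<Longrightarrow> u \<in> N \<Longrightarrow> r \<odot>\<^bsub>?M\<^esub> u \<in> N" if "submodule N R ?M" for N
    using that subgroup.subset[of N "add_monoid ?M"] subgroup.one_closed[of N "add_monoid ?M"]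
      subgroup.m_closed[of N "add_monoid ?M"] submodule.smult_closed[of N R ?M]
    by (auto simp: submodule_def)
  show "height {N. submodule N R ?M} \<le> height (over_ideals R A)"
  proof (rule height_mono_map[where f = pre])
    fix N assume "N \<in> {N. submodule N R ?M}"
    then have N: "submodule N R ?M" by simp
    have "ideal (pre N) R"
      by (rule idealI_comm) (use N1[OF N] in \<open>auto simp: pre_def addM[symmetric] zM[symmetric] smM[symmetric]\<close>)
    moreover have "A \<subseteq> pre N"
    proof
      fix a assume a: "a \<in> A"
      then have "A +> a = A +> \<zero>" using a_rcos_zero[OF A] ideal_zero[OF A] by metis
      then show "a \<in> pre N" using a N1(2)[OF N] zM by (auto simp: pre_def)
    qed
    ultimately show "pre N \<in> over_ideals R A" by (simp add: over_ideals_def)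
  next
    fix N N' assume "N \<in> {N. submodule N R ?M}" "N' \<in> {N. submodule N R ?M}" "N \<subset> N'"
    then have N: "submodule N' R ?M" "N \<subset> N'" by auto
    then obtain u where u: "u \<in> N'" "u \<notin> N" by blast
    then have "u \<in> carrier ?M" using N1(1)[OF N(1)] by blast
    then obtain x where x: "x \<in> carrier R" "u = A +> x" unfolding carrM by blast
    then have "x \<in> pre N'" "x \<notin> pre N" using u by (auto simp: pre_def)
    moreover have "pre N \<subseteq> pre N'" using N by (auto simp: pre_def)
    ultimately show "pre N \<subset> pre N'" by blast
  qed
  define im where "im B = (\<lambda>x. A +> x) ` B" for B
  show "height (over_ideals R A) \<le> height {N. submodule N R ?M}"
  proof (rule height_mono_map[where f = im])
    fix B assume "B \<in> over_ideals R A"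
    then have B: "ideal B R" "B \<subseteq> carrier R" by (simp_all add: over_ideals_def ideal_subset_carrier)
    have "submodule (im B) R ?M"
      unfolding submodule_def submodule_axioms_def
    proof (intro conjI allI impI)
      interpret G: comm_group "add_monoid ?M" by (rule grp)
      show "subgroup (im B) (add_monoid ?M)"
      proof (rule G.subgroupI)
        show "im B \<subseteq> carrier (add_monoid ?M)" using B carrM by (auto simp: im_def)
        show "im B \<noteq> {}" using ideal_zero[OF B(1)] by (auto simp: im_def)
        fix u assume "u \<in> im B"
        then obtain b where b: "b \<in> B" "u = A +> b" by (auto simp: im_def)
        have "inv\<^bsub>add_monoid ?M\<^esub> u = A +> (\<ominus> b)"
        proof (rule G.inv_equality)
          show "(A +> \<ominus> b) \<otimes>\<^bsub>add_monoid ?M\<^esub> u = \<one>\<^bsub>add_monoid ?M\<^esub>"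
            using b B addM[of "\<ominus> b" b] zM by (auto simp: l_neg)
        qed (use b B carrM in auto)
        then show "inv\<^bsub>add_monoid ?M\<^esub> u \<in> im B" using b ideal_neg[OF B(1)] by (auto simp: im_def)
      next
        fix u v assume "u \<in> im B" "v \<in> im B"
        then show "u \<otimes>\<^bsub>add_monoid ?M\<^esub> v \<in> im B" using B addM ideal_add[OF B(1)] by (auto simp: im_def subset_iff)
      qed
    qed (use B smM ideal_mult[OF B(1)] in \<open>auto simp: im_def subset_iff\<close>)
    then show "im B \<in> {N. submodule N R ?M}" by simp
  next
    fix B B' assume "B \<in> over_ideals R A" "B' \<in> over_ideals R A" and sub: "B \<subset> B'"
    then have B: "ideal B R" "B \<subseteq> carrier R" "A \<subseteq> B" and B': "ideal B' R" "B' \<subseteq> carrier R"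
      by (simp_all add: over_ideals_def ideal_subset_carrier)
    obtain b where b: "b \<in> B'" "b \<notin> B" using sub by auto
    have "A +> b \<notin> im B"
    proof
      assume "A +> b \<in> im B"
      then obtain c where c: "c \<in> B" "A +> b = A +> c" by (auto simp: im_def)
      have bc: "b \<in> carrier R" "c \<in> carrier R" using b c B B' by auto
      then have "b \<ominus> c \<in> B" using rcoset_eq_iff[OF A bc] c B by auto
      then have "(b \<ominus> c) \<oplus> c \<in> B" using c ideal_add[OF B(1)] by blast
      moreover have "(b \<ominus> c) \<oplus> c = b" using bc by (simp add: minus_eq a_assoc l_neg)
      ultimately show False using b by simp
    qed
    then show "im B \<subset> im B'" using sub b by (auto simp: im_def)
  qed
qed

lemma colength_height: "ideal A R \<Longrightarrow> colength R A = the_enat (height (over_ideals R A))"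
  by (simp add: colength_def module_length_quot)

lemma finite_colength_mono:
  assumes "finite_colength R A" "ideal B R" "A \<subseteq> B" shows "finite_colength R B" "colength R B \<le> colength R A"
proof -
  have le: "height (over_ideals R B) \<le> height (over_ideals R A)"
    by (rule height_mono_map[where f = "\<lambda>C. C"]) (use assms in \<open>auto simp: over_ideals_def\<close>)
  then show "finite_colength R B" using assms by (auto simp: finite_colength_def dest: enat_ile)
  then show "colength R B \<le> colength R A" using le assms
    by (auto simp: finite_colength_def colength_height)
qed

lemma finite_colength_insert_iff:
  assumes "ideal A R" "x \<in> carrier R"
  shows "finite_colength R A \<longleftrightarrow> finite_colength R (Idl (insert x A)) \<and> finite_colength R (colon R A x)"
  unfolding finite_colength_def height_over_ideals_insert[OF assms] plus_eq_infty_iff_enat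
  using assms ideal_subset_carrier[OF assms(1)] by (simp add: genideal_ideal ideal_colon)

lemma colength_insert:
  assumes "finite_colength R A" "x \<in> carrier R"
  shows "colength R A = colength R (Idl (insert x A)) + colength R (colon R A x)"
proof -
  have A: "ideal A R" using assms by (simp add: finite_colength_def)
  have "finite_colength R (Idl (insert x A))" "finite_colength R (colon R A x)"
    using finite_colength_insert_iff[OF A assms(2)] assms by auto
  then show ?thesis
    using A height_over_ideals_insert[OF A assms(2)] by (auto simp: finite_colength_def colength_height)
qed

lemma colength_carrier: "finite_colength R (carrier R)" "colength R (carrier R) = 0"
proof -
  have "over_ideals R (carrier R) = {carrier R}"
    using oneideal by (auto simp: over_ideals_def dest: ideal_subset_carrier)
  then have "height (over_ideals R (carrier R)) \<le> 0"
    by (intro height_leI) (auto simp: set_chain_def zero_enat_def)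
  then have "height (over_ideals R (carrier R)) = enat 0" by (simp add: zero_enat_def[symmetric])
  then show "finite_colength R (carrier R)" "colength R (carrier R) = 0"
    using oneideal by (auto simp: finite_colength_def colength_height)
qed

text \<open>Adjoining \<open>s\<close> to an ideal that contains \<open>A\<close> lowers the
  colength by that of a colon ideal, which contains \<open>D\<close> because colons grow with the
  ideal. With \<open>D\<close> the maximal ideal this counts generators; with other ideals it bounds
  lengths of products.\<close>

lemma finite_colength_Idl_Un:
  assumes "finite S" "ideal A R" "S \<subseteq> carrier R" "finite_colength R (Idl (A \<union> S))"
    "finite_colength R D" "\<And>s. s \<in> S \<Longrightarrow> D \<subseteq> colon R A s"
  shows "finite_colength R A \<and> colength R A \<le> colength R (Idl (A \<union> S)) + card S * colength R D"
  using assms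
proof (induction S arbitrary: A rule: finite_induct)
  case empty
  then show ?case by (simp add: Idl_of_ideal)
next
  case (insert s S)
  let ?A = "Idl (insert s A)"
  have s: "s \<in> carrier R" "S \<subseteq> carrier R" and Ac: "A \<subseteq> carrier R" using insert.prems by (simp_all add: ideal_subset_carrier)
  have iA: "ideal ?A R" "A \<subseteq> ?A" using s Ac genideal_self[of "insert s A"] by (auto intro: genideal_ideal)
  have "S \<union> insert s A = A \<union> insert s S" by auto
  then have eq: "Idl (?A \<union> S) = Idl (A \<union> insert s S)"
    using Idl_Un_Idl[of S "insert s A"] s Ac by (auto simp: Un_commute)
  have IH: "finite_colength R ?A \<and> colength R ?A \<le> colength R (Idl (?A \<union> S)) + card S * colength R D"
    using insert.prems colon_mono[OF iA(2)] by (intro insert.IH) (auto simp: eq iA s)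
  have "finite_colength R (colon R A s) \<and> colength R (colon R A s) \<le> colength R D"
    using finite_colength_mono[of D "colon R A s"] insert.prems ideal_colon s by auto
  moreover from this have "finite_colength R A" using finite_colength_insert_iff[of A s] insert.prems s IH by auto
  ultimately show ?case using IH colength_insert[of A s] s insert.hyps by (auto simp: eq)
qed

lemma finite_colength_ideal: "finite_colength R A \<Longrightarrow> ideal A R"
  by (simp add: finite_colength_def)

end

section \<open>Powers of ideals and Nakayama's lemma\<close>

context cring
begin

lemma ideal_power_0: "ideal_power R I 0 = carrier R"
  by (simp add: nat_pow_def ideals_set_def)

lemma ideal_power_Suc: "ideal_power R I (Suc n) = ideal_power R I n \<cdot> I"
  by (simp add: nat_pow_def ideals_set_def)

lemma ideal_ideal_power: "ideal I R \<Longrightarrow> ideal (ideal_power R I n) R"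
  by (induction n) (simp_all only: ideal_power_0 ideal_power_Suc oneideal ideal_prod_is_ideal)

lemma ideal_power_1: "ideal I R \<Longrightarrow> ideal_power R I (Suc 0) = I"
  by (simp only: ideal_power_Suc ideal_power_0 ideal_prod_commute[OF oneideal] ideal_prod_one)

lemma ideal_power_add:
  assumes "ideal I R" shows "ideal_power R I (m + n) = ideal_power R I m \<cdot> ideal_power R I n"
proof (induction n)
  case 0
  then show ?case
    by (simp only: add_0_right ideal_power_0 ideal_prod_one[OF ideal_ideal_power[OF assms]])
next
  case (Suc n)
  then show ?case
    by (simp only: add_Suc_right ideal_power_Suc ideal_prod_assoc ideal_ideal_power[OF assms] assms)
qed

lemma ideal_prod_subsetI:
  assumes "ideal C R" "\<And>a b. a \<in> A \<Longrightarrow> b \<in> B \<Longrightarrow> a \<otimes> b \<in> C" shows "A \<cdot> B \<subseteq> C"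
proof
  fix x assume "x \<in> A \<cdot> B"
  then show "x \<in> C"
    by (induction rule: ideal_prod.induct) (simp_all add: assms ideal_add)
qed

lemma ideal_prod_mono:
  assumes "ideal C R" "ideal D R" "A \<subseteq> C" "B \<subseteq> D" shows "A \<cdot> B \<subseteq> C \<cdot> D"
  by (rule ideal_prod_subsetI[OF ideal_prod_is_ideal[OF assms(1,2)]], rule ideal_prod.prod)
     (use assms(3,4) in blast)+

lemma ideal_power_mono:
  assumes "ideal I R" "ideal J R" "I \<subseteq> J" shows "ideal_power R I n \<subseteq> ideal_power R J n"
  by (induction n) (simp_all only: ideal_power_0 ideal_power_Suc subset_refl ideal_prod_mono ideal_ideal_power assms)

lemma ideal_prod_subset1: "ideal A R \<Longrightarrow> ideal B R \<Longrightarrow> A \<cdot> B \<subseteq> A"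
  using ideal_prod_inter[of A B] by blast

lemma ideal_prod_subset2: "ideal A R \<Longrightarrow> ideal B R \<Longrightarrow> A \<cdot> B \<subseteq> B"
  using ideal_prod_inter[of A B] by blast

lemma ideal_power_antimono:
  assumes "ideal I R" "m \<le> n" shows "ideal_power R I n \<subseteq> ideal_power R I m"
proof -
  obtain k where "n = m + k" using assms(2) le_Suc_ex by blast
  then show ?thesis
    by (simp only: ideal_power_add[OF assms(1)] ideal_prod_subset1 ideal_ideal_power[OF assms(1)])
qed

lemma colon_comm: "a \<in> carrier R \<Longrightarrow> b \<in> carrier R \<Longrightarrow> a \<in> colon R C b \<longleftrightarrow> b \<in> colon R C a"
  by (simp add: colon_def m_comm)

text \<open>The elements that a fixed element multiplies into \<open>C\<close> form a colon ideal.
  So the condition passes from \<open>X\<close> to \<open>Idl X\<close> with the second factor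
  fixed, and then from \<open>Y\<close> to \<open>Idl Y\<close>.\<close>

lemma ideal_prod_Idl_subset:
  assumes X: "X \<subseteq> carrier R" and Y: "Y \<subseteq> carrier R" and C: "ideal C R"
    and xy: "\<And>x y. x \<in> X \<Longrightarrow> y \<in> Y \<Longrightarrow> x \<otimes> y \<in> C"
  shows "(Idl X) \<cdot> (Idl Y) \<subseteq> C"
proof (rule ideal_prod_subsetI[OF C])
  fix a b assume a: "a \<in> Idl X" and b: "b \<in> Idl Y"
  have ac: "a \<in> carrier R" by (rule ideal_carr[OF genideal_ideal[OF X] a])
  have bc: "b \<in> carrier R" by (rule ideal_carr[OF genideal_ideal[OF Y] b])
  have "a \<in> colon R C y" if y: "y \<in> Y" for y
  proof -
    have yc: "y \<in> carrier R" using y Y by blast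
    have "X \<subseteq> colon R C y" using xy X y by (auto simp: colon_def)
    then have "Idl X \<subseteq> colon R C y" by (rule genideal_minimal[OF ideal_colon[OF C yc]])
    then show ?thesis using a by blast
  qed
  then have "Y \<subseteq> colon R C a" using colon_comm ac Y by blast
  then have "Idl Y \<subseteq> colon R C a" by (rule genideal_minimal[OF ideal_colon[OF C ac]])
  then have "b \<otimes> a \<in> C" using b by (auto simp: colon_def)
  then show "a \<otimes> b \<in> C" using ac bc by (simp add: m_comm)
qed

end

section \<open>Monomials in a system of generators\<close>

primrec monomial :: "('a, 'b) ring_scheme \<Rightarrow> (nat \<Rightarrow> 'a) \<Rightarrow> nat \<Rightarrow> (nat \<Rightarrow> nat) \<Rightarrow> 'a" where
  "monomial R x 0 a = \<one>\<^bsub>R\<^esub>"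
| "monomial R x (Suc k) a = monomial R x k a \<otimes>\<^bsub>R\<^esub> x k [^]\<^bsub>R\<^esub> a k"

definition unit_exp :: "nat \<Rightarrow> nat \<Rightarrow> nat" where
  "unit_exp i j = (if j = i then 1 else 0)"

lemma unit_exp_simps: "unit_exp i i = 1" "j \<noteq> i \<Longrightarrow> unit_exp i j = 0"
  by (simp_all add: unit_exp_def)

lemma exps_add: "a \<in> exps k m \<Longrightarrow> b \<in> exps k n \<Longrightarrow> (\<lambda>i. a i + b i) \<in> exps k (m + n)"
  by (simp add: exps_def sum.distrib)

lemma unit_exp_exps: "i < k \<Longrightarrow> unit_exp i \<in> exps k 1"
  by (auto simp: exps_def unit_exp_def)

lemma exps_k_0: "exps k 0 = {\<lambda>_. 0}"
proof -
  have "a = (\<lambda>_. 0)" if "a \<in> exps k 0" for a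
  proof
    fix i show "a i = 0" using that by (cases "i < k") (auto simp: exps_def)
  qed
  then show ?thesis by (auto simp: exps_def)
qed

context cring
begin

lemma monomial_closed: "(\<And>i. i < k \<Longrightarrow> x i \<in> carrier R) \<Longrightarrow> monomial R x k a \<in> carrier R"
  by (induction k) simp_all

lemma monomial_add:
  assumes "\<And>i. i < k \<Longrightarrow> x i \<in> carrier R"
  shows "monomial R x k (\<lambda>i. a i + b i) = monomial R x k a \<otimes> monomial R x k b"
  using assms
proof (induction k)
  case (Suc k)
  have c: "monomial R x k a \<in> carrier R" "monomial R x k b \<in> carrier R" "x k \<in> carrier R"
    using Suc.prems by (simp_all add: monomial_closed)
  then show ?case using Suc by (simp add: nat_pow_mult[symmetric] m_ac)
qed simp

lemma monomial_zero: "monomial R x k (\<lambda>_. 0) = \<one>"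
  by (induction k) simp_all

lemma monomial_unit:
  assumes "\<And>i. i < k \<Longrightarrow> x i \<in> carrier R" "i < k" shows "monomial R x k (unit_exp i) = x i"
proof -
  have 0: "monomial R x j (unit_exp i) = \<one>" if "j \<le> i" for j
    using that by (induction j) (simp_all add: unit_exp_simps)
  show ?thesis
    using assms
  proof (induction k)
    case (Suc k)
    show ?case
    proof (cases "i = k")
      case True
      have "monomial R x k (unit_exp i) = \<one>" by (rule 0) (simp add: True)
      then show ?thesis using Suc.prems(1)[of i] True by (simp add: unit_exp_simps)
    next
      case False
      then have "i < k" using Suc.prems by simp
      then have "monomial R x k (unit_exp i) = x i" using Suc.IH Suc.prems(1) by simp
      then show ?thesis using Suc.prems(1)[OF Suc.prems(2)] False by (simp add: unit_exp_simps)
    qed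
  qed simp
qed

lemma Idl_Un_generators:
  assumes A: "ideal A R" "A \<subseteq> M" and S: "S \<subseteq> carrier R" "M = Idl S"
  shows "Idl (A \<union> S) = M"
proof (rule subset_antisym)
  have iM: "ideal M R" unfolding S(2) by (rule genideal_ideal[OF S(1)])
  show "Idl (A \<union> S) \<subseteq> M"
    using A genideal_self[OF S(1)] by (intro genideal_minimal[OF iM]) (simp add: S(2))
  have AS: "A \<union> S \<subseteq> carrier R" using ideal_subset_carrier[OF A(1)] S(1) by simp
  have "Idl S \<subseteq> Idl (A \<union> S)" by (rule Idl_mono[OF AS]) simp
  then show "M \<subseteq> Idl (A \<union> S)" by (simp only: S(2))
qed

lemma pow_in_ideal_power: "y \<in> Q \<Longrightarrow> y [^] (n::nat) \<in> ideal_power R Q n"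
proof (induction n)
  case 0
  then show ?case unfolding ideal_power_0 by simp
next
  case (Suc n)
  then have "y [^] n \<otimes> y \<in> ideal_power R Q n \<cdot> Q" by (intro ideal_prod.prod)
  then show ?case unfolding ideal_power_Suc by simp
qed

lemma monomial_in_power:
  assumes Q: "ideal Q R" and x: "\<And>i. i < k \<Longrightarrow> x i \<in> Q"
  shows "monomial R x k a \<in> ideal_power R Q (\<Sum>i<k. a i)"
  using x
proof (induction k)
  case 0
  then show ?case using one_closed by (simp only: lessThan_0 sum.empty ideal_power_0 monomial.simps)
next
  case (Suc j)
  show ?case
    unfolding monomial.simps sum.lessThan_Suc ideal_power_add[OF Q]
    by (intro ideal_prod.prod pow_in_ideal_power Suc) simp_all
qed

lemma ideal_power_Idl:
  assumes x: "\<And>i. i < k \<Longrightarrow> x i \<in> carrier R"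
  shows "ideal_power R (Idl (x ` {..<k})) n = Idl (monomial R x k ` exps k n)"
proof (rule subset_antisym)
  let ?Q = "Idl (x ` {..<k})"
  have X: "x ` {..<k} \<subseteq> carrier R" using x by auto
  have Q: "ideal ?Q R" by (rule genideal_ideal[OF X])
  have xQ: "x i \<in> ?Q" if "i < k" for i using genideal_self[OF X] that by auto
  have M: "monomial R x k ` exps k n \<subseteq> carrier R" for n using x by (auto intro: monomial_closed)
  have "monomial R x k a \<in> ideal_power R ?Q n" if "a \<in> exps k n" for a
  proof -
    have "monomial R x k a \<in> ideal_power R ?Q (\<Sum>i<k. a i)"
      by (rule monomial_in_power[OF Q]) (rule xQ)
    then show ?thesis using that by (simp add: exps_def)
  qed
  then show "Idl (monomial R x k ` exps k n) \<subseteq> ideal_power R ?Q n"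
    by (intro genideal_minimal[OF ideal_ideal_power[OF Q]]) blast
  show "ideal_power R ?Q n \<subseteq> Idl (monomial R x k ` exps k n)"
  proof (induction n)
    case 0
    then show ?case unfolding ideal_power_0 by (simp add: exps_k_0 monomial_zero genideal_one)
  next
    case (Suc n)
    have "ideal_power R ?Q n \<cdot> ?Q \<subseteq> (Idl (monomial R x k ` exps k n)) \<cdot> ?Q"
      by (rule ideal_prod_mono[OF genideal_ideal[OF M] Q Suc subset_refl])
    also have "\<dots> \<subseteq> Idl (monomial R x k ` exps k (Suc n))"
    proof (rule ideal_prod_Idl_subset[OF M X genideal_ideal[OF M]])
      fix u y assume "u \<in> monomial R x k ` exps k n" "y \<in> x ` {..<k}"
      then obtain a i where a: "a \<in> exps k n" "u = monomial R x k a" and i: "i < k" "y = x i" by auto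
      have "u \<otimes> y = monomial R x k (\<lambda>j. a j + unit_exp i j)"
        using a i monomial_add[of k x a "unit_exp i"] monomial_unit[of k x i] x by simp
      moreover have "(\<lambda>j. a j + unit_exp i j) \<in> exps k (Suc n)"
        using exps_add[OF a(1) unit_exp_exps[OF i(1)]] by simp
      ultimately show "u \<otimes> y \<in> Idl (monomial R x k ` exps k (Suc n))"
        using genideal_self[OF M[of "Suc n"]] by blast
    qed
    finally show ?case by (simp only: ideal_power_Suc)
  qed
qed

end

section \<open>Nakayama's lemma and \<open>\<mm>\<close>-primary ideals\<close>

context noetherian_local_ring
begin

lemma ideal_m: "ideal \<mm> R" by (rule is_ideal)

lemma m_carr: "\<mm> \<subseteq> carrier R" by (rule ideal_subset_carrier[OF ideal_m])

lemma subset_colon_m: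
  assumes "ideal M R" "s \<in> M" shows "\<mm> \<subseteq> colon R (\<mm> \<cdot> M) s"
proof
  fix m assume m: "m \<in> \<mm>"
  have "m \<otimes> s \<in> \<mm> \<cdot> M" by (rule ideal_prod.prod[OF m assms(2)])
  then show "m \<in> colon R (\<mm> \<cdot> M) s" using m m_carr by (auto simp: colon_def)
qed

lemma fin_gen: "ideal A R \<Longrightarrow> \<exists>S. S \<subseteq> carrier R \<and> finite S \<and> A = Idl S"
  using finetely_gen by blast

lemma proper_subset_m:
  assumes A: "ideal A R" "A \<noteq> carrier R" shows "A \<subseteq> \<mm>"
proof -
  let ?F = "{C. ideal C R \<and> A \<subseteq> C \<and> C \<noteq> carrier R}"
  have "\<exists>M\<in>?F. \<forall>X\<in>?F. M \<subseteq> X \<longrightarrow> X = M"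
  proof (rule subset_Zorn)
    fix C assume C: "subset.chain ?F C"
    show "\<exists>U\<in>?F. \<forall>X\<in>C. X \<subseteq> U"
    proof (cases "C = {}")
      case True
      then show ?thesis using A by blast
    next
      case False
      have "subset.chain {I. ideal I R} C" using C unfolding subset.chain_def by blast
      \<comment> \<open>In a noetherian ring a nonempty chain of ideals contains its own union, so
        the union is again proper.\<close>
      then have "\<Union>C \<in> C" by (rule ideal_chain_is_trivial[OF False])
      moreover have "C \<subseteq> ?F" using C unfolding subset.chain_def by (rule conjunct1)
      then have "\<Union>C \<in> ?F" using \<open>\<Union>C \<in> C\<close> by (rule subsetD)
      ultimately show ?thesis by (intro bexI[of _ "\<Union>C"]) auto
    qed
  qed
  then obtain M where M: "M \<in> ?F" and max: "\<forall>X\<in>?F. M \<subseteq> X \<longrightarrow> X = M" by blast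
  have "maximalideal M R"
  proof (rule maximalidealI)
    show "ideal M R" "carrier R \<noteq> M" using M by auto
    fix J assume J: "ideal J R" "M \<subseteq> J" "J \<subseteq> carrier R"
    show "J = M \<or> J = carrier R"
    proof (cases "J = carrier R")
      case False
      then have "J \<in> ?F" using J M by blast
      then show ?thesis using max J by blast
    qed simp
  qed
  then have "M = \<mm>" by (rule maximal_unique)
  then show ?thesis using M by blast
qed

lemma unit_outside_m:
  assumes "u \<in> carrier R" "u \<notin> \<mm>" shows "\<exists>v\<in>carrier R. v \<otimes> u = \<one>"
proof -
  have "PIdl u = carrier R"
    using proper_subset_m[OF cgenideal_ideal[OF assms(1)]] cgenideal_self[OF assms(1)] assms(2) by blast
  then have "\<one> \<in> PIdl u" by simp
  then show ?thesis by (auto simp: cgenideal_def)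
qed

lemma one_notin_m: "\<one> \<notin> \<mm>"
  using I_notcarr one_imp_carrier by blast

lemma minus_add_cancel_carr: "a \<in> carrier R \<Longrightarrow> b \<in> carrier R \<Longrightarrow> (a \<ominus> b) \<oplus> b = a"
  by (simp add: minus_eq a_assoc l_neg)

lemma nakayama_element:
  assumes A: "ideal A R" and s: "s \<in> carrier R" "a \<in> A" "m \<in> \<mm>" "s = a \<oplus> m \<otimes> s"
  shows "s \<in> A"
proof -
  have c: "a \<in> carrier R" "m \<in> carrier R" using s m_carr ideal_carr[OF A] by blast+
  have "\<one> \<ominus> m \<notin> \<mm>"
  proof
    assume "\<one> \<ominus> m \<in> \<mm>"
    then have "(\<one> \<ominus> m) \<oplus> m \<in> \<mm>" using s ideal_add[OF ideal_m] by blast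
    then show False using one_notin_m c by (simp add: minus_add_cancel_carr)
  qed
  moreover have "\<one> \<ominus> m \<in> carrier R" using c by simp
  ultimately obtain v where v: "v \<in> carrier R" "v \<otimes> (\<one> \<ominus> m) = \<one>" using unit_outside_m by blast
  have "(\<one> \<ominus> m) \<otimes> s = s \<ominus> m \<otimes> s" using c s(1) by (simp add: minus_eq l_distr l_minus)
  also have "\<dots> = (a \<oplus> m \<otimes> s) \<ominus> m \<otimes> s" using s(4) by (rule arg_cong)
  also have "\<dots> = a" using c s(1) by (simp add: minus_eq a_assoc r_neg)
  finally have "v \<otimes> ((\<one> \<ominus> m) \<otimes> s) \<in> A" using s(2) v ideal_mult[OF A] by simp
  moreover have "v \<otimes> ((\<one> \<ominus> m) \<otimes> s) = s" using v c s(1) by (simp add: m_assoc[symmetric])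
  ultimately show ?thesis by simp
qed

text \<open>Induction on the generators instead of a determinant: with s put into A, the induction
  hypothesis places the other generators in A + (s). Then \<open>\<mm>\<close> times the whole ideal
  lies in A + \<open>\<mm>\<close>s, so s = a + ms with a in A and m in \<open>\<mm>\<close>, and 1
  - m is a unit.\<close>

lemma nakayama_finite:
  assumes "finite S" "ideal A R" "S \<subseteq> carrier R" "S \<subseteq> Idl (A \<union> (\<mm> \<cdot> (Idl S)))"
  shows "S \<subseteq> A"
  using assms
proof (induction S arbitrary: A rule: finite_induct)
  case (insert s T)
  note A = insert.prems(1)
  have s: "s \<in> carrier R" and T: "T \<subseteq> carrier R" and sT: "insert s T \<subseteq> carrier R" using insert.prems by auto
  have Ac: "A \<subseteq> carrier R" by (rule ideal_subset_carrier[OF A])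
  let ?A = "Idl (insert s A)"
  have ins: "insert s A \<subseteq> carrier R" using s Ac by auto
  have iA: "ideal ?A R" by (rule genideal_ideal[OF ins])
  have sub: "insert s A \<subseteq> ?A" by (rule genideal_self[OF ins])
  have iT: "ideal (Idl T) R" by (rule genideal_ideal[OF T])
  have imT: "ideal (\<mm> \<cdot> (Idl T)) R" by (rule ideal_prod_is_ideal[OF ideal_m iT])
  let ?C = "Idl (?A \<union> (\<mm> \<cdot> (Idl T)))"
  have Cc: "?A \<union> (\<mm> \<cdot> (Idl T)) \<subseteq> carrier R"
    using ideal_subset_carrier[OF iA] ideal_subset_carrier[OF imT] by blast
  have iC: "ideal ?C R" by (rule genideal_ideal[OF Cc])
  have sC: "?A \<union> (\<mm> \<cdot> (Idl T)) \<subseteq> ?C" by (rule genideal_self[OF Cc])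
  have "(Idl \<mm>) \<cdot> (Idl (insert s T)) \<subseteq> ?C"
  proof (rule ideal_prod_Idl_subset[OF m_carr sT iC])
    fix x y assume xy: "x \<in> \<mm>" "y \<in> insert s T"
    show "x \<otimes> y \<in> ?C"
    proof (cases "y = s")
      case True
      have "s \<in> ?A" "x \<in> carrier R" using sub xy m_carr by blast+
      then have "x \<otimes> y \<in> ?A" unfolding True by (rule ideal_mult[OF iA])
      then show ?thesis using sC by blast
    next
      case False
      then have "y \<in> Idl T" using xy genideal_self[OF T] by blast
      then have "x \<otimes> y \<in> \<mm> \<cdot> (Idl T)" using xy by (intro ideal_prod.prod)
      then show ?thesis using sC by blast
    qed
  qed
  then have "\<mm> \<cdot> (Idl (insert s T)) \<subseteq> ?C" by (simp only: Idl_of_ideal[OF ideal_m])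
  then have "Idl (A \<union> (\<mm> \<cdot> (Idl (insert s T)))) \<subseteq> ?C"
    using sC sub by (intro genideal_minimal[OF iC]) blast
  then have "T \<subseteq> ?C" using insert.prems by blast
  then have TA: "T \<subseteq> ?A" by (rule insert.IH[OF iA T])
  have SA: "Idl (insert s T) \<subseteq> ?A" using TA sub by (intro genideal_minimal[OF iA]) blast
  let ?D = "{a \<oplus> e \<otimes> s | a e. a \<in> A \<and> e \<in> \<mm>}"
  have iD: "ideal ?D R" by (rule ideal_insert_form[OF A ideal_m s])
  have "\<mm> \<cdot> (Idl (insert s T)) \<subseteq> ?D"
  proof (rule ideal_prod_subsetI[OF iD])
    fix m b assume m: "m \<in> \<mm>" and "b \<in> Idl (insert s T)"
    then have "b \<in> ?A" using SA by blast
    then obtain a e where ae: "a \<in> A" "e \<in> carrier R" "b = a \<oplus> e \<otimes> s" unfolding Idl_insert[OF A s] by blast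
    have c: "a \<in> carrier R" "m \<in> carrier R" using ae m m_carr Ac by blast+
    have "m \<otimes> b = m \<otimes> a \<oplus> (m \<otimes> e) \<otimes> s" using c ae s by (simp add: r_distr m_assoc)
    moreover have "m \<otimes> a \<in> A" "m \<otimes> e \<in> \<mm>"
      using ideal_mult[OF A ae(1) c(2)] ideal_mult_right[OF ideal_m m ae(2)] by auto
    ultimately show "m \<otimes> b \<in> ?D" by blast
  qed
  moreover have "A \<subseteq> ?D"
  proof
    fix a assume a: "a \<in> A"
    then have "a \<in> carrier R" using Ac by blast
    then have "a = a \<oplus> \<zero> \<otimes> s" using s by simp
    then show "a \<in> ?D" using a ideal_zero[OF ideal_m] by blast
  qed
  ultimately have "Idl (A \<union> (\<mm> \<cdot> (Idl (insert s T)))) \<subseteq> ?D" by (intro genideal_minimal[OF iD]) blast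
  then have "s \<in> ?D" using insert.prems(3) by blast
  then obtain a e where "a \<in> A" "e \<in> \<mm>" "s = a \<oplus> e \<otimes> s" by blast
  then have sA: "s \<in> A" by (rule nakayama_element[OF A s])
  then have "?A \<subseteq> A" by (intro genideal_minimal[OF A]) blast
  then show ?case using sA TA by blast
qed simp

lemma nakayama:
  assumes A: "ideal A R" and B: "ideal B R" and BA: "B \<subseteq> Idl (A \<union> (\<mm> \<cdot> B))"
  shows "B \<subseteq> A"
proof -
  obtain S where S: "S \<subseteq> carrier R" "finite S" "B = Idl S" using fin_gen[OF B] by blast
  have "S \<subseteq> Idl (A \<union> (\<mm> \<cdot> (Idl S)))" using BA genideal_self[OF S(1)] unfolding S(3) by blast
  then have "S \<subseteq> A" by (rule nakayama_finite[OF S(2) A S(1)])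
  then show ?thesis unfolding S(3) by (rule genideal_minimal[OF A])
qed

lemma colength_m: "finite_colength R \<mm>" "colength R \<mm> = 1"
proof -
  have sub: "\<mm> \<subset> carrier R" using m_carr I_notcarr by blast
  have F: "over_ideals R \<mm> = {\<mm>, carrier R}"
  proof
    show "over_ideals R \<mm> \<subseteq> {\<mm>, carrier R}"
      using I_maximal ideal_subset_carrier unfolding over_ideals_def by blast
    show "{\<mm>, carrier R} \<subseteq> over_ideals R \<mm>"
      using ideal_m oneideal m_carr by (simp add: over_ideals_def)
  qed
  have "height (over_ideals R \<mm>) = enat 1"
  proof (rule antisym)
    show "height (over_ideals R \<mm>) \<le> enat 1"
    proof (rule height_leI)
      fix n C assume C: "set_chain (over_ideals R \<mm>) n C"
      show "enat n \<le> enat 1"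
      proof (rule ccontr)
        assume "\<not> ?thesis"
        then have n: "n \<ge> 2" by simp
        have "0 < n" "1 < n" using n by auto
        then have "C 0 \<subset> C 1" "C 1 \<subset> C (Suc 1)" using C unfolding set_chain_def by fastforce+
        moreover have "C 0 \<in> over_ideals R \<mm>" "C 1 \<in> over_ideals R \<mm>" "C (Suc 1) \<in> over_ideals R \<mm>"
          using C n unfolding set_chain_def by auto
        ultimately show False using sub unfolding F by blast
      qed
    qed
    have "set_chain (over_ideals R \<mm>) 1 (\<lambda>i. if i = 0 then \<mm> else carrier R)"
      using sub unfolding F set_chain_def by simp
    then show "enat 1 \<le> height (over_ideals R \<mm>)" by (rule le_height)
  qed
  then show "finite_colength R \<mm>" "colength R \<mm> = 1"
    by (simp_all add: finite_colength_def ideal_m colength_height)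
qed

text \<open>(A + B)/A is finitely generated and killed by \<open>\<mm>\<close>, hence of finite
  length.\<close>

lemma finite_colength_of_m_multiple:
  assumes A: "ideal A R" and B: "finite_colength R B" and mB: "\<mm> \<cdot> B \<subseteq> A"
  shows "finite_colength R A"
proof -
  have iB: "ideal B R" by (rule finite_colength_ideal[OF B])
  obtain S where S: "S \<subseteq> carrier R" "finite S" "B = Idl S" using fin_gen[OF iB] by blast
  have SB: "S \<subseteq> B" using S genideal_self[OF S(1)] by simp
  have AS: "A \<union> S \<subseteq> carrier R" using S ideal_subset_carrier[OF A] by simp
  have "B \<subseteq> Idl (A \<union> S)" unfolding S(3) by (rule Idl_mono[OF AS]) simp
  then have fin: "finite_colength R (Idl (A \<union> S))"
    by (rule finite_colength_mono(1)[OF B genideal_ideal[OF AS]])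
  have "\<mm> \<subseteq> colon R A s" if s: "s \<in> S" for s
  proof
    fix m assume m: "m \<in> \<mm>"
    have "s \<in> B" using s SB by blast
    then have "m \<otimes> s \<in> \<mm> \<cdot> B" by (rule ideal_prod.prod[OF m])
    then show "m \<in> colon R A s" using mB m m_carr by (auto simp: colon_def)
  qed
  then show ?thesis using finite_colength_Idl_Un[OF S(2) A S(1) fin colength_m(1)] by blast
qed

lemma finite_colength_m_power: "finite_colength R (ideal_power R \<mm> n)"
proof (induction n)
  case 0
  then show ?case unfolding ideal_power_0 by (rule colength_carrier)
next
  case (Suc n)
  have i: "ideal (ideal_power R \<mm> n) R" by (rule ideal_ideal_power[OF ideal_m])
  show ?case
  proof (rule finite_colength_of_m_multiple[OF ideal_ideal_power[OF ideal_m] Suc])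
    show "\<mm> \<cdot> ideal_power R \<mm> n \<subseteq> ideal_power R \<mm> (Suc n)"
      by (simp only: ideal_power_Suc ideal_prod_commute[OF ideal_m i] subset_refl)
  qed
qed

text \<open>The unit ideal qualifies, so the class is closed under all powers, including the
  zeroth.\<close>

definition m_primary :: "'a set \<Rightarrow> bool" where
  "m_primary A \<longleftrightarrow> ideal A R \<and> (\<exists>n. ideal_power R \<mm> n \<subseteq> A)"

lemma m_primary_ideal: "m_primary A \<Longrightarrow> ideal A R"
  by (simp add: m_primary_def)

lemma m_primary_finite_colength: "m_primary A \<Longrightarrow> finite_colength R A"
  unfolding m_primary_def using finite_colength_mono(1)[OF finite_colength_m_power] by blast

lemma m_primary_mono: "m_primary A \<Longrightarrow> ideal B R \<Longrightarrow> A \<subseteq> B \<Longrightarrow> m_primary B"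
  unfolding m_primary_def by blast

lemma m_primary_carrier: "m_primary (carrier R)"
  unfolding m_primary_def using oneideal ideal_subset_carrier[OF ideal_ideal_power[OF ideal_m]] by blast

lemma m_primary_m: "m_primary \<mm>"
  unfolding m_primary_def using ideal_m ideal_power_1[OF ideal_m] by blast

lemma m_primary_prod:
  assumes "m_primary A" "m_primary B" shows "m_primary (A \<cdot> B)"
proof -
  obtain m n where mn: "ideal_power R \<mm> m \<subseteq> A" "ideal_power R \<mm> n \<subseteq> B"
    using assms unfolding m_primary_def by blast
  have i: "ideal A R" "ideal B R" using assms by (simp_all add: m_primary_def)
  have "ideal_power R \<mm> (m + n) \<subseteq> A \<cdot> B"
    unfolding ideal_power_add[OF ideal_m] by (rule ideal_prod_mono[OF i mn])
  then show ?thesis unfolding m_primary_def using ideal_prod_is_ideal[OF i] by blast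
qed

lemma m_primary_power: "m_primary A \<Longrightarrow> m_primary (ideal_power R A n)"
  by (induction n) (simp_all only: ideal_power_0 ideal_power_Suc m_primary_carrier m_primary_prod)

text \<open>Each of the finitely many generators of \<open>\<mm>\<close> has a power, with exponent
  \<open>e i\<close>, in \<open>I\<close>. By the pigeonhole principle a monomial whose degree
  exceeds the sum of the \<open>e i\<close> is divisible by one of these powers.\<close>

lemma m_primary_of_P_primary:
  assumes "P_primary R \<mm> I" shows "m_primary I"
proof -
  have I: "ideal I R" and rad: "radical R I = \<mm>" using assms by (simp_all add: P_primary_def primary_ideal_def)
  obtain S where S: "S \<subseteq> carrier R" "finite S" "\<mm> = Idl S" using fin_gen[OF ideal_m] by blast
  obtain x where x: "x ` {..<card S} = S"
    using ex_bij_betw_nat_finite[OF S(2)] by (auto simp: bij_betw_def atLeast0LessThan)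
  define k where "k = card S"
  have xk: "x ` {..<k} = S" using x by (simp add: k_def)
  have xS: "x i \<in> S" if "i < k" for i using xk that by blast
  have xc: "x i \<in> carrier R" if "i < k" for i using xS[OF that] S by blast
  have "\<exists>n::nat. x i [^] n \<in> I" if "i < k" for i
  proof -
    have "x i \<in> \<mm>" using xS[OF that] S genideal_self[OF S(1)] by blast
    then show ?thesis unfolding rad[symmetric] radical_def by blast
  qed
  then obtain e :: "nat \<Rightarrow> nat" where e: "\<And>i. i < k \<Longrightarrow> x i [^] e i \<in> I" by metis
  have mono: "monomial R x j a \<in> I" if "i < j" "j \<le> k" "e i \<le> a i" for i j a
    using that
  proof (induction j)
    case (Suc j)
    have c: "monomial R x j a \<in> carrier R" "x j \<in> carrier R" using Suc.prems xc by (simp_all add: monomial_closed)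
    show ?case
    proof (cases "i = j")
      case True
      have "x j [^] a j = x j [^] e j \<otimes> x j [^] (a j - e j)"
        using c True Suc.prems by (simp add: nat_pow_mult)
      moreover have "x j [^] e j \<in> I" using e[of j] Suc.prems by simp
      ultimately have "x j [^] a j \<in> I" using ideal_mult_right[OF I] c by simp
      then show ?thesis using ideal_mult[OF I] c by simp
    next
      case False
      then have "monomial R x j a \<in> I" using Suc by simp
      then show ?thesis using ideal_mult_right[OF I] c by simp
    qed
  qed simp
  have "Idl (monomial R x k ` exps k (Suc (\<Sum>i<k. e i))) \<subseteq> I"
  proof (rule genideal_minimal[OF I], rule image_subsetI)
    fix a assume a: "a \<in> exps k (Suc (\<Sum>i<k. e i))"
    have "\<exists>i<k. e i \<le> a i"
    proof (rule ccontr)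
      assume "\<not> ?thesis"
      then have "(\<Sum>i<k. a i) \<le> (\<Sum>i<k. e i)" by (intro sum_mono) (simp add: not_le less_imp_le)
      then show False using a by (simp add: exps_def)
    qed
    then show "monomial R x k a \<in> I" using mono by blast
  qed
  then have "ideal_power R \<mm> (Suc (\<Sum>i<k. e i)) \<subseteq> I"
    using ideal_power_Idl[of k x, OF xc] by (simp only: S(3) xk)
  then show ?thesis unfolding m_primary_def using I by blast
qed

text \<open>The list \<open>xs\<close> is a basis of \<open>(A + (S)) / A\<close> over the residue field.\<close>

lemma independent_generators:
  assumes "finite S" and A: "finite_colength R A" and "S \<subseteq> carrier R"
    and "\<And>s. s \<in> S \<Longrightarrow> \<mm> \<subseteq> colon R A s"
  shows "\<exists>xs. set xs \<subseteq> S \<and> Idl (A \<union> set xs) = Idl (A \<union> S) \<and>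
    (\<forall>i<length xs. xs ! i \<notin> Idl (A \<union> set (take i xs))) \<and>
    colength R A = length xs + colength R (Idl (A \<union> S))"
  using assms(1,3,4)
proof (induction S rule: finite_induct)
  case empty
  then show ?case by (simp add: Idl_of_ideal[OF finite_colength_ideal[OF A]])
next
  case (insert s S)
  have iA: "ideal A R" by (rule finite_colength_ideal[OF A])
  have Ac: "A \<subseteq> carrier R" by (rule ideal_subset_carrier[OF iA])
  have "\<exists>xs. set xs \<subseteq> S \<and> Idl (A \<union> set xs) = Idl (A \<union> S) \<and>
    (\<forall>i<length xs. xs ! i \<notin> Idl (A \<union> set (take i xs))) \<and>
    colength R A = length xs + colength R (Idl (A \<union> S))"
    by (rule insert.IH) (use insert.prems in blast)+
  then obtain xs where xs: "set xs \<subseteq> S" "Idl (A \<union> set xs) = Idl (A \<union> S)"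
    "\<forall>i<length xs. xs ! i \<notin> Idl (A \<union> set (take i xs))"
    "colength R A = length xs + colength R (Idl (A \<union> S))" by blast
  have s: "s \<in> carrier R" and S: "S \<subseteq> carrier R" using insert.prems by auto
  have AS: "A \<union> S \<subseteq> carrier R" using Ac S by simp
  let ?B = "Idl (A \<union> S)"
  have iB: "ideal ?B R" by (rule genideal_ideal[OF AS])
  have AB: "A \<subseteq> ?B" by (rule subset_Idl[OF AS]) simp
  have Bs: "Idl (insert s ?B) = Idl (A \<union> insert s S)"
    using Idl_Un_Idl[of "{s}" "A \<union> S"] s AS by simp
  show ?case
  proof (cases "s \<in> ?B")
    case True
    then have "Idl (A \<union> insert s S) = ?B" unfolding Bs[symmetric] by (simp add: insert_absorb Idl_of_ideal[OF iB])
    then show ?thesis using xs by (intro exI[of _ xs]) auto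
  next
    case False
    have fB: "finite_colength R ?B" by (rule finite_colength_mono(1)[OF A iB AB])
    have "\<mm> \<subseteq> colon R ?B s" using insert.prems(2)[of s] colon_mono[OF AB, of s] by blast
    moreover have "colon R ?B s \<noteq> carrier R"
    proof
      assume "colon R ?B s = carrier R"
      then have "\<one> \<in> colon R ?B s" by simp
      then show False using False s by (simp add: colon_def)
    qed
    \<comment> \<open>The colon is proper and contains \<open>\<mm>\<close>, so it is
      \<open>\<mm>\<close>: a new generator lowers the colength by exactly one.\<close>
    ultimately have "colon R ?B s = \<mm>"
      using I_maximal[OF ideal_colon[OF iB s]] ideal_subset_carrier[OF ideal_colon[OF iB s]] by blast
    then have "colength R ?B = colength R (Idl (A \<union> insert s S)) + 1"
      using colength_insert[OF fB s] colength_m Bs by simp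
    moreover have "Idl (A \<union> set (xs @ [s])) = Idl (A \<union> insert s S)"
    proof -
      have "A \<union> set xs \<subseteq> carrier R" using Ac xs S by blast
      then have "Idl ({s} \<union> Idl (A \<union> set xs)) = Idl ({s} \<union> (A \<union> set xs))"
        using s by (intro Idl_Un_Idl) simp_all
      then show ?thesis using xs(2) Bs by simp
    qed
    moreover have "\<forall>i<length (xs @ [s]). (xs @ [s]) ! i \<notin> Idl (A \<union> set (take i (xs @ [s])))"
      using xs(3) False xs(2) by (auto simp: nth_append less_Suc_eq)
    ultimately show ?thesis using xs by (intro exI[of _ "xs @ [s]"]) auto
  qed
qed

end

section \<open>Leading coefficient ideals\<close>

definition exp_deg :: "nat \<Rightarrow> (nat \<Rightarrow> nat) \<Rightarrow> nat" where
  "exp_deg k a = (\<Sum>i<k. a i)"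

text \<open>\<open>less_fun\<close> is the lexicographic order, which is total on finitely supported
  vectors and compatible with addition. Comparing only vectors of one degree keeps these sets
  finite.\<close>

definition lower_exps :: "nat \<Rightarrow> (nat \<Rightarrow> nat) \<Rightarrow> (nat \<Rightarrow> nat) set" where
  "lower_exps k a = {b \<in> exps k (exp_deg k a). less_fun b a}"

lemma exp_deg_exps: "a \<in> exps k n \<Longrightarrow> exp_deg k a = n"
  by (simp add: exp_deg_def exps_def)

lemma exp_deg_add: "exp_deg k (\<lambda>i. a i + b i) = exp_deg k a + exp_deg k b"
  by (simp add: exp_deg_def sum.distrib)

lemma less_fun_add: "less_fun (a::nat \<Rightarrow> nat) b \<Longrightarrow> less_fun (\<lambda>i. a i + c i) (\<lambda>i. b i + c i)"
  by (auto simp: less_fun_def)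

lemma exps_less_fun_linear:
  assumes "a \<in> exps k m" "b \<in> exps k n" shows "less_fun a b \<or> a = b \<or> less_fun b a"
proof (rule less_fun_trichotomy)
  have "{i. a i \<noteq> b i} \<subseteq> {..<k}" using assms by (auto simp: exps_def not_le[symmetric])
  then show "finite {i. a i \<noteq> b i}" by (rule finite_subset) simp
qed

lemma exps_max:
  assumes "finite Y" "Y \<noteq> {}" "Y \<subseteq> exps k n"
  shows "\<exists>m\<in>Y. \<forall>b\<in>Y - {m}. less_fun b m"
  using assms
proof (induction Y rule: finite_ne_induct)
  case (insert a Y)
  then obtain m where m: "m \<in> Y" "\<forall>b\<in>Y - {m}. less_fun b m" by auto
  have "less_fun a m \<or> a = m \<or> less_fun m a"
    using exps_less_fun_linear[of a k n m n] insert.prems m by auto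
  then consider "less_fun a m" | "less_fun m a" | "a = m" by blast
  then show ?case
  proof cases
    case 1
    then show ?thesis using m by (intro bexI[of _ m]) auto
  next
    case 2
    then have "less_fun b a" if "b \<in> Y" for b using m that less_fun_trans by (cases "b = m") auto
    then show ?thesis by (intro bexI[of _ a]) auto
  next
    case 3
    then show ?thesis using m insert.hyps by auto
  qed
qed simp

lemma lower_exps_add:
  assumes "b \<in> lower_exps k a" "c \<in> exps k j"
  shows "(\<lambda>i. b i + c i) \<in> lower_exps k (\<lambda>i. a i + c i)"
  using assms exps_add[of b k "exp_deg k a" c j] less_fun_add
  by (simp add: lower_exps_def exp_deg_add exp_deg_exps)

text \<open>The leading coefficients at the monomial with exponent \<open>a\<close> of those homogeneous forms whose
  value at \<open>x\<close> lies in \<open>E\<close>.\<close>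

definition lead_ideal :: "('a, 'b) ring_scheme \<Rightarrow> (nat \<Rightarrow> 'a) \<Rightarrow> nat \<Rightarrow> (nat \<Rightarrow> 'a set) \<Rightarrow> (nat \<Rightarrow> nat) \<Rightarrow> 'a set" where
  "lead_ideal R x k E a =
     colon R (genideal R (E (exp_deg k a) \<union> monomial R x k ` lower_exps k a)) (monomial R x k a)"

context cring
begin

lemma Idl_insert_Un:
  assumes "A \<subseteq> carrier R" "x \<in> carrier R"
  shows "Idl (insert x (Idl A)) = Idl (insert x A)"
  using Idl_Un_Idl[of "{x}" A] assms by simp

lemma Idl_Un_form:
  assumes A: "ideal A R" and S: "S \<subseteq> carrier R" and y: "y \<in> Idl (A \<union> S)"
  shows "\<exists>a\<in>A. \<exists>s\<in>Idl S. y = a \<oplus> s"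
proof -
  have "Idl (A \<union> S) = Idl (A \<union> Idl S)"
    using Idl_Un_Idl[OF ideal_subset_carrier[OF A] S] by simp
  also have "\<dots> = A <+> Idl S" by (rule union_genideal[OF A genideal_ideal[OF S]])
  finally have "y \<in> A <+> Idl S" using y by simp
  then show ?thesis unfolding set_add_def' by blast
qed

text \<open>The monomials are adjoined to \<open>A\<close> in increasing order, and each contributes
  the colength of its colon by what is already there. The induction removes the largest exponent,
  which leaves the sets below the other exponents unchanged.\<close>

lemma colength_monomials:
  assumes x: "\<And>i. i < k \<Longrightarrow> x i \<in> carrier R" and A: "finite_colength R A" and Y: "Y \<subseteq> exps k n"
  shows "colength R A = colength R (Idl (A \<union> monomial R x k ` Y)) +
    (\<Sum>a\<in>Y. colength R (colon R (Idl (A \<union> monomial R x k ` {b \<in> Y. less_fun b a})) (monomial R x k a)))"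
proof -
  have Ac: "A \<subseteq> carrier R" by (rule ideal_subset_carrier[OF finite_colength_ideal[OF A]])
  have mc: "monomial R x k a \<in> carrier R" for a using x by (rule monomial_closed)
  have Mc: "A \<union> monomial R x k ` Z \<subseteq> carrier R" for Z using Ac mc by auto
  have fY: "finite Y" using finite_subset[OF Y finite_exps] .
  from fY Y show ?thesis
  proof (induction "card Y" arbitrary: Y)
    case 0
    then show ?case using Idl_of_ideal[OF finite_colength_ideal[OF A]] by simp
  next
    case (Suc c)
    then have "Y \<noteq> {}" by auto
    obtain m where m: "m \<in> Y" "\<forall>b\<in>Y - {m}. less_fun b m"
      using exps_max[OF Suc.prems(1) \<open>Y \<noteq> {}\<close> Suc.prems(2)] by blast
    let ?Y = "Y - {m}"
    let ?M = "monomial R x k"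
    have IH: "colength R A = colength R (Idl (A \<union> ?M ` ?Y)) +
      (\<Sum>a\<in>?Y. colength R (colon R (Idl (A \<union> ?M ` {b \<in> ?Y. less_fun b a})) (?M a)))"
      by (rule Suc.hyps(1)) (use Suc m in auto)
    have "{b \<in> ?Y. less_fun b a} = {b \<in> Y. less_fun b a}" if "a \<in> ?Y" for a
      using m that less_fun_asym by auto
    then have 1: "(\<Sum>a\<in>?Y. colength R (colon R (Idl (A \<union> ?M ` {b \<in> ?Y. less_fun b a})) (?M a))) =
      (\<Sum>a\<in>?Y. colength R (colon R (Idl (A \<union> ?M ` {b \<in> Y. less_fun b a})) (?M a)))"
      by (intro sum.cong refl) simp
    have 2: "{b \<in> Y. less_fun b m} = ?Y" using m less_fun_irrefl by auto
    let ?B = "Idl (A \<union> ?M ` ?Y)"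
    have fB: "finite_colength R ?B"
      by (rule finite_colength_mono(1)[OF A genideal_ideal[OF Mc]], rule subset_Idl[OF Mc]) simp
    have "Idl (insert (?M m) ?B) = Idl (insert (?M m) (A \<union> ?M ` ?Y))" by (rule Idl_insert_Un[OF Mc mc])
    also have "insert (?M m) (A \<union> ?M ` ?Y) = A \<union> ?M ` Y" using m(1) by auto
    finally have 3: "colength R ?B = colength R (Idl (A \<union> ?M ` Y)) + colength R (colon R ?B (?M m))"
      using colength_insert[OF fB mc[of m]] by simp
    show ?case
      unfolding sum.remove[OF Suc.prems(1) m(1)] 2 using IH 1 3 by simp
  qed
qed

lemma ideal_lead_ideal:
  assumes x: "\<And>i. i < k \<Longrightarrow> x i \<in> carrier R" and E: "\<And>n. ideal (E n) R"
  shows "ideal (lead_ideal R x k E a) R" "E (exp_deg k a) \<subseteq> lead_ideal R x k E a"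
proof -
  have mc: "monomial R x k a \<in> carrier R" for a using x by (rule monomial_closed)
  have Mc: "E n \<union> monomial R x k ` Z \<subseteq> carrier R" for Z n using ideal_subset_carrier[OF E] mc by auto
  show "ideal (lead_ideal R x k E a) R"
    unfolding lead_ideal_def by (rule ideal_colon[OF genideal_ideal[OF Mc] mc])
  have "E (exp_deg k a) \<subseteq> Idl (E (exp_deg k a) \<union> monomial R x k ` lower_exps k a)"
    by (rule subset_Idl[OF Mc]) simp
  also have "\<dots> \<subseteq> lead_ideal R x k E a"
    unfolding lead_ideal_def by (rule subset_colon[OF genideal_ideal[OF Mc] mc])
  finally show "E (exp_deg k a) \<subseteq> lead_ideal R x k E a" .
qed

text \<open>Multiplication by the monomial with exponent \<open>c\<close> respects the order, so a
  form with leading exponent \<open>a\<close> becomes one with leading exponent \<open>a + c\<close>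
  and the same leading coefficient.\<close>

lemma lead_ideal_add:
  assumes x: "\<And>i. i < k \<Longrightarrow> x i \<in> carrier R" and E: "\<And>n. ideal (E n) R"
    and graded: "\<And>n j u y. u \<in> exps k j \<Longrightarrow> y \<in> E n \<Longrightarrow> y \<otimes> monomial R x k u \<in> E (n + j)"
    and c: "c \<in> exps k j"
  shows "lead_ideal R x k E a \<subseteq> lead_ideal R x k E (\<lambda>i. a i + c i)"
proof
  let ?M = "monomial R x k" and ?ac = "\<lambda>i. a i + c i"
  have mc: "?M a \<in> carrier R" for a using x by (rule monomial_closed)
  have Mc: "E n \<union> ?M ` Z \<subseteq> carrier R" for Z n using ideal_subset_carrier[OF E] mc by auto
  let ?B = "Idl (E (exp_deg k ?ac) \<union> ?M ` lower_exps k ?ac)"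
  have iB: "ideal ?B R" by (rule genideal_ideal[OF Mc])
  have deg: "exp_deg k ?ac = exp_deg k a + j" using c by (simp add: exp_deg_add exp_deg_exps)
  have sB: "E (exp_deg k ?ac) \<union> ?M ` lower_exps k ?ac \<subseteq> ?B" by (rule genideal_self[OF Mc])
  have "Idl (E (exp_deg k a) \<union> ?M ` lower_exps k a) \<subseteq> colon R ?B (?M c)"
  proof (rule genideal_minimal[OF ideal_colon[OF iB mc]], rule Un_least)
    show "E (exp_deg k a) \<subseteq> colon R ?B (?M c)"
    proof
      fix y assume y: "y \<in> E (exp_deg k a)"
      have "y \<otimes> ?M c \<in> E (exp_deg k ?ac)" using graded[OF c y] deg by simp
      then show "y \<in> colon R ?B (?M c)" using sB ideal_carr[OF E y] by (simp add: colon_def subset_iff)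
    qed
    show "?M ` lower_exps k a \<subseteq> colon R ?B (?M c)"
    proof (rule image_subsetI)
      fix b assume b: "b \<in> lower_exps k a"
      have "?M b \<otimes> ?M c = ?M (\<lambda>i. b i + c i)" using monomial_add[of k x b c] x by simp
      moreover have "?M (\<lambda>i. b i + c i) \<in> ?B" using lower_exps_add[OF b c] sB by blast
      ultimately show "?M b \<in> colon R ?B (?M c)" using mc by (simp add: colon_def)
    qed
  qed
  moreover fix r assume r: "r \<in> lead_ideal R x k E a"
  ultimately have "r \<otimes> ?M a \<in> colon R ?B (?M c)" "r \<in> carrier R"
    by (auto simp: lead_ideal_def colon_def)
  then have "r \<otimes> ?M a \<otimes> ?M c \<in> ?B" "r \<in> carrier R" by (auto simp: colon_def)
  then have "r \<otimes> ?M ?ac \<in> ?B" using monomial_add[of k x a c] x mc by (simp add: m_assoc)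
  then show "r \<in> lead_ideal R x k E ?ac" using \<open>r \<in> carrier R\<close> by (simp add: lead_ideal_def colon_def)
qed

lemma lead_ideal_mono:
  assumes x: "\<And>i. i < k \<Longrightarrow> x i \<in> carrier R" and E: "\<And>n. ideal (E n) R"
    and graded: "\<And>n j u y. u \<in> exps k j \<Longrightarrow> y \<in> E n \<Longrightarrow> y \<otimes> monomial R x k u \<in> E (n + j)"
    and ab: "\<forall>i\<ge>k. a i = 0" "\<forall>i\<ge>k. b i = 0" "\<And>i. i < k \<Longrightarrow> a i \<le> b i"
  shows "lead_ideal R x k E a \<subseteq> lead_ideal R x k E b"
proof -
  define c where "c i = b i - a i" for i
  have "c \<in> exps k (\<Sum>i<k. c i)" using ab by (simp add: exps_def c_def)
  moreover have "(\<lambda>i. a i + c i) = b"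
  proof
    fix i show "a i + c i = b i" using ab by (cases "i < k") (simp_all add: c_def)
  qed
  ultimately show ?thesis using lead_ideal_add[of k x E c _ a, OF x E graded] by simp
qed

text \<open>The \<open>E n\<close> are the components of a homogeneous ideal in the Rees algebra of
  Q, the ideal of the \<open>x i\<close>. The length of Q^n/E_n is the sum of the colengths of the
  leading coefficient ideals in degree n, and these ideals grow with the exponent, so their
  colengths reverse the order.\<close>

theorem ev_int_poly_graded_family:
  assumes x: "\<And>i. i < k \<Longrightarrow> x i \<in> carrier R" and E: "\<And>n. finite_colength R (E n)"
    and graded: "\<And>n j u y. u \<in> exps k j \<Longrightarrow> y \<in> E n \<Longrightarrow> y \<otimes> monomial R x k u \<in> E (n + j)"
    and EQ: "\<And>n. E n \<subseteq> ideal_power R (Idl (x ` {..<k})) n"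
  shows "ev_int_poly k (\<lambda>n. int (colength R (E n)) - int (colength R (ideal_power R (Idl (x ` {..<k})) n)))"
proof -
  let ?M = "monomial R x k" and ?Q = "Idl (x ` {..<k})"
  have iE: "ideal (E n) R" for n by (rule finite_colength_ideal[OF E])
  have mc: "?M a \<in> carrier R" for a using x by (rule monomial_closed)
  have eq: "int (colength R (E n)) - int (colength R (ideal_power R ?Q n)) =
      (\<Sum>a\<in>exps k n. int (colength R (lead_ideal R x k E a)))" for n
  proof -
    have Q: "ideal_power R ?Q n = Idl (?M ` exps k n)" by (rule ideal_power_Idl[OF x])
    have Mc: "?M ` exps k n \<subseteq> carrier R" using mc by auto
    have "Idl (E n \<union> ?M ` exps k n) = ideal_power R ?Q n"
      by (rule Idl_Un_generators[OF iE EQ Mc Q])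
    moreover have "colon R (Idl (E n \<union> ?M ` {b \<in> exps k n. less_fun b a})) (?M a) = lead_ideal R x k E a"
      if "a \<in> exps k n" for a
      using that by (simp add: lead_ideal_def lower_exps_def exp_deg_exps)
    then have "(\<Sum>a\<in>exps k n. colength R (colon R (Idl (E n \<union> ?M ` {b \<in> exps k n. less_fun b a})) (?M a)))
      = (\<Sum>a\<in>exps k n. colength R (lead_ideal R x k E a))" by (intro sum.cong refl) simp
    ultimately show ?thesis using colength_monomials[of k x "E n" "exps k n" n, OF x E subset_refl] by simp
  qed
  show ?thesis
    unfolding eq
  proof (rule ev_int_poly_sum_exps)
    fix a b :: "nat \<Rightarrow> nat" assume ab: "\<forall>i\<ge>k. a i = 0" "\<forall>i\<ge>k. b i = 0" "\<And>i. a i \<le> b i"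
    have sub: "lead_ideal R x k E a \<subseteq> lead_ideal R x k E b"
      by (rule lead_ideal_mono[of k x E a b, OF x iE graded ab(1,2)]) (use ab(3) in auto)
    have "finite_colength R (lead_ideal R x k E a)"
      by (rule finite_colength_mono(1)[OF E ideal_lead_ideal(1)[OF x iE] ideal_lead_ideal(2)[OF x iE]])
    then show "colength R (lead_ideal R x k E b) \<le> colength R (lead_ideal R x k E a)"
      by (rule finite_colength_mono(2)[OF _ ideal_lead_ideal(1)[OF x iE] sub])
  qed
qed

end

section \<open>The Artin-Rees lemma\<close>

context noetherian_local_ring
begin

text \<open>A form of finite generation: beyond degree \<open>c\<close> every leading coefficient
  ideal already occurs at an exponent with one factor fewer. If not, a monotone subsequence of bad
  exponents would give a strictly ascending chain of ideals.\<close>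

lemma lead_ideal_stationary:
  assumes x: "\<And>i. i < k \<Longrightarrow> x i \<in> carrier R" and E: "\<And>n. ideal (E n) R"
    and graded: "\<And>n j u y. u \<in> exps k j \<Longrightarrow> y \<in> E n \<Longrightarrow> y \<otimes> monomial R x k u \<in> E (n + j)"
  shows "\<exists>c. \<forall>a. (\<forall>i\<ge>k. a i = 0) \<longrightarrow> exp_deg k a > c \<longrightarrow>
    (\<exists>i<k. a i > 0 \<and> lead_ideal R x k E (a(i := a i - 1)) = lead_ideal R x k E a)"
proof (rule ccontr)
  let ?L = "lead_ideal R x k E"
  assume "\<not> ?thesis"
  then have "\<forall>c. \<exists>a. (\<forall>i\<ge>k. a i = 0) \<and> exp_deg k a > c \<and> (\<forall>i<k. a i > 0 \<longrightarrow> ?L (a(i := a i - 1)) \<noteq> ?L a)"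
    by blast
  then obtain f where f: "\<And>c. \<forall>i\<ge>k. f c i = 0" "\<And>c. exp_deg k (f c) > c"
    "\<And>c i. i < k \<Longrightarrow> f c i > 0 \<Longrightarrow> ?L ((f c)(i := f c i - 1)) \<noteq> ?L (f c)" by metis
  \<comment> \<open>Each bad vector is chosen of larger degree than its predecessor. Along the
    monotone subsequence some coordinate therefore increases strictly, and lowering it by one still
    leaves a vector above the earlier one.\<close>
  define s where "s = rec_nat (f 0) (\<lambda>_ a. f (exp_deg k a))"
  have s: "s (Suc n) = f (exp_deg k (s n))" for n by (simp add: s_def)
  have sf: "\<exists>c. s n = f c" for n by (cases n) (auto simp: s_def)
  have sdeg: "strict_mono (\<lambda>n. exp_deg k (s n))" unfolding strict_mono_Suc_iff s using f(2) by blast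
  obtain \<phi> :: "nat \<Rightarrow> nat" where \<phi>: "strict_mono \<phi>" "\<forall>i<k. mono (\<lambda>j. s (\<phi> j) i)"
    using Dickson[of k s] by blast
  have step: "?L (s (\<phi> n)) \<subset> ?L (s (\<phi> (Suc n)))" for n
  proof -
    let ?a = "s (\<phi> n)" and ?b = "s (\<phi> (Suc n))"
    obtain c d where cd: "?a = f c" "?b = f d" using sf by blast
    have le: "?a i \<le> ?b i" if "i < k" for i using \<phi>(2) that by (auto simp: mono_def)
    have "\<phi> n < \<phi> (Suc n)" using \<phi>(1) by (simp add: strict_mono_def)
    then have "exp_deg k ?a < exp_deg k ?b" using sdeg by (simp add: strict_mono_def)
    then have "\<exists>i<k. ?a i < ?b i"
      unfolding exp_deg_def by (metis (no_types, lifting) lessThan_iff not_le sum_mono)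
    then obtain i where i: "i < k" "?a i < ?b i" by blast
    have a0: "\<forall>i\<ge>k. ?a i = 0" and b0: "\<forall>i\<ge>k. ?b i = 0" unfolding cd by (rule f(1))+
    let ?b' = "?b(i := ?b i - 1)"
    have "?L ?a \<subseteq> ?L ?b'"
      by (rule lead_ideal_mono[of k x E ?a ?b', OF x E graded a0]) (use b0 i le in auto)
    moreover have "?L ?b' \<subseteq> ?L ?b"
      by (rule lead_ideal_mono[of k x E ?b' ?b, OF x E graded _ b0]) (use b0 i le in auto)
    moreover have "?L ?b' \<noteq> ?L ?b" unfolding cd by (rule f(3)) (use i cd in auto)
    ultimately show ?thesis by blast
  qed
  have mono: "?L (s (\<phi> m)) \<subseteq> ?L (s (\<phi> n))" if "m \<le> n" for m n
    using that by (induction n rule: dec_induct) (use step in blast)+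
  let ?C = "range (\<lambda>n. ?L (s (\<phi> n)))"
  have "subset.chain {I. ideal I R} ?C"
    unfolding subset_chain_def
  proof (intro conjI ballI)
    show "?C \<subseteq> {I. ideal I R}" using ideal_lead_ideal(1)[of k x E, OF x E] by blast
    fix X Y assume "X \<in> ?C" "Y \<in> ?C"
    then obtain m n where XY: "X = ?L (s (\<phi> m))" "Y = ?L (s (\<phi> n))" by blast
    show "X \<subseteq> Y \<or> Y \<subseteq> X" unfolding XY using mono linear[of m n] by blast
  qed
  then have "\<Union>?C \<in> ?C" by (intro ideal_chain_is_trivial) auto
  then obtain n where "\<Union>?C = ?L (s (\<phi> n))" by blast
  then show False using step[of n] by blast
qed

text \<open>With \<open>E n\<close> the intersection of Q^n and D, the leading coefficient of an
  element of \<open>E n\<close> beyond degree \<open>c\<close> also occurs one degree lower.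
  Subtracting \<open>x i\<close> times an element of \<open>E (n - 1)\<close> removes the leading
  monomial, and repeating this gives E_n \<subseteq> Q E_(n-1).\<close>

theorem Artin_Rees:
  fixes x :: "nat \<Rightarrow> 'a"
  assumes x: "\<And>i. i < k \<Longrightarrow> x i \<in> carrier R" and D: "ideal D R" and Q: "Q = Idl (x ` {..<k})"
  shows "\<exists>c. \<forall>n. ideal_power R Q (n + c) \<inter> D \<subseteq> ideal_power R Q n \<cdot> D"
proof -
  let ?M = "monomial R x k"
  have X: "x ` {..<k} \<subseteq> carrier R" using x by auto
  have iQ: "ideal Q R" unfolding Q by (rule genideal_ideal[OF X])
  have xQ: "x i \<in> Q" if "i < k" for i using genideal_self[OF X] that unfolding Q by blast
  define E where "E n = ideal_power R Q n \<inter> D" for n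
  have E: "ideal (E n) R" for n unfolding E_def by (rule i_intersect[OF ideal_ideal_power[OF iQ] D])
  have mc: "?M a \<in> carrier R" for a using x by (rule monomial_closed)
  have Mc: "?M ` Z \<subseteq> carrier R" for Z using mc by auto
  have graded: "y \<otimes> ?M u \<in> E (n + j)" if u: "u \<in> exps k j" and y: "y \<in> E n" for n j u y
  proof -
    have "?M u \<in> ideal_power R Q (\<Sum>i<k. u i)" by (rule monomial_in_power[OF iQ]) (rule xQ)
    then have "?M u \<in> ideal_power R Q j" using u by (simp add: exps_def)
    then have "y \<otimes> ?M u \<in> ideal_power R Q (n + j)"
      unfolding ideal_power_add[OF iQ] using y by (intro ideal_prod.prod) (simp_all add: E_def)
    moreover have "y \<otimes> ?M u \<in> D" using y ideal_mult_right[OF D _ mc] by (simp add: E_def)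
    ultimately show ?thesis by (simp add: E_def)
  qed
  obtain c where c: "\<And>a. \<forall>i\<ge>k. a i = 0 \<Longrightarrow> exp_deg k a > c \<Longrightarrow>
    \<exists>i<k. a i > 0 \<and> lead_ideal R x k E (a(i := a i - 1)) = lead_ideal R x k E a"
    using lead_ideal_stationary[of k x E, OF x E graded] by blast
  \<comment> \<open>\<open>Y\<close> is an initial segment of the exponents of degree
    \<open>n\<close>. Removing its maximum \<open>m\<close> then leaves exactly
    \<open>lower_exps k m\<close>, so the coefficient at \<open>m\<close> lies in
    \<open>lead_ideal\<close>, and the induction can go on.\<close>
  have main: "E n \<inter> Idl (?M ` Y) \<subseteq> Q \<cdot> E (n - 1)"
    if "n > c" "Y \<subseteq> exps k n" "\<And>a. a \<in> Y \<Longrightarrow> lower_exps k a \<subseteq> Y" for n Y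
    using finite_subset[OF that(2) finite_exps] that
  proof (induction "card Y" arbitrary: Y)
    case 0
    have iQE: "ideal (Q \<cdot> E (n - 1)) R" by (rule ideal_prod_is_ideal[OF iQ E])
    have "Y = {}" using 0 by auto
    then have "Idl (?M ` Y) \<subseteq> Q \<cdot> E (n - 1)" by (intro genideal_minimal[OF iQE]) simp
    then show ?case by blast
  next
    case (Suc p)
    have iQE: "ideal (Q \<cdot> E (n - 1)) R" by (rule ideal_prod_is_ideal[OF iQ E])
    have "Y \<noteq> {}" using Suc.hyps by auto
    obtain m where m: "m \<in> Y" "\<forall>b\<in>Y - {m}. less_fun b m"
      using exps_max[OF Suc.prems(1) \<open>Y \<noteq> {}\<close> Suc.prems(3)] by blast
    have mn: "m \<in> exps k n" "exp_deg k m = n" using m Suc.prems(3) exp_deg_exps by blast+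
    let ?Y = "Y - {m}"
    have low: "lower_exps k m = ?Y"
    proof
      show "lower_exps k m \<subseteq> ?Y" using Suc.prems(4)[OF m(1)] less_fun_irrefl by (auto simp: lower_exps_def)
      show "?Y \<subseteq> lower_exps k m" using m Suc.prems(3) mn by (auto simp: lower_exps_def)
    qed
    have IH: "E n \<inter> Idl (?M ` ?Y) \<subseteq> Q \<cdot> E (n - 1)"
    proof (rule Suc.hyps(1))
      fix a assume a: "a \<in> ?Y"
      show "lower_exps k a \<subseteq> ?Y"
      proof
        fix b assume b: "b \<in> lower_exps k a"
        then have "b \<in> Y" using Suc.prems(4) a by blast
        moreover have "b \<noteq> m" using b m a less_fun_asym by (auto simp: lower_exps_def)
        ultimately show "b \<in> ?Y" by simp
      qed
    qed (use Suc m in auto)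
    have iY: "ideal (Idl (?M ` ?Y)) R" by (rule genideal_ideal[OF Mc])
    show ?case
    proof
      fix e assume e: "e \<in> E n \<inter> Idl (?M ` Y)"
      have "insert (?M m) (?M ` ?Y) = ?M ` Y" using m(1) by auto
      then have "Idl (?M ` Y) = Idl (insert (?M m) (Idl (?M ` ?Y)))" using Idl_insert_Un[OF Mc mc] by simp
      then obtain s r where sr: "s \<in> Idl (?M ` ?Y)" "r \<in> carrier R" "e = s \<oplus> r \<otimes> ?M m"
        using e unfolding Idl_insert[OF iY mc] by blast
      have sc: "s \<in> carrier R" by (rule ideal_carr[OF iY sr(1)])
      have rm: "r \<otimes> ?M m = e \<ominus> s"
        using sr(2,3) sc mc[of m] by (simp add: minus_eq a_comm[of s "r \<otimes> ?M m"] a_assoc r_neg)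
      have EMc: "E q \<union> ?M ` Z \<subseteq> carrier R" for Z q using ideal_subset_carrier[OF E] mc by auto
      have "e \<ominus> s \<in> Idl (E n \<union> ?M ` ?Y)"
      proof -
        have i: "ideal (Idl (E n \<union> ?M ` ?Y)) R" by (rule genideal_ideal[OF EMc])
        have "e \<in> Idl (E n \<union> ?M ` ?Y)" using e genideal_self[OF EMc[of n ?Y]] by blast
        moreover have "s \<in> Idl (E n \<union> ?M ` ?Y)" using sr Idl_mono[OF EMc[of n ?Y], of "?M ` ?Y"] by blast
        ultimately show ?thesis unfolding minus_eq by (intro ideal_add[OF i] ideal_neg[OF i])
      qed
      then have rL: "r \<in> lead_ideal R x k E m"
        using sr(2) by (simp add: lead_ideal_def colon_def low mn rm)
      \<comment> \<open>Since \<open>r\<close> is also a leading coefficient at the exponent with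
        one \<open>x i\<close> fewer, multiplying by \<open>x i\<close> writes \<open>r\<close>
        times the monomial of \<open>m\<close> as a multiple of \<open>x i\<close> by an element of
        \<open>E (n - 1)\<close> plus smaller monomials.\<close>
      obtain i where i: "i < k" "m i > 0"
        "lead_ideal R x k E (m(i := m i - 1)) = lead_ideal R x k E m"
        using c[of m] mn \<open>n > c\<close> by (auto simp: exps_def)
      let ?m = "m(i := m i - 1)"
      have m': "(\<lambda>j. ?m j + unit_exp i j) = m"
        using i(2) by (auto simp: unit_exp_def)
      have ui: "unit_exp i \<in> exps k 1" by (rule unit_exp_exps[OF i(1)])
      have dm: "exp_deg k ?m = n - 1"
        using exp_deg_add[of k ?m "unit_exp i"] exp_deg_exps[OF ui] mn unfolding m' by simp
      have n1: "n - 1 + 1 = n" using \<open>n > c\<close> by simp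
      have Mm: "?M m = ?M ?m \<otimes> x i"
        using monomial_add[of k x ?m "unit_exp i"] monomial_unit[of k x i] x i(1) unfolding m' by simp
      have "r \<in> lead_ideal R x k E ?m" using rL by (simp only: i(3))
      then have "r \<otimes> ?M ?m \<in> Idl (E (n - 1) \<union> ?M ` lower_exps k ?m)"
        unfolding lead_ideal_def colon_def dm by blast
      then obtain e' s' where es: "e' \<in> E (n - 1)" "s' \<in> Idl (?M ` lower_exps k ?m)" "r \<otimes> ?M ?m = e' \<oplus> s'"
        using Idl_Un_form[OF E Mc] by blast
      have xc: "x i \<in> carrier R" by (rule x[OF i(1)])
      have c': "e' \<in> carrier R" "s' \<in> carrier R"
        using ideal_carr[OF E es(1)] ideal_carr[OF genideal_ideal[OF Mc] es(2)] by auto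
      have "Idl (?M ` lower_exps k ?m) \<subseteq> colon R (Idl (?M ` ?Y)) (x i)"
      proof (rule genideal_minimal[OF ideal_colon[OF iY xc]], rule image_subsetI)
        fix b assume b: "b \<in> lower_exps k ?m"
        have "?M b \<otimes> x i = ?M (\<lambda>j. b j + unit_exp i j)"
          using monomial_add[of k x b "unit_exp i"] monomial_unit[of k x i] x i(1) by simp
        moreover have "(\<lambda>j. b j + unit_exp i j) \<in> ?Y"
          using lower_exps_add[OF b ui] unfolding m' low .
        ultimately have "?M b \<otimes> x i \<in> Idl (?M ` ?Y)" using genideal_self[OF Mc[of ?Y]] by auto
        then show "?M b \<in> colon R (Idl (?M ` ?Y)) (x i)" using mc by (simp add: colon_def)
      qed
      then have s'Y: "s' \<otimes> x i \<in> Idl (?M ` ?Y)" using es(2) by (auto simp: colon_def)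
      have e'n: "e' \<otimes> x i \<in> E n"
        using graded[OF ui es(1)] monomial_unit[of k x i] x i(1) n1 by simp
      have e'Q: "e' \<otimes> x i \<in> Q \<cdot> E (n - 1)"
        using ideal_prod.prod[OF xQ[OF i(1)] es(1), of R] m_comm[OF c'(1) xc] by simp
      have "r \<otimes> ?M m = e' \<otimes> x i \<oplus> s' \<otimes> x i"
      proof -
        have "r \<otimes> ?M m = (r \<otimes> ?M ?m) \<otimes> x i" using Mm sr(2) mc xc by (simp add: m_assoc)
        then show ?thesis using es(3) c' xc by (simp add: l_distr)
      qed
      \<comment> \<open>The last summand lies in Q E_(n-1). The bracket lies in \<open>E n\<close>,
        being a difference of two of its elements, and involves only exponents below
        \<open>m\<close>, so the induction hypothesis applies to it.\<close>
      then have e_eq: "e = (s \<oplus> s' \<otimes> x i) \<oplus> e' \<otimes> x i" using sr(3) c' xc sc by (simp add: a_ac)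
      have "(s \<oplus> s' \<otimes> x i) = e \<ominus> e' \<otimes> x i" unfolding e_eq using c' xc sc by (simp add: minus_eq a_assoc r_neg)
      then have "(s \<oplus> s' \<otimes> x i) \<in> E n" using e e'n unfolding minus_eq by (simp add: ideal_add[OF E] ideal_neg[OF E])
      moreover have "(s \<oplus> s' \<otimes> x i) \<in> Idl (?M ` ?Y)" by (rule ideal_add[OF iY sr(1) s'Y])
      ultimately have "(s \<oplus> s' \<otimes> x i) \<in> Q \<cdot> E (n - 1)" using IH by blast
      then show "e \<in> Q \<cdot> E (n - 1)" unfolding e_eq by (rule ideal_add[OF iQE _ e'Q])
    qed
  qed
  have step: "E n \<subseteq> Q \<cdot> E (n - 1)" if "n > c" for n
  proof -
    have "E n \<subseteq> Idl (?M ` exps k n)"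
      using ideal_power_Idl[of k x n, OF x] unfolding E_def Q by blast
    moreover have "E n \<inter> Idl (?M ` exps k n) \<subseteq> Q \<cdot> E (n - 1)"
      by (rule main[OF that subset_refl]) (auto simp: lower_exps_def exp_deg_exps)
    ultimately show ?thesis by blast
  qed
  have "E (n + c) \<subseteq> ideal_power R Q n \<cdot> E c" for n
  proof (induction n)
    case 0
    then show ?case
      unfolding ideal_power_0 ideal_prod_commute[OF oneideal E] ideal_prod_one[OF E] by simp
  next
    case (Suc n)
    have "E (Suc n + c) \<subseteq> Q \<cdot> E (n + c)" using step[of "Suc n + c"] by simp
    also have "\<dots> \<subseteq> Q \<cdot> (ideal_power R Q n \<cdot> E c)"
      by (rule ideal_prod_mono[OF iQ ideal_prod_is_ideal[OF ideal_ideal_power[OF iQ] E] subset_refl Suc])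
    also have "\<dots> = ideal_power R Q (Suc n) \<cdot> E c"
      unfolding ideal_power_Suc ideal_prod_commute[OF ideal_ideal_power[OF iQ] iQ]
      by (rule ideal_prod_assoc[OF iQ ideal_ideal_power[OF iQ] E, symmetric])
    finally show ?case .
  qed
  moreover have "ideal_power R Q n \<cdot> E c \<subseteq> ideal_power R Q n \<cdot> D" for n
    by (rule ideal_prod_mono[OF ideal_ideal_power[OF iQ] D subset_refl]) (simp add: E_def)
  ultimately show ?thesis unfolding E_def by blast
qed

end

section \<open>Growth of colengths and the Krull dimension\<close>

lemma card_exps_poly: "real (card (exps (Suc k) n)) = poly (pcompose (mchoose_poly k) [:1, 1:]) (real n)"
proof -
  have "card (exps (Suc k) n) = mchoose k (Suc n)" by (simp add: card_exps mchoose_def)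
  also have "real \<dots> = poly (mchoose_poly k) (real (Suc n))" by (simp only: poly_mchoose_poly)
  finally show ?thesis by (simp add: poly_pcompose)
qed

lemma tendsto_card_exps:
  "(\<lambda>n. real (card (exps (Suc k) n)) / real n ^ k) \<longlonglongrightarrow> 1 / fact k"
proof -
  let ?p = "pcompose (mchoose_poly k) [:1, 1:]"
  have d: "degree ?p = k" by (simp add: degree_pcompose degree_mchoose_poly)
  have "lead_coeff ?p = lead_coeff (mchoose_poly k)" by (subst lead_coeff_comp) simp_all
  then have "Polynomial.coeff ?p k = 1 / fact k" by (simp add: d degree_mchoose_poly coeff_mchoose_poly_top)
  then show ?thesis using tendsto_poly_div_power[of ?p k] d by (simp add: card_exps_poly)
qed

lemma tendsto_card_exps_0:
  assumes "k < d" shows "(\<lambda>n. real (card (exps (Suc k) n)) / real n ^ d) \<longlonglongrightarrow> 0"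
proof -
  let ?p = "pcompose (mchoose_poly k) [:1, 1:]"
  have d: "degree ?p = k" by (simp add: degree_pcompose degree_mchoose_poly)
  then have "Polynomial.coeff ?p d = 0" using assms by (simp add: coeff_eq_0)
  then show ?thesis using tendsto_poly_div_power[of ?p d] d assms by (simp add: card_exps_poly)
qed

lemma finite_enum: "finite S \<Longrightarrow> \<exists>x::nat \<Rightarrow> 'a. x ` {..<card S} = S"
  using ex_bij_betw_nat_finite[of S] by (auto simp: bij_betw_def atLeast0LessThan)

context noetherian_local_ring
begin

lemma ideal_Idl_Un: "ideal A R \<Longrightarrow> ideal B R \<Longrightarrow> ideal (Idl (A \<union> B)) R"
  by (rule genideal_ideal) (simp add: ideal_subset_carrier)

lemma finite_colength_power_Un:
  assumes "m_primary Q" "ideal P R" shows "finite_colength R (Idl (ideal_power R Q n \<union> P))"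
proof (rule finite_colength_mono(1)[OF m_primary_finite_colength[OF m_primary_power[OF assms(1), of n]]])
  have i: "ideal (ideal_power R Q n) R" by (rule ideal_ideal_power[OF m_primary_ideal[OF assms(1)]])
  show "ideal (Idl (ideal_power R Q n \<union> P)) R" by (rule ideal_Idl_Un[OF i assms(2)])
  show "ideal_power R Q n \<subseteq> Idl (ideal_power R Q n \<union> P)"
    by (rule subset_Idl) (simp_all add: ideal_subset_carrier i assms(2))
qed

text \<open>By the Artin-Rees lemma, \<open>(Q\<^sup>n\<^sup>+\<^sup>c + P : u)\<close> is contained in \<open>Q\<^sup>n + P\<close>.\<close>

lemma colength_growth_step:
  assumes Q: "m_primary Q" and P: "primeideal P R" and u: "u \<in> carrier R" "u \<notin> P"
  shows "\<exists>c. \<forall>n. colength R (Idl (ideal_power R Q n \<union> P)) +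
    colength R (Idl (insert u (Idl (ideal_power R Q (n + c) \<union> P))))
    \<le> colength R (Idl (ideal_power R Q (n + c) \<union> P))"
proof -
  have iQ: "ideal Q R" by (rule m_primary_ideal[OF Q])
  have iP: "ideal P R" by (rule primeideal.axioms(1)[OF P])
  have Pc: "P \<subseteq> carrier R" by (rule ideal_subset_carrier[OF iP])
  obtain S where S: "S \<subseteq> carrier R" "finite S" "Q = Idl S" using fin_gen[OF iQ] by blast
  obtain x where x: "x ` {..<card S} = S" using finite_enum[OF S(2)] by blast
  let ?D = "Idl (insert u P)"
  have uP: "insert u P \<subseteq> carrier R" using u Pc by simp
  have iD: "ideal ?D R" by (rule genideal_ideal[OF uP])
  have xc: "x i \<in> carrier R" if "i < card S" for i using x S(1) that by blast
  have Qx: "Q = Idl (x ` {..<card S})" by (simp only: x S(3))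
  obtain c where c: "\<And>n. ideal_power R Q (n + c) \<inter> ?D \<subseteq> ideal_power R Q n \<cdot> ?D"
    using Artin_Rees[of "card S" x ?D Q, OF xc iD Qx] by blast
  show ?thesis
  proof (intro exI[of _ c] allI)
    fix n
    let ?A = "Idl (ideal_power R Q (n + c) \<union> P)" and ?B = "Idl (ideal_power R Q n \<union> P)"
    have ip: "ideal (ideal_power R Q m) R" for m by (rule ideal_ideal_power[OF iQ])
    have pc: "ideal_power R Q m \<subseteq> carrier R" for m by (rule ideal_subset_carrier[OF ip])
    have fA: "finite_colength R ?A" by (rule finite_colength_power_Un[OF Q iP])
    have iA: "ideal ?A R" and iB: "ideal ?B R" by (rule ideal_Idl_Un[OF ip iP])+
    have sB: "ideal_power R Q n \<union> P \<subseteq> ?B" by (rule subset_Idl) (simp_all add: pc Pc)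
    have "colon R ?A u \<subseteq> ?B"
    proof
      fix r assume "r \<in> colon R ?A u"
      then have r: "r \<in> carrier R" "r \<otimes> u \<in> ?A" by (simp_all add: colon_def)
      obtain y p where yp: "y \<in> ideal_power R Q (n + c)" "p \<in> P" "r \<otimes> u = y \<oplus> p"
      proof -
        obtain y s where "y \<in> ideal_power R Q (n + c)" "s \<in> Idl P" "r \<otimes> u = y \<oplus> s"
          using Idl_Un_form[OF ip Pc r(2)] by blast
        then show ?thesis using that Idl_of_ideal[OF iP] by simp
      qed
      have cc: "y \<in> carrier R" "p \<in> carrier R" "r \<otimes> u \<in> carrier R"
        using ideal_carr[OF ip yp(1)] ideal_carr[OF iP yp(2)] r u by simp_all
      have "y = r \<otimes> u \<ominus> p" using yp(3) cc by (simp add: minus_eq a_assoc r_neg)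
      moreover have "r \<otimes> u \<in> ?D" "p \<in> ?D"
        using ideal_mult[OF iD, of u r] genideal_self[OF uP] r(1) yp(2) by auto
      ultimately have "y \<in> ?D" by (simp add: minus_eq ideal_add[OF iD] ideal_neg[OF iD])
      \<comment> \<open>\<open>y\<close> lies in Q^(n+c) and in P + (u), so Artin-Rees places it in
        Q^n (P + (u)), whose elements have the form p' + bu with p' in P and b in Q^n.\<close>
      then have y: "y \<in> ideal_power R Q n \<cdot> ?D" using c yp(1) by blast
      let ?E = "{a \<oplus> e \<otimes> u | a e. a \<in> P \<and> e \<in> ideal_power R Q n}"
      have "ideal_power R Q n \<cdot> ?D \<subseteq> ?E"
      proof (rule ideal_prod_subsetI[OF ideal_insert_form[OF iP ip u(1)]])
        fix q w assume q: "q \<in> ideal_power R Q n" and "w \<in> ?D"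
        then obtain a e where ae: "a \<in> P" "e \<in> carrier R" "w = a \<oplus> e \<otimes> u"
          unfolding Idl_insert[OF iP u(1)] by blast
        have qc: "q \<in> carrier R" "a \<in> carrier R" using ideal_carr[OF ip q] ideal_carr[OF iP ae(1)] by simp_all
        have "q \<otimes> w = q \<otimes> a \<oplus> (q \<otimes> e) \<otimes> u" using ae qc u(1) by (simp add: r_distr m_assoc)
        moreover have "q \<otimes> a \<in> P" by (rule ideal_mult[OF iP ae(1) qc(1)])
        moreover have "q \<otimes> e \<in> ideal_power R Q n" by (rule ideal_mult_right[OF ip q ae(2)])
        ultimately show "q \<otimes> w \<in> ?E" by blast
      qed
      then obtain p' b where pb: "p' \<in> P" "b \<in> ideal_power R Q n" "y = p' \<oplus> b \<otimes> u" using y by blast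
      have bc: "b \<in> carrier R" "p' \<in> carrier R" using ideal_carr[OF ip pb(2)] ideal_carr[OF iP pb(1)] by simp_all
      \<comment> \<open>Comparing the two expressions for \<open>y\<close> modulo \<open>P\<close>
        leaves a multiple of \<open>u\<close> in the prime \<open>P\<close>; as \<open>u\<close> is
        outside \<open>P\<close>, the element \<open>r\<close> differs from \<open>b\<close> by an
        element of \<open>P\<close>.\<close>
      have "(r \<ominus> b) \<otimes> u = r \<otimes> u \<ominus> b \<otimes> u" using r bc u by (simp add: minus_eq l_distr l_minus)
      also have "\<dots> = (p' \<oplus> p \<oplus> b \<otimes> u) \<ominus> b \<otimes> u"
        using yp(3) pb(3) bc cc u by (simp add: a_assoc a_comm[of p "b \<otimes> u"])
      also have "\<dots> = p' \<oplus> p" using bc cc u by (simp add: minus_eq a_assoc r_neg)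
      finally have "(r \<ominus> b) \<otimes> u \<in> P" using ideal_add[OF iP pb(1) yp(2)] by simp
      moreover have rb: "r \<ominus> b \<in> carrier R" using r bc by simp
      ultimately have "r \<ominus> b \<in> P" using primeideal.I_prime[OF P rb u(1)] u(2) by blast
      then have "(r \<ominus> b) \<oplus> b \<in> ?B" using sB pb(2) by (intro ideal_add[OF iB]) blast+
      then show "r \<in> ?B" using r bc by (simp add: minus_add_cancel_carr)
    qed
    then have "colength R ?B \<le> colength R (colon R ?A u)"
      using finite_colength_insert_iff[OF iA u(1)] fA by (intro finite_colength_mono(2)[OF _ iB]) blast+
    then show "colength R ?B + colength R (Idl (insert u ?A)) \<le> colength R ?A"
      using colength_insert[OF fA u(1)] by simp
  qed
qed

lemma prime_subset_m: "primeideal P R \<Longrightarrow> P \<subseteq> \<mm>"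
  using proper_subset_m[of P] primeideal.I_notcarr[of P] primeideal.axioms(1)[of P] by blast

text \<open>For \<open>u\<close> in \<open>C 1\<close> but not in \<open>C 0\<close>, adjoining
  \<open>u\<close> to Q^n + C_0 stays inside Q^n + C_1. Hence \<open>colength_growth_step\<close>
  bounds the increments for \<open>C 0\<close> from below by the function of the shorter chain.
  Summing raises the order of growth by one per prime, and Pascal's rule gives the binomial.\<close>

lemma prime_chain_growth:
  assumes Q: "m_primary Q" "Q \<subseteq> \<mm>" and C: "set_chain {P. primeideal P R} r C"
  shows "\<exists>c\<ge>1. \<forall>q. q choose r \<le> colength R (Idl (ideal_power R Q (c * (q + 1)) \<union> C 0))"
  using C
proof (induction r arbitrary: C)
  case 0
  have P: "primeideal (C 0) R" using 0 by (simp add: set_chain_def)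
  have iP: "ideal (C 0) R" by (rule primeideal.axioms(1)[OF P])
  have iQ: "ideal Q R" by (rule m_primary_ideal[OF Q(1)])
  have "1 \<le> colength R (Idl (ideal_power R Q (q + 1) \<union> C 0))" for q
  proof -
    have "ideal_power R Q (q + 1) \<subseteq> \<mm>"
      using ideal_power_antimono[OF iQ, of 1 "q + 1"] ideal_power_1[OF iQ] Q(2) by simp
    then have "Idl (ideal_power R Q (q + 1) \<union> C 0) \<subseteq> \<mm>"
      using prime_subset_m[OF P] by (intro genideal_minimal[OF ideal_m]) simp
    then have "colength R \<mm> \<le> colength R (Idl (ideal_power R Q (q + 1) \<union> C 0))"
      by (rule finite_colength_mono(2)[OF finite_colength_power_Un[OF Q(1) iP] ideal_m])
    then show ?thesis by (simp add: colength_m)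
  qed
  then show ?case by (intro exI[of _ 1]) simp
next
  case (Suc r)
  have P: "primeideal (C i) R" if "i \<le> Suc r" for i using Suc.prems that by (simp add: set_chain_def)
  have P0: "primeideal (C 0) R" and P1: "primeideal (C 1) R" using P by simp_all
  have sub: "C 0 \<subset> C 1" using Suc.prems by (simp add: set_chain_def)
  have iP: "ideal (C 0) R" "ideal (C 1) R" by (rule primeideal.axioms(1)[OF P0] primeideal.axioms(1)[OF P1])+
  have iQ: "ideal Q R" by (rule m_primary_ideal[OF Q(1)])
  define H where "H n = colength R (Idl (ideal_power R Q n \<union> C 0))" for n
  define H1 where "H1 n = colength R (Idl (ideal_power R Q n \<union> C 1))" for n
  have pc: "ideal_power R Q n \<subseteq> carrier R" for n by (rule ideal_subset_carrier[OF ideal_ideal_power[OF iQ]])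
  have mono: "colength R (Idl (ideal_power R Q m \<union> P)) \<le> colength R (Idl (ideal_power R Q n \<union> P))"
    if "m \<le> n" "ideal P R" for m n P
  proof (rule finite_colength_mono(2)[OF finite_colength_power_Un[OF Q(1) that(2)]])
    show "ideal (Idl (ideal_power R Q m \<union> P)) R" by (rule ideal_Idl_Un[OF ideal_ideal_power[OF iQ] that(2)])
    show "Idl (ideal_power R Q n \<union> P) \<subseteq> Idl (ideal_power R Q m \<union> P)"
      using ideal_power_antimono[OF iQ that(1)] by (intro Idl_mono) (auto simp: pc[THEN subsetD] dest: ideal_carr[OF that(2)])
  qed
  obtain u where u: "u \<in> C 1" "u \<notin> C 0" using sub by blast
  have uc: "u \<in> carrier R" by (rule ideal_carr[OF iP(2) u(1)])
  have "set_chain {P. primeideal P R} r (\<lambda>i. C (Suc i))" using Suc.prems by (simp add: set_chain_def)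
  from Suc.IH[OF this] obtain c1 where c1: "c1 \<ge> 1" "\<And>q. q choose r \<le> H1 (c1 * (q + 1))"
    by (auto simp: H1_def)
  obtain c2 where c2: "\<And>n. H n + colength R (Idl (insert u (Idl (ideal_power R Q (n + c2) \<union> C 0)))) \<le> H (n + c2)"
    using colength_growth_step[OF Q(1) P0 uc u(2)] unfolding H_def by blast
  have step: "H n + H1 (n + c2) \<le> H (n + c2)" for n
  proof -
    let ?A = "Idl (ideal_power R Q (n + c2) \<union> C 0)" and ?B = "Idl (ideal_power R Q (n + c2) \<union> C 1)"
    have iA: "ideal ?A R" and iB: "ideal ?B R"
      by (rule ideal_Idl_Un[OF ideal_ideal_power[OF iQ] iP(1)] ideal_Idl_Un[OF ideal_ideal_power[OF iQ] iP(2)])+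
    have Bc: "ideal_power R Q (n + c2) \<union> C 1 \<subseteq> carrier R" using pc ideal_subset_carrier[OF iP(2)] by simp
    have AB: "?A \<subseteq> ?B" using sub by (intro Idl_mono[OF Bc]) blast
    have "u \<in> ?B" using genideal_self[OF Bc] u(1) by blast
    then have "Idl (insert u ?A) \<subseteq> ?B" using AB by (intro genideal_minimal[OF iB]) simp
    moreover have "finite_colength R (Idl (insert u ?A))"
      using finite_colength_insert_iff[OF iA uc] finite_colength_power_Un[OF Q(1) iP(1)] by blast
    ultimately have "H1 (n + c2) \<le> colength R (Idl (insert u ?A))"
      unfolding H1_def using finite_colength_mono(2)[OF _ iB] by blast
    then show ?thesis using c2[of n] by simp
  qed
  \<comment> \<open>The step width has to reach \<open>c1\<close> for the hypothesis on the shorter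
    chain and \<open>c2\<close> for one growth step.\<close>
  define c where "c = max c1 c2"
  have "q choose Suc r \<le> H (c * (q + 1))" for q
  proof (induction q)
    case (Suc q)
    \<comment> \<open>The surplus \<open>c - c2\<close> is moved to the starting point, so that a
      growth step of width \<open>c2\<close> ends exactly at the next multiple of
      \<open>c\<close>.\<close>
    have eq: "c * (Suc q + 1) = (c * (q + 1) + (c - c2)) + c2" by (simp add: c_def)
    have "q choose Suc r \<le> H (c * (q + 1) + (c - c2))"
      using Suc mono[OF _ iP(1), of "c * (q + 1)" "c * (q + 1) + (c - c2)"] by (simp add: H_def)
    moreover have "q choose r \<le> H1 (c * (Suc q + 1))"
    proof -
      have "q choose r \<le> H1 (c1 * (q + 1))" by (rule c1)
      also have "\<dots> \<le> H1 (c * (Suc q + 1))"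
        unfolding H1_def by (rule mono[OF _ iP(2)]) (intro mult_mono, simp_all add: c_def)
      finally show ?thesis .
    qed
    ultimately show ?case using step[of "c * (q + 1) + (c - c2)"] unfolding eq by simp
  qed simp
  moreover have "c \<ge> 1" using c1 by (simp add: c_def)
  ultimately show ?case unfolding H_def by blast
qed

theorem colength_power_lower_bound:
  assumes Q: "m_primary Q" "Q \<subseteq> \<mm>" and d: "krull_dim R = enat d"
  shows "\<exists>c\<ge>1. \<forall>q. q choose d \<le> colength R (ideal_power R Q (c * (q + 1)))"
proof -
  have "\<mm> \<in> {P. primeideal P R}" using maximalideal_prime[OF is_maximalideal] by simp
  then obtain C where C: "set_chain {P. primeideal P R} d C"
    using height_attained[of "{P. primeideal P R}" d] d unfolding krull_dim_height by blast
  obtain c where c: "c \<ge> 1" "\<And>q. q choose d \<le> colength R (Idl (ideal_power R Q (c * (q + 1)) \<union> C 0))"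
    using prime_chain_growth[OF Q C] by blast
  have iP: "ideal (C 0) R" using C primeideal.axioms(1) unfolding set_chain_def by blast
  have iQ: "ideal (ideal_power R Q n) R" for n by (rule ideal_ideal_power[OF m_primary_ideal[OF Q(1)]])
  have "colength R (Idl (ideal_power R Q n \<union> C 0)) \<le> colength R (ideal_power R Q n)" for n
    by (rule finite_colength_mono(2)[OF m_primary_finite_colength[OF m_primary_power[OF Q(1)]] ideal_Idl_Un[OF iQ iP]],
        rule subset_Idl) (simp_all add: ideal_subset_carrier iQ iP)
  then show ?thesis using c order_trans by blast
qed

lemma colength_power_not_small:
  assumes Q: "m_primary Q" "Q \<subseteq> \<mm>" and d: "krull_dim R = enat d" "d > 0"
  shows "\<not> (\<lambda>n. real (colength R (ideal_power R Q n)) / real n ^ d) \<longlonglongrightarrow> 0"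
proof
  let ?f = "\<lambda>n. real (colength R (ideal_power R Q n)) / real n ^ d"
  assume lim: "?f \<longlonglongrightarrow> 0"
  obtain c where c: "c \<ge> 1" "\<And>q. q choose d \<le> colength R (ideal_power R Q (c * (q + 1)))"
    using colength_power_lower_bound[OF Q d(1)] by blast
  \<comment> \<open>\<open>h q\<close> is \<open>c * (p + 1)\<close> for
    \<open>p = q + d - 1\<close>, and \<open>p choose d\<close> is
    \<open>mchoose d q\<close>.\<close>
  define h where "h q = c * (q + d)" for q
  have mchoose: "mchoose d q \<le> colength R (ideal_power R Q (h q))" for q
    using c(2)[of "q + d - 1"] d(2) by (simp add: mchoose_def h_def)
  have "strict_mono h" using c(1) by (simp add: strict_mono_def h_def)
  from LIMSEQ_subseq_LIMSEQ[OF lim this] have l1: "(\<lambda>q. ?f (h q)) \<longlonglongrightarrow> 0" by (simp add: o_def)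
  have "(\<lambda>q. real c * (1 + real d * inverse (real q))) \<longlonglongrightarrow> real c * (1 + real d * 0)"
    by (intro tendsto_intros lim_inverse_n)
  moreover have "\<forall>\<^sub>F q in sequentially. real c * (1 + real d * inverse (real q)) = real (h q) / real q"
    using eventually_gt_at_top[of 0] by eventually_elim (simp add: h_def field_simps)
  ultimately have "(\<lambda>q. real (h q) / real q) \<longlonglongrightarrow> real c" by (simp add: tendsto_cong)
  then have "(\<lambda>q. (real (h q) / real q) ^ d) \<longlonglongrightarrow> real c ^ d" by (rule tendsto_power)
  from tendsto_mult[OF l1 this] have "(\<lambda>q. ?f (h q) * (real (h q) / real q) ^ d) \<longlonglongrightarrow> 0" by simp
  moreover have "\<forall>\<^sub>F q in sequentially. ?f (h q) * (real (h q) / real q) ^ d = real (colength R (ideal_power R Q (h q))) / real q ^ d"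
    using eventually_gt_at_top[of 0]
  proof eventually_elim
    case (elim q)
    have "h q > 0" using elim c(1) by (simp add: h_def)
    then show ?case by (simp add: power_divide)
  qed
  ultimately have l2: "(\<lambda>q. real (colength R (ideal_power R Q (h q))) / real q ^ d) \<longlonglongrightarrow> 0"
    by (simp add: tendsto_cong)
  have l3: "(\<lambda>q. real (mchoose d q) / real q ^ d) \<longlonglongrightarrow> 1 / fact d"
    using tendsto_poly_div_power[of "mchoose_poly d" d] by (simp add: degree_mchoose_poly poly_mchoose_poly coeff_mchoose_poly_top)
  have "1 / fact d \<le> (0::real)"
    by (rule LIMSEQ_le[OF l3 l2]) (intro exI[of _ 0] allI impI divide_right_mono, simp_all add: mchoose)
  moreover have "0 < 1 / (fact d :: real)" by simp
  ultimately show False by linarith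
qed

section \<open>Upper bounds and polynomial growth for colengths of powers\<close>

lemma colength_prod_power_le:
  fixes x :: "nat \<Rightarrow> 'a"
  assumes x: "\<And>i. i < k \<Longrightarrow> x i \<in> carrier R" and Q: "Q = Idl (x ` {..<k})" "m_primary Q" and B: "m_primary B"
  shows "colength R (B \<cdot> ideal_power R Q n) \<le> colength R (ideal_power R Q n) + card (exps k n) * colength R B"
proof -
  have iQ: "ideal (ideal_power R Q n) R" by (rule ideal_ideal_power[OF m_primary_ideal[OF Q(2)]])
  have iB: "ideal B R" by (rule m_primary_ideal[OF B])
  let ?S = "monomial R x k ` exps k n" and ?A = "B \<cdot> ideal_power R Q n"
  have iA: "ideal ?A R" by (rule ideal_prod_is_ideal[OF iB iQ])
  have S: "?S \<subseteq> carrier R" using monomial_closed[of k x, OF x] by blast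
  have eq: "ideal_power R Q n = Idl ?S" unfolding Q(1) by (rule ideal_power_Idl[OF x])
  have SQ: "?S \<subseteq> ideal_power R Q n" unfolding eq by (rule genideal_self[OF S])
  have "Idl (?A \<union> ?S) = ideal_power R Q n"
    by (rule Idl_Un_generators[OF iA ideal_prod_subset2[OF iB iQ] S eq])
  moreover have "finite_colength R (ideal_power R Q n)"
    by (rule m_primary_finite_colength[OF m_primary_power[OF Q(2)]])
  moreover have "B \<subseteq> colon R ?A s" if s: "s \<in> ?S" for s
  proof
    fix b assume b: "b \<in> B"
    have "b \<otimes> s \<in> ?A" using s SQ by (intro ideal_prod.prod[OF b]) blast
    then show "b \<in> colon R ?A s" using ideal_carr[OF iB b] by (simp add: colon_def)
  qed
  ultimately have "colength R ?A \<le> colength R (ideal_power R Q n) + card ?S * colength R B"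
    using finite_colength_Idl_Un[of ?S ?A B, OF _ iA S _ m_primary_finite_colength[OF B]] finite_exps by simp
  also have "\<dots> \<le> colength R (ideal_power R Q n) + card (exps k n) * colength R B"
    by (intro add_left_mono mult_right_mono card_image_le finite_exps) simp
  finally show ?thesis .
qed

text \<open>Q^n/Q^(n+1) is spanned over R/Q by the monomials of degree n, and the numbers of these
  add up to at most a count in one more variable. So \<open>k\<close> generators limit the growth to
  order \<open>n ^ k\<close>.\<close>

lemma colength_power_upper_bound:
  fixes x :: "nat \<Rightarrow> 'a"
  assumes x: "\<And>i. i < k \<Longrightarrow> x i \<in> carrier R" and Q: "Q = Idl (x ` {..<k})" "m_primary Q"
  shows "colength R (ideal_power R Q n) \<le> colength R Q * card (exps (Suc k) n)"
proof -
  have iQ: "ideal Q R" by (rule m_primary_ideal[OF Q(2)])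
  have "colength R (ideal_power R Q n) \<le> (\<Sum>j<n. card (exps k j)) * colength R Q"
  proof (induction n)
    case 0
    then show ?case unfolding ideal_power_0 by (simp add: colength_carrier)
  next
    case (Suc n)
    have "ideal_power R Q (Suc n) = Q \<cdot> ideal_power R Q n"
      unfolding ideal_power_Suc by (rule ideal_prod_commute[OF ideal_ideal_power[OF iQ] iQ])
    then show ?case using colength_prod_power_le[OF x Q Q(2), of n] Suc by (simp add: algebra_simps)
  qed
  also have "\<dots> \<le> card (exps (Suc k) n) * colength R Q"
    by (intro mult_right_mono card_exps_sum) simp
  finally show ?thesis by (simp add: mult.commute)
qed

text \<open>The ideals BQ^n form a homogeneous ideal of the Rees algebra of Q. For B = Q this yields
  the first difference of \<lambda>(R/Q^n), for B = \<open>\<mm>\<close> the Hilbert function of the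
  special fiber.\<close>

lemma ev_int_poly_prod_power:
  fixes x :: "nat \<Rightarrow> 'a"
  assumes x: "\<And>i. i < k \<Longrightarrow> x i \<in> carrier R" and Q: "Q = Idl (x ` {..<k})" "m_primary Q" and B: "m_primary B"
  shows "ev_int_poly k (\<lambda>n. int (colength R (B \<cdot> ideal_power R Q n)) - int (colength R (ideal_power R Q n)))"
proof -
  have iQ: "ideal Q R" by (rule m_primary_ideal[OF Q(2)])
  have ip: "ideal (ideal_power R Q n) R" for n by (rule ideal_ideal_power[OF iQ])
  have iB: "ideal B R" by (rule m_primary_ideal[OF B])
  have X: "x ` {..<k} \<subseteq> carrier R" using x by auto
  have xQ: "x i \<in> Q" if "i < k" for i using genideal_self[OF X] that unfolding Q(1) by blast
  show ?thesis
    unfolding Q(1)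
  proof (rule ev_int_poly_graded_family[of k x "\<lambda>n. B \<cdot> ideal_power R (Idl (x ` {..<k})) n", OF x], unfold Q(1)[symmetric])
    fix n j u y assume u: "u \<in> exps k j" and y: "y \<in> B \<cdot> ideal_power R Q n"
    have "monomial R x k u \<in> ideal_power R Q (\<Sum>i<k. u i)" by (rule monomial_in_power[OF iQ]) (rule xQ)
    then have "monomial R x k u \<in> ideal_power R Q j" using u by (simp add: exps_def)
    then have "y \<otimes> monomial R x k u \<in> (B \<cdot> ideal_power R Q n) \<cdot> ideal_power R Q j"
      by (rule ideal_prod.prod[OF y])
    then show "y \<otimes> monomial R x k u \<in> B \<cdot> ideal_power R Q (n + j)"
      by (simp only: ideal_prod_assoc[OF iB ip ip] ideal_power_add[OF iQ])
  qed (simp_all add: ideal_prod_subset2[OF iB ip] m_primary_finite_colength[OF m_primary_prod[OF B m_primary_power[OF Q(2)]]])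
qed

lemma ev_int_poly_colength_power:
  fixes x :: "nat \<Rightarrow> 'a"
  assumes x: "\<And>i. i < k \<Longrightarrow> x i \<in> carrier R" and Q: "Q = Idl (x ` {..<k})" "m_primary Q"
  shows "ev_int_poly (Suc k) (\<lambda>n. int (colength R (ideal_power R Q n)))"
proof (rule ev_int_poly_antidifference)
  have iQ: "ideal Q R" by (rule m_primary_ideal[OF Q(2)])
  have "ideal_power R Q (Suc n) = Q \<cdot> ideal_power R Q n" for n
    unfolding ideal_power_Suc by (rule ideal_prod_commute[OF ideal_ideal_power[OF iQ] iQ])
  then show "ev_int_poly k (\<lambda>n. int (colength R (ideal_power R Q (Suc n))) - int (colength R (ideal_power R Q n)))"
    using ev_int_poly_prod_power[OF x Q Q(2)] by simp
qed

text \<open>Otherwise fewer than \<open>d\<close> elements would already generate an \<open>\<mm>\<close>-primary ideal.\<close>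

lemma reduction_generators_independent:
  assumes I: "m_primary I" "I \<subseteq> \<mm>" and d: "krull_dim R = enat d" "d > 0"
    and S: "finite S" "S \<subseteq> carrier R" and J: "J = Idl S" "J \<subseteq> I"
    and red: "ideal_power R I (r + 1) = J \<cdot> ideal_power R I r"
  shows "colength R (\<mm> \<cdot> I) \<ge> d + colength R (Idl (\<mm> \<cdot> I \<union> S))"
proof -
  have iI: "ideal I R" by (rule m_primary_ideal[OF I(1)])
  have ip: "ideal (ideal_power R I n) R" for n by (rule ideal_ideal_power[OF iI])
  let ?A = "\<mm> \<cdot> I"
  have mA: "m_primary ?A" by (rule m_primary_prod[OF m_primary_m I(1)])
  have iA: "ideal ?A R" by (rule m_primary_ideal[OF mA])
  have SJ: "S \<subseteq> J" unfolding J(1) by (rule genideal_self[OF S(2)])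
  have mcol: "\<mm> \<subseteq> colon R ?A s" if "s \<in> S" for s
    using subset_colon_m[OF iI] SJ J(2) that by blast
  obtain xs where xs: "set xs \<subseteq> S" "Idl (?A \<union> set xs) = Idl (?A \<union> S)"
    "colength R ?A = length xs + colength R (Idl (?A \<union> S))"
    using independent_generators[OF S(1) m_primary_finite_colength[OF mA] S(2) mcol] by blast
  show ?thesis
  proof (rule ccontr)
    assume "\<not> ?thesis"
    then have "length xs < d" using xs(3) by simp
    then have k: "card (set xs) < d" using card_length[of xs] by simp
    let ?J = "Idl (set xs)"
    have xsc: "set xs \<subseteq> carrier R" using xs S by blast
    have iJ': "ideal ?J R" by (rule genideal_ideal[OF xsc])
    have iP: "ideal (\<mm> \<cdot> ideal_power R I (r + 1)) R" by (rule ideal_prod_is_ideal[OF ideal_m ip])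
    let ?C = "Idl (?J \<union> (\<mm> \<cdot> ideal_power R I (r + 1)))"
    have Cc: "?J \<union> (\<mm> \<cdot> ideal_power R I (r + 1)) \<subseteq> carrier R"
      using ideal_subset_carrier[OF iJ'] ideal_subset_carrier[OF iP] by simp
    have iC: "ideal ?C R" by (rule genideal_ideal[OF Cc])
    have sC: "?J \<union> (\<mm> \<cdot> ideal_power R I (r + 1)) \<subseteq> ?C" by (rule genideal_self[OF Cc])
    \<comment> \<open>Modulo \<open>\<mm>\<close>I the ideal J is generated by \<open>xs\<close>, so
      I^(r+1) = JI^r lies in (xs) + \<open>\<mm>\<close>I^(r+1). Nakayama then places I^(r+1) in
      (xs), which is therefore \<open>\<mm>\<close>-primary.\<close>
    have "J \<cdot> ideal_power R I r \<subseteq> ?C"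
    proof (rule ideal_prod_subsetI[OF iC])
      fix s b assume s: "s \<in> J" and b: "b \<in> ideal_power R I r"
      have bc: "b \<in> carrier R" by (rule ideal_carr[OF ip b])
      have "Idl (?A \<union> set xs) \<subseteq> colon R ?C b"
      proof (rule genideal_minimal[OF ideal_colon[OF iC bc]], rule Un_least)
        show "?A \<subseteq> colon R ?C b"
        proof
          fix y assume y: "y \<in> ?A"
          have "y \<otimes> b \<in> (\<mm> \<cdot> I) \<cdot> ideal_power R I r" by (rule ideal_prod.prod[OF y b])
          also have "\<dots> = \<mm> \<cdot> ideal_power R I (r + 1)"
            by (simp only: ideal_prod_assoc[OF ideal_m iI ip] Suc_eq_plus1[symmetric] ideal_power_Suc ideal_prod_commute[OF iI ip])
          finally show "y \<in> colon R ?C b" using sC ideal_carr[OF iA y] by (auto simp: colon_def)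
        qed
        show "set xs \<subseteq> colon R ?C b"
        proof
          fix y assume y: "y \<in> set xs"
          have yc: "y \<in> carrier R" and "y \<in> ?J" using y xsc genideal_self[OF xsc] by blast+
          then have "y \<otimes> b \<in> ?J" using ideal_mult_right[OF iJ' _ bc] by simp
          then show "y \<in> colon R ?C b" using sC yc by (auto simp: colon_def)
        qed
      qed
      moreover have "s \<in> Idl (?A \<union> S)"
      proof -
        have "?A \<union> S \<subseteq> carrier R" using ideal_subset_carrier[OF iA] S(2) by simp
        then have "Idl S \<subseteq> Idl (?A \<union> S)" by (rule Idl_mono) simp
        then show ?thesis using s J(1) by blast
      qed
      ultimately show "s \<otimes> b \<in> ?C" unfolding xs(2) by (auto simp: colon_def)
    qed
    then have "ideal_power R I (r + 1) \<subseteq> ?C" by (simp only: red)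
    then have sub: "ideal_power R I (r + 1) \<subseteq> ?J" by (rule nakayama[OF iJ' ip])
    have mJ: "m_primary ?J" by (rule m_primary_mono[OF m_primary_power[OF I(1)] iJ' sub])
    have "?J \<subseteq> Idl S" by (rule Idl_mono[OF S(2) xs(1)])
    then have Jm: "?J \<subseteq> \<mm>" using J I(2) by blast
    obtain x where x: "x ` {..<card (set xs)} = set xs" using finite_enum[of "set xs"] by auto
    have xc: "x i \<in> carrier R" if "i < card (set xs)" for i using x xsc that by blast
    have ub: "colength R (ideal_power R ?J n) \<le> colength R ?J * card (exps (Suc (card (set xs))) n)" for n
      by (rule colength_power_upper_bound[of "card (set xs)" x]) (simp_all add: xc x mJ)
    have "(\<lambda>n. real (colength R ?J) * (real (card (exps (Suc (card (set xs))) n)) / real n ^ d)) \<longlonglongrightarrow> real (colength R ?J) * 0"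
      by (intro tendsto_mult tendsto_const tendsto_card_exps_0 k)
    then have l: "(\<lambda>n. real (colength R ?J) * (real (card (exps (Suc (card (set xs))) n)) / real n ^ d)) \<longlonglongrightarrow> 0" by simp
    \<comment> \<open>With fewer than \<open>d\<close> generators the colengths of the powers grow
      with order below \<open>n ^ d\<close>, which a chain of \<open>d + 1\<close> primes
      forbids.\<close>
    have "(\<lambda>n. real (colength R (ideal_power R ?J n)) / real n ^ d) \<longlonglongrightarrow> 0"
    proof (rule tendsto_sandwich[OF _ _ tendsto_const l])
      show "\<forall>\<^sub>F n in sequentially. real (colength R (ideal_power R ?J n)) / real n ^ d
          \<le> real (colength R ?J) * (real (card (exps (Suc (card (set xs))) n)) / real n ^ d)"
      proof (rule always_eventually, rule allI)
        fix n
        have "real (colength R (ideal_power R ?J n)) \<le> real (colength R ?J) * real (card (exps (Suc (card (set xs))) n))"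
          using ub[of n] by (metis of_nat_le_iff of_nat_mult)
        then show "real (colength R (ideal_power R ?J n)) / real n ^ d
          \<le> real (colength R ?J) * (real (card (exps (Suc (card (set xs))) n)) / real n ^ d)"
          by (simp add: divide_right_mono)
      qed
    qed simp
    then show False using colength_power_not_small[OF mJ Jm d] by blast
  qed
qed

end

section \<open>Graded components of the special fiber\<close>

context noetherian_local_ring
begin

text \<open>\<open>\<phi>\<close> identifies M/\<open>\<mm>\<close>M with its image, semilinearly
  along \<open>\<psi>\<close>. A basis supplied by \<open>independent_generators\<close> is adjoined
  one vector at a time, which mirrors the inductive definition of dimension by line
  extensions.\<close>

lemma dimension_mod_m:
  fixes F :: "('f, 'g) ring_scheme"
  assumes F: "ring F" and M: "m_primary M"
    and psi: "\<And>r. r \<in> carrier R \<Longrightarrow> \<psi> r \<in> carrier F"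
    and phi: "\<And>a. a \<in> M \<Longrightarrow> \<phi> a \<in> carrier F"
    and add: "\<And>a b. a \<in> M \<Longrightarrow> b \<in> M \<Longrightarrow> \<phi> (a \<oplus> b) = \<phi> a \<oplus>\<^bsub>F\<^esub> \<phi> b"
    and mult: "\<And>r a. r \<in> carrier R \<Longrightarrow> a \<in> M \<Longrightarrow> \<phi> (r \<otimes> a) = \<psi> r \<otimes>\<^bsub>F\<^esub> \<phi> a"
    and zero: "\<And>a. a \<in> M \<Longrightarrow> \<phi> a = \<zero>\<^bsub>F\<^esub> \<longleftrightarrow> a \<in> \<mm> \<cdot> M"
  shows "ring.dimension F (colength R (\<mm> \<cdot> M) - colength R M) (\<psi> ` carrier R) (\<phi> ` M)"
proof -
  interpret F: ring F by fact
  let ?A = "\<mm> \<cdot> M"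
  have mA: "m_primary ?A" by (rule m_primary_prod[OF m_primary_m M])
  have iA: "ideal ?A R" by (rule m_primary_ideal[OF mA])
  have iM: "ideal M R" by (rule m_primary_ideal[OF M])
  have AM: "?A \<subseteq> M" by (rule ideal_prod_subset2[OF ideal_m iM])
  have Ac: "?A \<subseteq> carrier R" by (rule ideal_subset_carrier[OF iA])
  obtain S where S: "S \<subseteq> carrier R" "finite S" "M = Idl S" using fin_gen[OF iM] by blast
  have SM: "S \<subseteq> M" unfolding S(3) by (rule genideal_self[OF S(1)])
  have IAS: "Idl (?A \<union> S) = M" by (rule Idl_Un_generators[OF iA AM S(1,3)])
  have "\<mm> \<subseteq> colon R ?A s" if "s \<in> S" for s
    using subset_colon_m[OF iM] SM that by blast
  then obtain xs where xs: "set xs \<subseteq> S" "Idl (?A \<union> set xs) = Idl (?A \<union> S)"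
    "\<And>i. i < length xs \<Longrightarrow> xs ! i \<notin> Idl (?A \<union> set (take i xs))"
    "colength R ?A = length xs + colength R (Idl (?A \<union> S))"
    using independent_generators[OF S(2) m_primary_finite_colength[OF mA] S(1)] by blast
  have "F.dimension i (\<psi> ` carrier R) (\<phi> ` (Idl (?A \<union> set (take i xs))))" if "i \<le> length xs" for i
    using that
  proof (induction i)
    case 0
    have z: "\<phi> a = \<zero>\<^bsub>F\<^esub>" if "a \<in> ?A" for a
      using zero[of a] AM that by blast
    have "\<phi> ` ?A = {\<zero>\<^bsub>F\<^esub>}"
    proof
      show "\<phi> ` ?A \<subseteq> {\<zero>\<^bsub>F\<^esub>}" by (rule image_subsetI) (simp add: z)
      show "{\<zero>\<^bsub>F\<^esub>} \<subseteq> \<phi> ` ?A" using z[OF ideal_zero[OF iA]] ideal_zero[OF iA] by (metis empty_subsetI imageI insert_subset)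
    qed
    then show ?case using Idl_of_ideal[OF iA] by simp
  next
    case (Suc i)
    let ?B = "Idl (?A \<union> set (take i xs))" and ?x = "xs ! i"
    have xS: "?x \<in> S" using Suc.prems xs(1) by (auto intro: nth_mem)
    have xc: "?x \<in> carrier R" and xM: "?x \<in> M" using xS S(1) SM by blast+
    have tS: "set (take i xs) \<subseteq> S" using set_take_subset[of i xs] xs(1) by blast
    have Bc: "?A \<union> set (take i xs) \<subseteq> carrier R" using Ac tS S(1) by blast
    have iB: "ideal ?B R" by (rule genideal_ideal[OF Bc])
    have BM: "?B \<subseteq> M" using AM tS SM by (intro genideal_minimal[OF iM]) blast
    have AB: "?A \<subseteq> ?B" by (rule subset_Idl[OF Bc]) simp
    have eq: "Idl (?A \<union> set (take (Suc i) xs)) = Idl (insert ?x ?B)"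
      using Suc.prems Idl_insert_Un[OF Bc xc] by (simp add: take_Suc_conv_app_nth Un_commute)
    \<comment> \<open>\<open>\<phi>\<close> is injective only modulo \<open>\<mm>\<close>M, but this
      ideal lies in \<open>?B\<close>, so equal images would force \<open>?x\<close> into
      \<open>?B\<close>.\<close>
    have notin: "\<phi> ?x \<notin> \<phi> ` ?B"
    proof
      assume "\<phi> ?x \<in> \<phi> ` ?B"
      then obtain b where b: "b \<in> ?B" "\<phi> ?x = \<phi> b" by blast
      have bM: "b \<in> M" using b BM by blast
      have bc: "b \<in> carrier R" by (rule ideal_carr[OF iB b(1)])
      have dM: "?x \<ominus> b \<in> M" unfolding minus_eq by (rule ideal_add[OF iM xM ideal_neg[OF iM bM]])
      have "\<phi> (?x \<ominus> b) \<oplus>\<^bsub>F\<^esub> \<phi> b = \<phi> ((?x \<ominus> b) \<oplus> b)" using add[OF dM bM] by simp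
      also have "\<dots> = \<zero>\<^bsub>F\<^esub> \<oplus>\<^bsub>F\<^esub> \<phi> b" using minus_add_cancel_carr[OF xc bc] b phi[OF bM] by simp
      finally have "\<phi> (?x \<ominus> b) = \<zero>\<^bsub>F\<^esub>" using phi[OF dM] phi[OF bM] by simp
      then have "?x \<ominus> b \<in> ?B" using zero[OF dM] AB by blast
      then have "(?x \<ominus> b) \<oplus> b \<in> ?B" using b(1) by (rule ideal_add[OF iB])
      then show False using xs(3)[of i] Suc.prems minus_add_cancel_carr[OF xc bc] by simp
    qed
    have "F.line_extension (\<psi> ` carrier R) (\<phi> ?x) (\<phi> ` ?B) = \<phi> ` (Idl (insert ?x ?B))"
    proof (rule subset_antisym; rule subsetI)
      fix y assume "y \<in> F.line_extension (\<psi> ` carrier R) (\<phi> ?x) (\<phi> ` ?B)"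
      then obtain r b where rb: "r \<in> carrier R" "b \<in> ?B" "y = \<psi> r \<otimes>\<^bsub>F\<^esub> \<phi> ?x \<oplus>\<^bsub>F\<^esub> \<phi> b"
        unfolding F.line_extension_def set_add_def' r_coset_def by blast
      have bM: "b \<in> M" using rb BM by blast
      have rxM: "r \<otimes> ?x \<in> M" by (rule ideal_mult[OF iM xM rb(1)])
      have "y = \<phi> (r \<otimes> ?x \<oplus> b)" using rb add[OF rxM bM] mult[OF rb(1) xM] by simp
      moreover have "r \<otimes> ?x \<oplus> b = b \<oplus> r \<otimes> ?x" using rb xc ideal_carr[OF iB rb(2)] by (simp add: a_comm)
      ultimately show "y \<in> \<phi> ` (Idl (insert ?x ?B))" unfolding Idl_insert[OF iB xc] using rb by blast
    next
      fix y assume "y \<in> \<phi> ` (Idl (insert ?x ?B))"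
      then obtain b r where rb: "b \<in> ?B" "r \<in> carrier R" "y = \<phi> (b \<oplus> r \<otimes> ?x)"
        unfolding Idl_insert[OF iB xc] by blast
      have bM: "b \<in> M" using rb BM by blast
      have rxM: "r \<otimes> ?x \<in> M" by (rule ideal_mult[OF iM xM rb(2)])
      have "y = \<phi> b \<oplus>\<^bsub>F\<^esub> \<phi> (r \<otimes> ?x)" using rb add[OF bM rxM] by simp
      also have "\<dots> = \<phi> (r \<otimes> ?x) \<oplus>\<^bsub>F\<^esub> \<phi> b" by (rule F.a_comm[OF phi[OF bM] phi[OF rxM]])
      finally have "y = \<psi> r \<otimes>\<^bsub>F\<^esub> \<phi> ?x \<oplus>\<^bsub>F\<^esub> \<phi> b" using mult[OF rb(2) xM] by simp
      then show "y \<in> F.line_extension (\<psi> ` carrier R) (\<phi> ?x) (\<phi> ` ?B)"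
        unfolding F.line_extension_def set_add_def' r_coset_def using rb by blast
    qed
    moreover have "F.dimension i (\<psi> ` carrier R) (\<phi> ` ?B)" using Suc by simp
    ultimately show ?case unfolding eq using F.Suc_dim[OF phi[OF xM] notin] by metis
  qed
  from this[of "length xs"] show ?thesis using xs(2,4) by (simp add: IAS)
qed

lemma finsum_in_ideal:
  assumes A: "ideal A R" and fin: "finite N" and f: "\<And>i. i \<in> N \<Longrightarrow> f i \<in> A"
  shows "(\<Oplus>i\<in>N. f i) \<in> A"
  using fin f
proof (induction N rule: finite_induct)
  case empty
  then show ?case by (simp add: ideal_zero[OF A])
next
  case (insert i N)
  have "f \<in> N \<rightarrow> carrier R" "f i \<in> carrier R" using insert.prems ideal_carr[OF A] by auto
  then show ?case using insert by (simp add: finsum_insert ideal_add[OF A])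
qed

text \<open>In degree n the extension of \<open>\<mm>\<close> is \<open>\<mm>\<close>I^n. One
  inclusion multiplies a constant from \<open>\<mm>\<close> with a form bt^n. For the other, the
  polynomials whose n-th coefficient lies in \<open>\<mm>\<close>I^n for all n already form an ideal
  that contains the generators.\<close>

lemma special_fiber_facts:
  assumes I: "ideal I R"
  defines "B \<equiv> rees_algebra R I" and "K \<equiv> rees_extension R \<mm> I"
  shows "cring B" "ideal K B"
    and "\<And>a n. a \<in> ideal_power R I n \<Longrightarrow> up_ring.monom (UP R) a n \<in> carrier B"
    and "\<And>a n. a \<in> ideal_power R I n \<Longrightarrow> up_ring.monom (UP R) a n \<in> K \<longleftrightarrow> a \<in> \<mm> \<cdot> ideal_power R I n"
proof -
  interpret U: UP_cring R "UP R" by unfold_locales simp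
  let ?P = "UP R"
  let ?c = "up_ring.coeff ?P" and ?m = "up_ring.monom ?P"
  have ip: "ideal (ideal_power R I n) R" for n by (rule ideal_ideal_power[OF I])
  define H where "H = {p \<in> carrier ?P. \<forall>n. ?c p n \<in> ideal_power R I n}"
  have BH: "B = ?P\<lparr>carrier := H\<rparr>" by (simp add: B_def rees_algebra_def H_def)
  have "subring H ?P"
  proof (rule U.P.subringI)
    show "H \<subseteq> carrier ?P" by (auto simp: H_def)
    have "\<one> \<in> ideal_power R I 0" unfolding ideal_power_0 by simp
    then show "\<one>\<^bsub>?P\<^esub> \<in> H" using ideal_zero[OF ip] by (simp add: H_def del: nat_pow_0)
  next
    fix p assume "p \<in> H"
    then show "\<ominus>\<^bsub>?P\<^esub> p \<in> H" using ideal_neg[OF ip] by (simp add: H_def)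
  next
    fix p q assume pq: "p \<in> H" "q \<in> H"
    then show "p \<oplus>\<^bsub>?P\<^esub> q \<in> H" using ideal_add[OF ip] by (simp add: H_def)
    have "(\<Oplus>i\<in>{..n}. ?c p i \<otimes> ?c q (n - i)) \<in> ideal_power R I n" for n
    proof (rule finsum_in_ideal[OF ip])
      fix i assume "i \<in> {..n}"
      then have "ideal_power R I n = ideal_power R I i \<cdot> ideal_power R I (n - i)"
        using ideal_power_add[OF I, of i "n - i"] by simp
      then show "?c p i \<otimes> ?c q (n - i) \<in> ideal_power R I n"
        using pq by (simp add: H_def ideal_prod.prod)
    qed simp
    then show "p \<otimes>\<^bsub>?P\<^esub> q \<in> H" using pq by (simp add: H_def)
  qed
  then have subH: "subcring H ?P" by (rule U.P.subcringI')
  then show cB: "cring B"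
    unfolding BH using U.P.subcring_iff[of H] by (auto simp: H_def)
  then interpret B: cring B .
  have mB: "?m a n \<in> carrier B" if "a \<in> ideal_power R I n" for a n
    using that ideal_carr[OF ip that] ideal_zero[OF ip] by (simp add: BH H_def)
  then show "\<And>a n. a \<in> ideal_power R I n \<Longrightarrow> ?m a n \<in> carrier B" .
  have m0: "?m a 0 \<in> carrier B" if "a \<in> carrier R" for a
  proof -
    have "a \<in> ideal_power R I 0" unfolding ideal_power_0 by (rule that)
    then show ?thesis by (rule mB)
  qed
  have gen: "(\<lambda>a. ?m a 0) ` \<mm> \<subseteq> carrier B" using m0 m_carr by blast
  have K: "K = genideal B ((\<lambda>a. ?m a 0) ` \<mm>)" by (simp add: K_def rees_extension_def B_def)
  show iK: "ideal K B" unfolding K by (rule B.genideal_ideal[OF gen])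
  have K0: "?m a 0 \<in> K" if "a \<in> \<mm>" for a using B.genideal_self[OF gen] that unfolding K by blast
  let ?T = "{p \<in> carrier B. \<forall>n. ?c p n \<in> \<mm> \<cdot> ideal_power R I n}"
  have imp: "ideal (\<mm> \<cdot> ideal_power R I n) R" for n by (rule ideal_prod_is_ideal[OF ideal_m ip])
  have cBP: "p \<in> carrier ?P" "?c p n \<in> ideal_power R I n" if "p \<in> carrier B" for p n
    using that by (simp_all add: BH H_def)
  have "ideal ?T B"
  proof (rule B.idealI_comm)
    show "\<zero>\<^bsub>B\<^esub> \<in> ?T" using ideal_zero[OF imp] B.zero_closed by (simp add: BH)
  next
    fix p q assume pq: "p \<in> ?T" "q \<in> ?T"
    have "p \<oplus>\<^bsub>B\<^esub> q \<in> carrier B" using pq by simp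
    then show "p \<oplus>\<^bsub>B\<^esub> q \<in> ?T" using pq cBP ideal_add[OF imp] by (simp add: BH)
  next
    fix p q assume p: "p \<in> ?T" and q: "q \<in> carrier B"
    have "(\<Oplus>i\<in>{..n}. ?c q i \<otimes> ?c p (n - i)) \<in> \<mm> \<cdot> ideal_power R I n" for n
    proof (rule finsum_in_ideal[OF imp])
      fix i assume i: "i \<in> {..n}"
      have "?c q i \<otimes> ?c p (n - i) \<in> ideal_power R I i \<cdot> (\<mm> \<cdot> ideal_power R I (n - i))"
        using p cBP(2)[OF q] by (intro ideal_prod.prod) simp_all
      also have "\<dots> = \<mm> \<cdot> (ideal_power R I i \<cdot> ideal_power R I (n - i))"
        by (simp only: ideal_prod_assoc[OF ip ideal_m ip, symmetric] ideal_prod_commute[OF ip ideal_m]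
              ideal_prod_assoc[OF ideal_m ip ip])
      also have "\<dots> = \<mm> \<cdot> ideal_power R I n"
        using ideal_power_add[OF I, of i "n - i"] i by simp
      finally show "?c q i \<otimes> ?c p (n - i) \<in> \<mm> \<cdot> ideal_power R I n" .
    qed simp
    moreover have "q \<otimes>\<^bsub>B\<^esub> p \<in> carrier B" using p q by simp
    ultimately show "q \<otimes>\<^bsub>B\<^esub> p \<in> ?T" using p q cBP by (simp add: BH)
  qed simp
  moreover have "(\<lambda>a. ?m a 0) ` \<mm> \<subseteq> ?T"
  proof (rule image_subsetI)
    fix a assume a: "a \<in> \<mm>"
    have ac: "a \<in> carrier R" using a m_carr by blast
    have "a \<in> \<mm> \<cdot> ideal_power R I 0" unfolding ideal_power_0 ideal_prod_one[OF ideal_m] by (rule a)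
    then show "?m a 0 \<in> ?T" using m0[OF ac] ac ideal_zero[OF imp] by (simp del: nat_pow_0)
  qed
  ultimately have KT: "K \<subseteq> ?T" unfolding K by (rule B.genideal_minimal)
  have mK: "?m a n \<in> K" if "a \<in> \<mm> \<cdot> ideal_power R I n" for a n
    using that
  proof (induction rule: ideal_prod.induct)
    case (prod i j)
    have c: "i \<in> carrier R" "j \<in> carrier R" using prod m_carr ideal_carr[OF ip] by blast+
    have "?m (i \<otimes> j) n = ?m i 0 \<otimes>\<^bsub>?P\<^esub> ?m j n" using U.monom_mult[OF c, of 0 n] by simp
    also have "\<dots> = ?m i 0 \<otimes>\<^bsub>B\<^esub> ?m j n" by (simp add: BH)
    also have "\<dots> \<in> K" by (rule B.ideal_mult_right[OF iK K0[OF prod(1)] mB[OF prod(2)]])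
    finally show ?case .
  next
    case (sum a b)
    have c: "a \<in> carrier R" "b \<in> carrier R" using sum ideal_carr[OF imp] by blast+
    have "?m (a \<oplus> b) n = ?m a n \<oplus>\<^bsub>B\<^esub> ?m b n" using U.monom_add[OF c] by (simp add: BH)
    then show ?case using B.ideal_add[OF iK sum(3,4)] by simp
  qed
  show "?m a n \<in> K \<longleftrightarrow> a \<in> \<mm> \<cdot> ideal_power R I n" if a: "a \<in> ideal_power R I n" for a n
  proof
    assume "?m a n \<in> K"
    then have "?c (?m a n) n \<in> \<mm> \<cdot> ideal_power R I n" using KT by blast
    then show "a \<in> \<mm> \<cdot> ideal_power R I n" using ideal_carr[OF ip a] by simp
  qed (rule mK)
qed

text \<open>\<open>ring.dim\<close> is a definite description, and it is resolved by uniqueness of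
  dimension over a subfield. So the component of degree zero is shown to be one, using that elements
  outside \<open>\<mm>\<close> are units.\<close>

theorem special_fiber_hilbert_fun_eq:
  assumes I: "m_primary I"
  shows "special_fiber_hilbert_fun R \<mm> I n =
    colength R (\<mm> \<cdot> ideal_power R I n) - colength R (ideal_power R I n)"
proof -
  interpret U: UP_cring R "UP R" by unfold_locales simp
  have iI: "ideal I R" by (rule m_primary_ideal[OF I])
  have ip: "ideal (ideal_power R I n) R" for n by (rule ideal_ideal_power[OF iI])
  let ?B = "rees_algebra R I" and ?K = "rees_extension R \<mm> I" and ?F = "special_fiber R \<mm> I"
  let ?m = "up_ring.monom (UP R)"
  note fb = special_fiber_facts[OF iI]
  interpret B: cring ?B by (rule fb(1))
  interpret K: ideal ?K ?B by (rule fb(2))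
  have F: "?F = ?B Quot ?K" by (simp add: special_fiber_def)
  interpret F: cring ?F unfolding F by (rule K.quotient_is_cring[OF fb(1)])
  have hom: "(+>\<^bsub>?B\<^esub>) ?K \<in> ring_hom ?B ?F" unfolding F by (rule K.rcos_ring_hom)
  define \<phi> where "\<phi> n a = ?K +>\<^bsub>?B\<^esub> ?m a n" for n a
  have Bops: "p \<oplus>\<^bsub>?B\<^esub> q = p \<oplus>\<^bsub>UP R\<^esub> q" "p \<otimes>\<^bsub>?B\<^esub> q = p \<otimes>\<^bsub>UP R\<^esub> q" for p q
    by (simp_all add: rees_algebra_def)
  have zF: "\<zero>\<^bsub>?F\<^esub> = ?K" by (simp add: F FactRing_def)
  have phi: "\<phi> n a \<in> carrier ?F" if "a \<in> ideal_power R I n" for n a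
    unfolding \<phi>_def by (rule ring_hom_closed[OF hom fb(3)[OF that]])
  have phi_add: "\<phi> n (a \<oplus> b) = \<phi> n a \<oplus>\<^bsub>?F\<^esub> \<phi> n b" if ab: "a \<in> ideal_power R I n" "b \<in> ideal_power R I n" for n a b
  proof -
    have "?m (a \<oplus> b) n = ?m a n \<oplus>\<^bsub>?B\<^esub> ?m b n"
      unfolding Bops by (rule U.monom_add[OF ideal_carr[OF ip ab(1)] ideal_carr[OF ip ab(2)]])
    then show ?thesis unfolding \<phi>_def using ring_hom_add[OF hom fb(3)[OF ab(1)] fb(3)[OF ab(2)]] by simp
  qed
  have in0: "r \<in> ideal_power R I 0" if "r \<in> carrier R" for r unfolding ideal_power_0 by (rule that)
  have phi_mult: "\<phi> n (r \<otimes> a) = \<phi> 0 r \<otimes>\<^bsub>?F\<^esub> \<phi> n a" if r: "r \<in> carrier R" and a: "a \<in> ideal_power R I n" for n r a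
  proof -
    have "?m (r \<otimes> a) n = ?m r 0 \<otimes>\<^bsub>?B\<^esub> ?m a n"
      unfolding Bops using U.monom_mult[OF r ideal_carr[OF ip a], of 0 n] by simp
    then show ?thesis unfolding \<phi>_def using ring_hom_mult[OF hom fb(3)[OF in0[OF r]] fb(3)[OF a]] by simp
  qed
  have phi_zero: "\<phi> n a = \<zero>\<^bsub>?F\<^esub> \<longleftrightarrow> a \<in> \<mm> \<cdot> ideal_power R I n" if a: "a \<in> ideal_power R I n" for n a
  proof -
    have "\<phi> n a = ?K \<longleftrightarrow> ?m a n \<in> ?K"
      unfolding \<phi>_def using B.a_rcos_zero[OF fb(2)] K.rcos_const_imp_mem[OF fb(3)[OF a]] by blast
    then show ?thesis unfolding zF using fb(4)[OF a] by simp
  qed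
  have phi_one: "\<phi> 0 \<one> = \<one>\<^bsub>?F\<^esub>"
  proof -
    have "?m \<one> 0 = \<one>\<^bsub>?B\<^esub>" using U.monom_one by (simp add: rees_algebra_def)
    then show ?thesis unfolding \<phi>_def using ring_hom_one[OF hom] by simp
  qed
  let ?k = "\<phi> 0 ` carrier R"
  have zero0: "\<phi> 0 r = \<zero>\<^bsub>?F\<^esub> \<longleftrightarrow> r \<in> \<mm>" if "r \<in> carrier R" for r
    using phi_zero[OF in0[OF that]] unfolding ideal_power_0 ideal_prod_one[OF ideal_m] .
  have sub: "subfield ?k ?F"
  proof (rule F.subfieldI)
    have neg: "\<ominus>\<^bsub>?F\<^esub> \<phi> 0 r = \<phi> 0 (\<ominus> r)" if r: "r \<in> carrier R" for r
    proof (rule F.minus_equality)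
      have "\<phi> 0 (\<ominus> r) \<oplus>\<^bsub>?F\<^esub> \<phi> 0 r = \<phi> 0 (\<ominus> r \<oplus> r)"
        using phi_add[OF in0 in0, of "\<ominus> r" r] r by simp
      then show "\<phi> 0 (\<ominus> r) \<oplus>\<^bsub>?F\<^esub> \<phi> 0 r = \<zero>\<^bsub>?F\<^esub>"
        using zero0[of \<zero>] r ideal_zero[OF ideal_m] by (simp add: l_neg)
    qed (use phi[OF in0] r in auto)
    have "subring ?k ?F"
    proof (rule F.subringI)
      show "?k \<subseteq> carrier ?F" using phi[OF in0] by blast
      show "\<one>\<^bsub>?F\<^esub> \<in> ?k" using phi_one by (metis imageI one_closed)
      show "\<ominus>\<^bsub>?F\<^esub> h \<in> ?k" if "h \<in> ?k" for h using that neg by auto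
    next
      fix h1 h2 assume "h1 \<in> ?k" "h2 \<in> ?k"
      then obtain r s where rs: "r \<in> carrier R" "s \<in> carrier R" "h1 = \<phi> 0 r" "h2 = \<phi> 0 s" by blast
      have "r \<otimes> s \<in> carrier R" "r \<oplus> s \<in> carrier R" using rs by simp_all
      then show "h1 \<otimes>\<^bsub>?F\<^esub> h2 \<in> ?k" "h1 \<oplus>\<^bsub>?F\<^esub> h2 \<in> ?k"
        unfolding rs(3,4) phi_mult[OF rs(1) in0[OF rs(2)], symmetric]
          phi_add[OF in0[OF rs(1)] in0[OF rs(2)], symmetric] by blast+
    qed
    then show "subcring ?k ?F" by (rule F.subcringI')
    show "Units (?F\<lparr>carrier := ?k\<rparr>) = ?k - {\<zero>\<^bsub>?F\<^esub>}"
    proof (rule subset_antisym; rule subsetI)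
      fix h assume "h \<in> Units (?F\<lparr>carrier := ?k\<rparr>)"
      then obtain g where hg: "h \<in> ?k" "g \<in> ?k" "g \<otimes>\<^bsub>?F\<^esub> h = \<one>\<^bsub>?F\<^esub>" by (auto simp: Units_def)
      have g: "g \<in> carrier ?F" using hg(2) phi[OF in0] by blast
      have "h \<noteq> \<zero>\<^bsub>?F\<^esub>"
      proof
        assume "h = \<zero>\<^bsub>?F\<^esub>"
        then have "\<phi> 0 \<one> = \<zero>\<^bsub>?F\<^esub>" using hg(3) F.r_null[OF g] phi_one by simp
        then show False using zero0[of \<one>] one_notin_m by simp
      qed
      then show "h \<in> ?k - {\<zero>\<^bsub>?F\<^esub>}" using hg by simp
    next
      fix h assume h: "h \<in> ?k - {\<zero>\<^bsub>?F\<^esub>}"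
      then obtain r where r: "r \<in> carrier R" "h = \<phi> 0 r" by blast
      then have "r \<notin> \<mm>" using h zero0 by blast
      then obtain v where v: "v \<in> carrier R" "v \<otimes> r = \<one>" using unit_outside_m r by blast
      have "\<phi> 0 v \<otimes>\<^bsub>?F\<^esub> h = \<one>\<^bsub>?F\<^esub>" using phi_mult[OF v(1) in0[OF r(1)]] v(2) r(2) phi_one by simp
      moreover from this have "h \<otimes>\<^bsub>?F\<^esub> \<phi> 0 v = \<one>\<^bsub>?F\<^esub>"
        using F.m_comm[OF phi[OF in0[OF v(1)]] phi[OF in0[OF r(1)]]] r(2) by simp
      ultimately show "h \<in> Units (?F\<lparr>carrier := ?k\<rparr>)" using h v(1) by (auto simp: Units_def)
    qed
  qed
  have "F.dimension (colength R (\<mm> \<cdot> ideal_power R I n) - colength R (ideal_power R I n)) ?k (\<phi> n ` ideal_power R I n)"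
  proof (rule dimension_mod_m[where \<psi> = "\<phi> 0" and \<phi> = "\<phi> n", OF F.ring_axioms m_primary_power[OF I]])
    show "\<phi> 0 r \<in> carrier ?F" if "r \<in> carrier R" for r by (rule phi[OF in0[OF that]])
  qed (fact phi phi_add phi_mult phi_zero)+
  from F.dimI[OF sub this] show ?thesis
    unfolding special_fiber_hilbert_fun_def special_fiber_component_def over_def \<phi>_def ideal_power_0 .
qed

end

section \<open>The multiplicity of the special fiber\<close>

lemma tendsto_shift_div_power:
  assumes "(\<lambda>n. f n / real n ^ d) \<longlonglongrightarrow> (l::real)"
  shows "(\<lambda>n. f (n + r) / real n ^ d) \<longlonglongrightarrow> l"
proof -
  have "(\<lambda>n. f (n + r) / real (n + r) ^ d) \<longlonglongrightarrow> l" using LIMSEQ_ignore_initial_segment[OF assms] .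
  moreover have "(\<lambda>n. (1 + real r * inverse (real n)) ^ d) \<longlonglongrightarrow> (1 + real r * 0) ^ d"
    by (intro tendsto_intros lim_inverse_n)
  ultimately have "(\<lambda>n. f (n + r) / real (n + r) ^ d * (1 + real r * inverse (real n)) ^ d) \<longlonglongrightarrow> l * (1 + real r * 0) ^ d"
    by (rule tendsto_mult)
  moreover have "\<forall>\<^sub>F n in sequentially. f (n + r) / real (n + r) ^ d * (1 + real r * inverse (real n)) ^ d = f (n + r) / real n ^ d"
    using eventually_gt_at_top[of 0]
  proof eventually_elim
    case (elim n)
    have "1 + real r * inverse (real n) = real (n + r) / real n" using elim by (simp add: field_simps)
    then show ?case using elim by (simp add: power_divide)
  qed
  ultimately show ?thesis by (simp add: tendsto_cong)
qed

lemma eventually_le_of_tendsto: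
  assumes "(\<lambda>n. f n / real n ^ d) \<longlonglongrightarrow> (l::real)"
  shows "\<forall>\<^sub>F n in sequentially. f n \<le> (l + 1) * real n ^ d"
proof -
  have "\<forall>\<^sub>F n in sequentially. f n / real n ^ d < l + 1"
    using order_tendstoD(2)[OF assms, of "l + 1"] by simp
  then show ?thesis using eventually_gt_at_top[of 0]
    by eventually_elim (simp add: divide_less_eq less_imp_le)
qed

section \<open>Comparison of an ideal with its reduction\<close>

context noetherian_local_ring
begin

text \<open>By Nakayama I^n is generated by \<lambda>(I^n/\<open>\<mm>\<close>I^n) elements, so
  I^n/I^(n+1) is covered by that many copies of R/I. This bounds the growth of the fiber from
  below.\<close>

lemma colength_power_Suc_le:
  assumes I: "m_primary I"
  shows "colength R (ideal_power R I (Suc n)) \<le> colength R (ideal_power R I n) +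
    (colength R (\<mm> \<cdot> ideal_power R I n) - colength R (ideal_power R I n)) * colength R I"
proof -
  let ?M = "ideal_power R I n"
  have iI: "ideal I R" by (rule m_primary_ideal[OF I])
  have mM: "m_primary ?M" by (rule m_primary_power[OF I])
  have iM: "ideal ?M R" by (rule m_primary_ideal[OF mM])
  have mA: "m_primary (\<mm> \<cdot> ?M)" by (rule m_primary_prod[OF m_primary_m mM])
  have iA: "ideal (\<mm> \<cdot> ?M) R" by (rule m_primary_ideal[OF mA])
  obtain S where S: "S \<subseteq> carrier R" "finite S" "?M = Idl S" using fin_gen[OF iM] by blast
  have SM: "S \<subseteq> ?M" unfolding S(3) by (rule genideal_self[OF S(1)])
  have eq: "Idl ((\<mm> \<cdot> ?M) \<union> S) = ?M"
    by (rule Idl_Un_generators[OF iA ideal_prod_subset2[OF ideal_m iM] S(1,3)])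
  have col: "\<mm> \<subseteq> colon R (\<mm> \<cdot> ?M) s" if "s \<in> S" for s
    using subset_colon_m[OF iM] SM that by blast
  obtain xs where xs: "set xs \<subseteq> S" "Idl ((\<mm> \<cdot> ?M) \<union> set xs) = ?M"
    "colength R (\<mm> \<cdot> ?M) = length xs + colength R ?M"
    using independent_generators[OF S(2) m_primary_finite_colength[OF mA] S(1) col] unfolding eq by blast
  have Y: "set xs \<subseteq> carrier R" using xs(1) S(1) by blast
  have iY: "ideal (Idl (set xs)) R" by (rule genideal_ideal[OF Y])
  have "?M \<subseteq> Idl (Idl (set xs) \<union> (\<mm> \<cdot> ?M))"
  proof -
    have "Idl ((\<mm> \<cdot> ?M) \<union> set xs) \<subseteq> Idl (Idl (set xs) \<union> (\<mm> \<cdot> ?M))"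
      using genideal_self[OF Y] ideal_subset_carrier[OF iY] ideal_subset_carrier[OF iA]
      by (intro Idl_mono) blast+
    then show ?thesis by (simp only: xs(2))
  qed
  then have sub: "?M \<subseteq> Idl (set xs)" by (rule nakayama[OF iY iM])
  have YM: "set xs \<subseteq> ?M" using xs(1) SM by blast
  have MY: "?M = Idl (set xs)" using sub genideal_minimal[OF iM YM] by blast
  let ?B = "ideal_power R I (Suc n)"
  have mB: "m_primary ?B" by (rule m_primary_power[OF I])
  have iB: "ideal ?B R" by (rule m_primary_ideal[OF mB])
  have BM: "?B \<subseteq> ?M" by (rule ideal_power_antimono[OF iI]) simp
  have eqB: "Idl (?B \<union> set xs) = ?M" by (rule Idl_Un_generators[OF iB BM Y MY])
  have colB: "I \<subseteq> colon R ?B s" if s: "s \<in> set xs" for s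
  proof
    fix b assume b: "b \<in> I"
    have bc: "b \<in> carrier R" and sM: "s \<in> ?M" using ideal_carr[OF iI b] s YM by blast+
    have "s \<otimes> b \<in> ?B" unfolding ideal_power_Suc by (rule ideal_prod.prod[OF sM b])
    then show "b \<in> colon R ?B s" using bc m_comm[OF bc ideal_carr[OF iM sM]] by (simp add: colon_def)
  qed
  have "colength R ?B \<le> colength R ?M + card (set xs) * colength R I"
    using finite_colength_Idl_Un[OF finite_set iB Y _ m_primary_finite_colength[OF I] colB]
      m_primary_finite_colength[OF mM] unfolding eqB by blast
  also have "\<dots> \<le> colength R ?M + length xs * colength R I"
    by (intro add_left_mono mult_right_mono card_length) simp
  finally show ?thesis using xs(3) by simp
qed

text \<open>A generating set of minimal size shows \<lambda>(I/\<open>\<mm>\<close>I) \<le>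
  \<mu>(I). The generators \<open>S\<close> use up at least d of this length, so at most \<mu>(I) -
  d further elements complete them modulo \<open>\<mm>\<close>I, and Nakayama lifts the generation
  to I.\<close>

lemma reduction_complement:
  assumes I: "m_primary I" "I \<subseteq> \<mm>" and d: "krull_dim R = enat d" "d > 0"
    and S: "finite S" "S \<subseteq> carrier R" and J: "J = Idl S" "J \<subseteq> I"
    and red: "ideal_power R I (r + 1) = J \<cdot> ideal_power R I r"
  shows "\<exists>G. finite G \<and> G \<subseteq> carrier R \<and> I = Idl (S \<union> G) \<and> card G + d \<le> min_gens R I"
proof -
  have iI: "ideal I R" by (rule m_primary_ideal[OF I(1)])
  let ?A = "\<mm> \<cdot> I" and ?A' = "Idl ((\<mm> \<cdot> I) \<union> S)"
  have mA: "m_primary ?A" by (rule m_primary_prod[OF m_primary_m I(1)])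
  have iA: "ideal ?A R" by (rule m_primary_ideal[OF mA])
  have AI: "?A \<subseteq> I" by (rule ideal_prod_subset2[OF ideal_m iI])
  have SI: "S \<subseteq> I" using genideal_self[OF S(2)] J by blast
  have AS: "?A \<union> S \<subseteq> carrier R" using ideal_subset_carrier[OF iA] S(2) by simp
  have iA': "ideal ?A' R" by (rule genideal_ideal[OF AS])
  have AA': "?A \<subseteq> ?A'" by (rule subset_Idl[OF AS]) simp
  have mA': "m_primary ?A'" by (rule m_primary_mono[OF mA iA' AA'])
  have A'I: "?A' \<subseteq> I" using AI SI by (intro genideal_minimal[OF iI]) simp
  have "\<exists>n T. T \<subseteq> carrier R \<and> finite T \<and> card T = n \<and> I = Idl T" using fin_gen[OF iI] by blast
  from LeastI_ex[OF this] obtain T where T: "T \<subseteq> carrier R" "finite T" "card T = min_gens R I" "I = Idl T"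
    unfolding min_gens_def by blast
  have TI: "T \<subseteq> I" using genideal_self[OF T(1)] T(4) by blast
  have eq: "Idl (?A \<union> T) = I" by (rule Idl_Un_generators[OF iA AI T(1,4)])
  have eq': "Idl (?A' \<union> T) = I" by (rule Idl_Un_generators[OF iA' A'I T(1,4)])
  have col: "\<mm> \<subseteq> colon R ?A s" if "s \<in> T" for s using subset_colon_m[OF iI] TI that by blast
  have col': "\<mm> \<subseteq> colon R ?A' s" if "s \<in> T" for s using col[OF that] colon_mono[OF AA'] by blast
  have "colength R ?A \<le> colength R I + card T * colength R \<mm>"
    using finite_colength_Idl_Un[OF T(2) iA T(1) _ colength_m(1) col] m_primary_finite_colength[OF I(1)]
    unfolding eq by blast
  then have 1: "colength R ?A \<le> colength R I + min_gens R I" by (simp add: colength_m T(3))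
  obtain xs where xs: "set xs \<subseteq> T" "Idl (?A' \<union> set xs) = I"
    "colength R ?A' = length xs + colength R I"
    using independent_generators[OF T(2) m_primary_finite_colength[OF mA'] T(1) col'] unfolding eq' by blast
  have 2: "d + colength R ?A' \<le> colength R ?A"
    by (rule reduction_generators_independent[OF I d S J red])
  have xc: "set xs \<subseteq> carrier R" using xs(1) T(1) by blast
  have Sx: "S \<union> set xs \<subseteq> carrier R" using S(2) xc by simp
  have iSx: "ideal (Idl (S \<union> set xs)) R" by (rule genideal_ideal[OF Sx])
  have Cc: "Idl (S \<union> set xs) \<union> ?A \<subseteq> carrier R"
    using ideal_subset_carrier[OF iSx] ideal_subset_carrier[OF iA] by simp
  have iC: "ideal (Idl (Idl (S \<union> set xs) \<union> ?A)) R" by (rule genideal_ideal[OF Cc])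
  have "S \<union> set xs \<union> ?A \<subseteq> Idl (Idl (S \<union> set xs) \<union> ?A)"
    using genideal_self[OF Sx] genideal_self[OF Cc] by blast
  then have "?A' \<subseteq> Idl (Idl (S \<union> set xs) \<union> ?A)" "set xs \<subseteq> Idl (Idl (S \<union> set xs) \<union> ?A)"
    using genideal_minimal[OF iC, of "?A \<union> S"] by blast+
  then have "Idl (?A' \<union> set xs) \<subseteq> Idl (Idl (S \<union> set xs) \<union> ?A)" by (intro genideal_minimal[OF iC]) simp
  then have "I \<subseteq> Idl (Idl (S \<union> set xs) \<union> ?A)" by (simp only: xs(2))
  then have "I \<subseteq> Idl (S \<union> set xs)" by (rule nakayama[OF iSx iI])
  moreover have "Idl (S \<union> set xs) \<subseteq> I" using SI xs(1) TI by (intro genideal_minimal[OF iI]) blast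
  ultimately have "I = Idl (S \<union> set xs)" by (rule subset_antisym)
  moreover have "card (set xs) + d \<le> min_gens R I" using 1 2 xs(3) card_length[of xs] by linarith
  ultimately show ?thesis using xc by (intro exI[of _ "set xs"]) simp
qed

text \<open>\<open>J\<^sup>nI + \<mm>I\<^sup>n\<^sup>+\<^sup>1\<close> is generated modulo \<open>\<mm>I\<^sup>n\<^sup>+\<^sup>1\<close> by the monomials of degree \<open>n + 1\<close> in the
  generators of \<open>J\<close> and the products of monomials of degree \<open>n\<close> with elements of \<open>G\<close>.\<close>

lemma fiber_bound:
  fixes x :: "nat \<Rightarrow> 'a"
  assumes I: "m_primary I" and J: "m_primary J" "J \<subseteq> I"
    and x: "\<And>i. i < k \<Longrightarrow> x i \<in> carrier R" and Jx: "J = Idl (x ` {..<k})"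
    and G: "finite G" "G \<subseteq> carrier R" and IG: "I = Idl (x ` {..<k} \<union> G)"
  shows "colength R (\<mm> \<cdot> ideal_power R I (Suc n)) \<le> card (exps k (Suc n)) + card G * card (exps k n)
    + colength R (ideal_power R J n) + card (exps k n) * colength R I"
proof -
  let ?M = "monomial R x k" and ?A = "\<mm> \<cdot> ideal_power R I (Suc n)"
  let ?X = "?M ` exps k (Suc n) \<union> (\<lambda>(g, b). ?M b \<otimes> g) ` (G \<times> exps k n)"
  have iI: "ideal I R" and iJ: "ideal J R" by (rule m_primary_ideal[OF I] m_primary_ideal[OF J(1)])+
  have ipI: "ideal (ideal_power R I n) R" for n by (rule ideal_ideal_power[OF iI])
  have ipJ: "ideal (ideal_power R J n) R" for n by (rule ideal_ideal_power[OF iJ])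
  have mA: "m_primary ?A" by (rule m_primary_prod[OF m_primary_m m_primary_power[OF I]])
  have iA: "ideal ?A R" by (rule m_primary_ideal[OF mA])
  have mc: "?M a \<in> carrier R" for a using x by (rule monomial_closed)
  have Mc: "?M ` Z \<subseteq> carrier R" for Z using mc by auto
  have SG: "x ` {..<k} \<union> G \<subseteq> carrier R" using x G by auto
  have GI: "x ` {..<k} \<union> G \<subseteq> I" unfolding IG by (rule genideal_self[OF SG])
  have J_eq: "ideal_power R J m = Idl (?M ` exps k m)" for m unfolding Jx by (rule ideal_power_Idl[OF x])
  have MJ: "?M a \<in> ideal_power R J m" if "a \<in> exps k m" for a m
    unfolding J_eq using genideal_self[OF Mc] that by blast
  have MI: "?M a \<in> ideal_power R I m" if "a \<in> exps k m" for a m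
    using MJ[OF that] ideal_power_mono[OF iJ iI J(2)] by blast
  have XI: "?X \<subseteq> ideal_power R I (Suc n)"
  proof (rule Un_least)
    show "?M ` exps k (Suc n) \<subseteq> ideal_power R I (Suc n)" by (rule image_subsetI) (rule MI)
    show "(\<lambda>(g, b). ?M b \<otimes> g) ` (G \<times> exps k n) \<subseteq> ideal_power R I (Suc n)"
    proof (rule image_subsetI)
      fix p assume "p \<in> G \<times> exps k n"
      then obtain g b where p: "p = (g, b)" "g \<in> G" "b \<in> exps k n" by blast
      have "?M b \<otimes> g \<in> ideal_power R I n \<cdot> I" using GI p by (intro ideal_prod.prod MI) blast+
      then show "(case p of (g, b) \<Rightarrow> ?M b \<otimes> g) \<in> ideal_power R I (Suc n)" by (simp only: p ideal_power_Suc prod.case)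
    qed
  qed
  have Xc: "?X \<subseteq> carrier R" using XI ideal_subset_carrier[OF ipI] by (rule subset_trans)
  have finX: "finite ?X" by (intro finite_UnI finite_imageI finite_cartesian_product finite_exps G)
  have cardX: "card ?X \<le> card (exps k (Suc n)) + card G * card (exps k n)"
  proof -
    have "card ?X \<le> card (?M ` exps k (Suc n)) + card ((\<lambda>(g, b). ?M b \<otimes> g) ` (G \<times> exps k n))" by (rule card_Un_le)
    also have "\<dots> \<le> card (exps k (Suc n)) + card (G \<times> exps k n)"
      by (intro add_mono card_image_le finite_exps finite_cartesian_product G)
    finally show ?thesis by (simp add: card_cartesian_product)
  qed
  have AX: "?A \<union> ?X \<subseteq> carrier R" using ideal_subset_carrier[OF iA] Xc by (rule Un_least)
  have iAX: "ideal (Idl (?A \<union> ?X)) R" by (rule genideal_ideal[OF AX])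
  have fAX: "finite_colength R (Idl (?A \<union> ?X))"
    by (rule finite_colength_mono(1)[OF m_primary_finite_colength[OF mA] iAX], rule subset_Idl[OF AX]) (rule Un_upper1)
  have colX: "\<mm> \<subseteq> colon R ?A s" if "s \<in> ?X" for s using subset_colon_m[OF ipI] XI that by blast
  have "colength R ?A \<le> colength R (Idl (?A \<union> ?X)) + card ?X * colength R \<mm>"
    using finite_colength_Idl_Un[OF finX iA Xc fAX colength_m(1) colX] by blast
  then have 1: "colength R ?A \<le> colength R (Idl (?A \<union> ?X)) + card ?X" by (simp add: colength_m)
  have sX: "?X \<subseteq> Idl (?A \<union> ?X)" by (rule subset_Idl[OF AX]) (rule Un_upper2)
  \<comment> \<open>A generator of J^n times a generator of I is a monomial of degree n + 1, or a
    monomial of degree n times an element of \<open>G\<close>.\<close>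
  have "(Idl (?M ` exps k n)) \<cdot> (Idl (x ` {..<k} \<union> G)) \<subseteq> Idl (?A \<union> ?X)"
  proof (rule ideal_prod_Idl_subset[OF Mc SG iAX])
    fix u y assume "u \<in> ?M ` exps k n" and y: "y \<in> x ` {..<k} \<union> G"
    then obtain b where b: "b \<in> exps k n" "u = ?M b" by blast
    from y show "u \<otimes> y \<in> Idl (?A \<union> ?X)"
    proof
      assume "y \<in> x ` {..<k}"
      then obtain i where i: "i < k" "y = x i" by blast
      have "u \<otimes> y = ?M (\<lambda>j. b j + unit_exp i j)"
        using b i monomial_add[of k x b "unit_exp i"] monomial_unit[of k x i] x by simp
      moreover have "(\<lambda>j. b j + unit_exp i j) \<in> exps k (Suc n)"
        using exps_add[OF b(1) unit_exp_exps[OF i(1)]] by simp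
      ultimately have "u \<otimes> y \<in> ?X" by blast
      then show ?thesis using sX by blast
    next
      assume "y \<in> G"
      then have "u \<otimes> y \<in> ?X" using b by force
      then show ?thesis using sX by blast
    qed
  qed
  then have sub: "ideal_power R J n \<cdot> I \<subseteq> Idl (?A \<union> ?X)" by (simp only: J_eq IG[symmetric])
  have comm: "ideal_power R J n \<cdot> I = I \<cdot> ideal_power R J n" by (rule ideal_prod_commute[OF ipJ iI])
  have mIJ: "m_primary (I \<cdot> ideal_power R J n)" by (rule m_primary_prod[OF I m_primary_power[OF J(1)]])
  \<comment> \<open>The ideal contains J^nI, and passing from J^n to J^nI costs at most
    \<lambda>(R/I) for each monomial of degree n.\<close>
  have "colength R (Idl (?A \<union> ?X)) \<le> colength R (I \<cdot> ideal_power R J n)"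
    by (rule finite_colength_mono(2)[OF m_primary_finite_colength[OF mIJ] iAX sub[unfolded comm]])
  also have "\<dots> \<le> colength R (ideal_power R J n) + card (exps k n) * colength R I"
    by (rule colength_prod_power_le[OF x Jx J(1) I])
  finally show ?thesis using 1 cardX by linarith
qed

theorem special_fiber_multiplicity_le:
  assumes d: "krull_dim R = enat d" "d > 0"
    and PI: "P_primary R \<mm> I" and MR: "minimal_reduction R d I J"
  shows "special_fiber_multiplicity R \<mm> d I \<le>
    real_of_int (hilbert_coeff R d I 1 - hilbert_coeff R d I 0 - hilbert_coeff R d J 1
      + int (colength R I) + int (min_gens R I) - int d + 1)"
proof -
  have I: "m_primary I" by (rule m_primary_of_P_primary[OF PI])
  have iI: "ideal I R" by (rule m_primary_ideal[OF I])
  have Im: "I \<subseteq> \<mm>" using PI proper_subset_m[OF iI] by (simp add: P_primary_def primary_ideal_def)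
  obtain S r where iJ: "ideal J R" and JI: "J \<subseteq> I" and S: "S \<subseteq> carrier R" "finite S" "card S = d" "J = Idl S"
    and red: "ideal_power R I (r + 1) = J \<cdot> ideal_power R I r"
    using MR unfolding minimal_reduction_def by blast
  have ipI: "ideal (ideal_power R I n) R" for n by (rule ideal_ideal_power[OF iI])
  have ipJ: "ideal (ideal_power R J n) R" for n by (rule ideal_ideal_power[OF iJ])
  have "ideal_power R I (r + 1) \<subseteq> J" unfolding red by (rule ideal_prod_subset1[OF iJ ipI])
  then have J: "m_primary J" by (rule m_primary_mono[OF m_primary_power[OF I] iJ])
  obtain x :: "nat \<Rightarrow> 'a" where x: "x ` {..<d} = S" using finite_enum[OF S(2)] S(3) by blast
  have xc: "x i \<in> carrier R" if "i < d" for i using x S(1) that by blast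
  have Jx: "J = Idl (x ` {..<d})" by (simp only: x S(4))
  obtain T where T: "T \<subseteq> carrier R" "finite T" "I = Idl T" using fin_gen[OF iI] by blast
  define k where "k = card T"
  obtain y :: "nat \<Rightarrow> 'a" where y: "y ` {..<k} = T" using finite_enum[OF T(2)] by (auto simp: k_def)
  have yc: "y i \<in> carrier R" if "i < k" for i using y T(1) that by blast
  have Iy: "I = Idl (y ` {..<k})" by (simp only: y T(3))
  obtain G where G: "finite G" "G \<subseteq> carrier R" "I = Idl (S \<union> G)" "card G + d \<le> min_gens R I"
    using reduction_complement[OF I Im d S(2,1,4) JI red] by blast
  obtain D where D: "d = Suc D" using d(2) gr0_implies_Suc by blast

  define A where "A n = colength R (ideal_power R I n)" for n
  define B where "B n = colength R (ideal_power R J n)" for n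
  define F where "F n = colength R (\<mm> \<cdot> ideal_power R I n) - A n" for n
  have fI: "finite_colength R (ideal_power R I n)" for n by (rule m_primary_finite_colength[OF m_primary_power[OF I]])
  have fJ: "finite_colength R (ideal_power R J n)" for n by (rule m_primary_finite_colength[OF m_primary_power[OF J]])
  have F_int: "int (F n) = int (colength R (\<mm> \<cdot> ideal_power R I n)) - int (A n)" for n
  proof -
    have "A n \<le> colength R (\<mm> \<cdot> ideal_power R I n)"
      unfolding A_def
      by (rule finite_colength_mono(2)[OF m_primary_finite_colength[OF m_primary_prod[OF m_primary_m m_primary_power[OF I]]] ipI
            ideal_prod_subset2[OF ideal_m ipI]])
    then show ?thesis by (simp add: F_def of_nat_diff)
  qed
  have AB: "A n \<le> B n" for n
    unfolding A_def B_def by (rule finite_colength_mono(2)[OF fJ ipI ideal_power_mono[OF iJ iI JI]])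
  \<comment> \<open>I^(n+r) lies in J^nI^r and so in J^n. Together with \<open>AB\<close> this
    encloses the two colengths up to a shift of the argument, whence equal leading
    coefficients.\<close>
  have BA: "B n \<le> A (n + r)" for n
  proof -
    have "ideal_power R I (n + r) \<subseteq> ideal_power R J n \<cdot> ideal_power R I r"
    proof (induction n)
      case 0
      then show ?case
        unfolding ideal_power_0 ideal_prod_commute[OF oneideal ipI] ideal_prod_one[OF ipI] by simp
    next
      case (Suc n)
      have "ideal_power R I (Suc n + r) = I \<cdot> ideal_power R I (n + r)"
        by (simp only: add_Suc ideal_power_Suc ideal_prod_commute[OF iI ipI])
      also have "\<dots> \<subseteq> I \<cdot> (ideal_power R J n \<cdot> ideal_power R I r)"
        by (rule ideal_prod_mono[OF iI ideal_prod_is_ideal[OF ipJ ipI] subset_refl Suc])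
      also have "\<dots> = ideal_power R J n \<cdot> (ideal_power R I r \<cdot> I)"
        by (simp only: ideal_prod_assoc[OF iI ipJ ipI, symmetric] ideal_prod_commute[OF iI ipJ]
              ideal_prod_assoc[OF ipJ iI ipI] ideal_prod_commute[OF iI ipI])
      also have "\<dots> = ideal_power R J n \<cdot> (J \<cdot> ideal_power R I r)"
        using red by (simp only: ideal_power_Suc[symmetric] Suc_eq_plus1)
      also have "\<dots> = ideal_power R J (Suc n) \<cdot> ideal_power R I r"
        by (simp only: ideal_power_Suc ideal_prod_assoc[OF ipJ iJ ipI])
      finally show ?case .
    qed
    also have "\<dots> \<subseteq> ideal_power R J n" by (rule ideal_prod_subset1[OF ipJ ipI])
    finally show ?thesis unfolding A_def B_def by (rule finite_colength_mono(2)[OF fI ipJ])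
  qed

  obtain cJ where cJ: "\<forall>\<^sub>F n in sequentially. int (B n) = (\<Sum>j<Suc d. cJ j * int (mchoose j n))"
    using ev_int_poly_colength_power[OF xc Jx J] unfolding ev_int_poly_def B_def by blast
  have limB: "(\<lambda>n. real (B n) / real n ^ d) \<longlonglongrightarrow> real_of_int (cJ d) / fact d"
    using tendsto_mchoose_comb[OF cJ] by simp
  \<comment> \<open>The filtration bounds the degree only by the number \<open>k\<close> of
    generators of I; comparison with J, which has \<open>d\<close> generators, brings it down to
    \<open>d\<close>.\<close>
  have "ev_int_poly (Suc d) (\<lambda>n. int (A n))"
  proof (rule ev_int_poly_reduce)
    show "ev_int_poly (Suc k) (\<lambda>n. int (A n))" unfolding A_def by (rule ev_int_poly_colength_power[OF yc Iy I])
    show "\<forall>\<^sub>F n in sequentially. \<bar>real_of_int (int (A n))\<bar> \<le> (real_of_int (cJ d) / fact d + 1) * real n ^ d"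
      using eventually_le_of_tendsto[OF limB]
    proof eventually_elim
      case (elim n)
      have "real (A n) \<le> real (B n)" using AB by simp
      then show ?case using elim by simp
    qed
  qed
  then obtain cI where cI: "\<forall>\<^sub>F n in sequentially. int (A n) = (\<Sum>j<Suc d. cI j * int (mchoose j n))"
    unfolding ev_int_poly_def by blast
  have limA: "(\<lambda>n. real (A n) / real n ^ d) \<longlonglongrightarrow> real_of_int (cI d) / fact d"
    using tendsto_mchoose_comb[OF cI] by simp
  have top: "cI d = cJ d"
  proof -
    have "real_of_int (cI d) / fact d \<le> real_of_int (cJ d) / fact d"
      by (rule LIMSEQ_le[OF limA limB]) (intro exI[of _ 0] allI impI divide_right_mono, simp_all add: AB)
    moreover have "real_of_int (cJ d) / fact d \<le> real_of_int (cI d) / fact d"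
      by (rule LIMSEQ_le[OF limB tendsto_shift_div_power[OF limA, of r]])
         (intro exI[of _ 0] allI impI divide_right_mono, simp_all add: BA)
    ultimately have "real_of_int (cI d) / fact d = real_of_int (cJ d) / fact d" by (rule antisym)
    then show ?thesis by simp
  qed
  have cI_pos: "cI d > 0"
  proof -
    have "cI d \<noteq> 0"
    proof
      assume "cI d = 0"
      then show False using limA colength_power_not_small[OF I Im d] by (simp add: A_def)
    qed
    moreover have "0 \<le> real_of_int (cI d) / fact d"
      by (rule tendsto_lowerbound[OF limA]) (simp_all add: always_eventually)
    moreover have "\<not> (fact d :: real) \<le> 0" by (simp add: not_le)
    ultimately show ?thesis by (simp add: zero_le_divide_iff)
  qed

  \<comment> \<open>(d-1)! times \<open>L\<close> is the asserted bound with |G| in place of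
    \<mu>(I) - d: the coefficients \<open>cI d\<close>, \<open>cI D\<close> and \<open>cJ D\<close>
    are e_0(I), -e_1(I) and -e_1(J).\<close>
  define L where "L = (1 + real (card G) + real (colength R I) + real_of_int (cJ D - cI d - cI D)) / fact D"
  define W where "W n = real (card (exps d n)) + real (card G) * real (mchoose D n) + real (mchoose D n) * real (colength R I)
    + real_of_int (int (B (n - 1)) - int (A n))" for n
  have limBA: "(\<lambda>n. real_of_int (int (B (n - 1)) - int (A n)) / real n ^ D) \<longlonglongrightarrow>
      real_of_int (cJ D - cI d - cI D) / fact D"
  proof -
    \<comment> \<open>The shifted coefficients of \<open>B\<close> minus those of \<open>A\<close>.
      At index \<open>d\<close> nothing is subtracted by the shift and the two cancel by
      \<open>top\<close>, which leaves degree \<open>D\<close>.\<close>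
    define c where "c j = (cJ j - (if Suc j < Suc d then cJ (Suc j) else 0)) - cI j" for j
    have "\<forall>\<^sub>F n in sequentially. int (B (n - 1)) - int (A n) = (\<Sum>j<Suc D. c j * int (mchoose j n))"
      using eventually_mchoose_comb_pred[OF cJ] cI
    proof eventually_elim
      case (elim n)
      have "int (B (n - 1)) - int (A n) = (\<Sum>j<Suc d. c j * int (mchoose j n))"
        unfolding elim by (simp only: c_def left_diff_distrib sum_subtractf)
      also have "\<dots> = (\<Sum>j<d. c j * int (mchoose j n))" by (simp add: c_def top)
      finally show ?case by (simp only: D)
    qed
    from tendsto_mchoose_comb[OF this] show ?thesis by (simp add: c_def D top[unfolded D])
  qed
  have lim_bb: "(\<lambda>n. real (mchoose D n) / real n ^ D) \<longlonglongrightarrow> 1 / fact D"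
    using tendsto_poly_div_power[of "mchoose_poly D" D] by (simp add: degree_mchoose_poly poly_mchoose_poly coeff_mchoose_poly_top)
  have limW: "(\<lambda>n. W n / real n ^ D) \<longlonglongrightarrow> L"
  proof -
    have "(\<lambda>n. real (card (exps d n)) / real n ^ D + real (card G) * (real (mchoose D n) / real n ^ D)
        + (real (mchoose D n) / real n ^ D) * real (colength R I) + real_of_int (int (B (n - 1)) - int (A n)) / real n ^ D)
      \<longlonglongrightarrow> 1 / fact D + real (card G) * (1 / fact D) + 1 / fact D * real (colength R I)
        + real_of_int (cJ D - cI d - cI D) / fact D"
      by (intro tendsto_add tendsto_mult tendsto_const lim_bb limBA) (simp only: D tendsto_card_exps)
    moreover have "1 / fact D + real (card G) * (1 / fact D) + 1 / fact D * real (colength R I)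
        + real_of_int (cJ D - cI d - cI D) / fact D = L"
      by (simp add: L_def add_divide_distrib)
    ultimately show ?thesis by (simp add: W_def add_divide_distrib)
  qed
  have FW: "real (F n) \<le> W n" if n0: "n > 0" for n
  proof -
    obtain m where m: "n = Suc m" using n0 by (cases n) auto
    have IG: "I = Idl (x ` {..<d} \<union> G)" using G(3) by (simp only: x)
    have card_m: "card (exps d m) = mchoose D (Suc m)" by (simp add: D card_exps mchoose_def)
    have "colength R (\<mm> \<cdot> ideal_power R I (Suc m)) \<le> card (exps d (Suc m)) + card G * card (exps d m)
        + colength R (ideal_power R J m) + card (exps d m) * colength R I"
      by (rule fiber_bound[OF I J JI xc Jx G(1,2) IG])
    then have "int (F n) \<le> int (card (exps d n)) + int (card G) * int (mchoose D n) + int (mchoose D n) * int (colength R I)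
        + (int (B (n - 1)) - int (A n))"
    proof -
      assume h: "colength R (\<mm> \<cdot> ideal_power R I (Suc m)) \<le> card (exps d (Suc m)) + card G * card (exps d m)
        + colength R (ideal_power R J m) + card (exps d m) * colength R I"
      have "int (F n) = int (colength R (\<mm> \<cdot> ideal_power R I n)) - int (A n)" by (rule F_int)
      also have "\<dots> \<le> int (card (exps d (Suc m)) + card G * card (exps d m)
        + colength R (ideal_power R J m) + card (exps d m) * colength R I) - int (A n)"
        using h m by (simp only: of_nat_le_iff diff_right_mono)
      finally show ?thesis by (simp add: m B_def card_m)
    qed
    then have "real_of_int (int (F n)) \<le> real_of_int (int (card (exps d n)) + int (card G) * int (mchoose D n)
        + int (mchoose D n) * int (colength R I) + (int (B (n - 1)) - int (A n)))" by (simp only: of_int_le_iff)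
    then show ?thesis by (simp add: W_def)
  qed

  have "ev_int_poly (Suc D) (\<lambda>n. int (F n))"
  proof (rule ev_int_poly_reduce)
    show "ev_int_poly k (\<lambda>n. int (F n))"
      unfolding F_int A_def by (rule ev_int_poly_prod_power[OF yc Iy I m_primary_m])
    show "\<forall>\<^sub>F n in sequentially. \<bar>real_of_int (int (F n))\<bar> \<le> (L + 1) * real n ^ D"
      using eventually_le_of_tendsto[OF limW] eventually_gt_at_top[of 0]
    proof eventually_elim
      case (elim n)
      then show ?case using FW[of n] by simp
    qed
  qed
  then obtain cF where cF: "\<forall>\<^sub>F n in sequentially. int (F n) = (\<Sum>j<Suc D. cF j * int (mchoose j n))"
    unfolding ev_int_poly_def by blast
  have limF: "(\<lambda>n. real (F n) / real n ^ D) \<longlonglongrightarrow> real_of_int (cF D) / fact D"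
    using tendsto_mchoose_comb[OF cF] by simp
  have "real_of_int (cF D) / fact D \<le> L"
    by (rule LIMSEQ_le[OF limF limW]) (intro exI[of _ 1] allI impI divide_right_mono FW, simp_all)
  then have le: "real_of_int (cF D) \<le> 1 + real (card G) + real (colength R I) + real_of_int (cJ D - cI d - cI D)"
    by (simp add: L_def divide_le_cancel)

  \<comment> \<open>Otherwise \<open>F\<close> has order below \<open>n ^ D\<close>, and so have the
    increments of \<open>A\<close>, which are at most \<lambda>(R/I) times \<open>F (n - 1)\<close>.
    But divided by \<open>n ^ D\<close> these increments tend to \<open>cI d / fact D\<close>, which
    is positive.\<close>
  have "cF D \<noteq> 0"
  proof
    assume 0: "cF D = 0"
    have "\<forall>\<^sub>F n in sequentially. int (A n) - int (A (n - 1)) = (\<Sum>j<Suc D. cI (Suc j) * int (mchoose j n))"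
      using eventually_mchoose_comb_pred[OF cI] cI
    proof eventually_elim
      case (elim n)
      have "int (A n) - int (A (n - 1)) = (\<Sum>j<Suc d. (if Suc j < Suc d then cI (Suc j) else 0) * int (mchoose j n))"
        unfolding elim by (simp only: left_diff_distrib sum_subtractf)
      also have "\<dots> = (\<Sum>j<d. cI (Suc j) * int (mchoose j n))" by simp
      finally show ?case by (simp only: D)
    qed
    from tendsto_mchoose_comb[OF this] have l1: "(\<lambda>n. real_of_int (int (A n) - int (A (n - 1))) / real n ^ D) \<longlonglongrightarrow> real_of_int (cI d) / fact D"
      by (simp add: D)
    have "(\<lambda>n. real_of_int (int (F (n - 1))) / real n ^ D) \<longlonglongrightarrow> 0"
      using tendsto_mchoose_comb[OF eventually_mchoose_comb_pred[OF cF]] by (simp add: 0)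
    then have l2: "(\<lambda>n. real (colength R I) * (real_of_int (int (F (n - 1))) / real n ^ D)) \<longlonglongrightarrow> 0"
      by (rule tendsto_mult_right_zero)
    have "real_of_int (cI d) / fact D \<le> 0"
    proof (rule LIMSEQ_le[OF l1 l2], intro exI[of _ 1] allI impI)
      fix n :: nat assume "n \<ge> 1"
      then obtain m where m: "n = Suc m" by (cases n) auto
      have "A (Suc m) \<le> A m + F m * colength R I"
        using colength_power_Suc_le[OF I, of m] by (simp add: A_def F_def)
      then have "real (A n) - real (A (n - 1)) \<le> real (colength R I) * real (F (n - 1))"
        unfolding m by (simp add: of_nat_mult[symmetric] of_nat_add[symmetric] mult.commute del: of_nat_mult of_nat_add)
      then show "real_of_int (int (A n) - int (A (n - 1))) / real n ^ D \<le> real (colength R I) * (real_of_int (int (F (n - 1))) / real n ^ D)"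
        by (simp add: divide_right_mono)
    qed
    moreover have "real_of_int (cI d) / fact D > 0" using cI_pos by (intro divide_pos_pos) simp_all
    ultimately show False by simp
  qed
  moreover have hp: "hilbert_poly (special_fiber_hilbert_fun R \<mm> I) = mchoose_comb D cF"
  proof (rule hilbert_poly_eqI)
    show "\<forall>\<^sub>F n in sequentially. real (special_fiber_hilbert_fun R \<mm> I n) = poly (mchoose_comb D cF) (real n)"
      using cF
    proof eventually_elim
      case (elim n)
      have "special_fiber_hilbert_fun R \<mm> I n = F n"
        unfolding special_fiber_hilbert_fun_eq[OF I] F_def A_def ..
      moreover have "real (F n) = real_of_int (int (F n))" by simp
      ultimately show ?case unfolding poly_mchoose_comb elim[symmetric] by simp
    qed
  qed
  moreover have "lead_coeff (mchoose_comb D cF) = real_of_int (cF D) / fact D" if "cF D \<noteq> 0"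
  proof -
    have "Polynomial.coeff (mchoose_comb D cF) D \<noteq> 0" using that by (simp add: coeff_mchoose_comb)
    then have "D \<le> degree (mchoose_comb D cF)" by (rule le_degree)
    then have "degree (mchoose_comb D cF) = D" using degree_mchoose_comb[of D cF] by simp
    then show ?thesis by (simp add: coeff_mchoose_comb)
  qed
  ultimately have f0: "special_fiber_multiplicity R \<mm> d I = real_of_int (cF D)"
    by (simp add: special_fiber_multiplicity_def D)

  have e0: "hilbert_coeff R d I 0 = cI d"
    using hilbert_coeff_eqI[where R = R and I = I and d = d and c = cI and i = 0] cI by (simp add: A_def)
  have e1: "hilbert_coeff R d I 1 = - cI D"
    using hilbert_coeff_eqI[where R = R and I = I and d = d and c = cI and i = 1] cI by (simp add: A_def D)
  have e1': "hilbert_coeff R d J 1 = - cJ D"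
    using hilbert_coeff_eqI[where R = R and I = J and d = d and c = cJ and i = 1] cJ by (simp add: B_def D)
  have "real (card G) + real d \<le> real (min_gens R I)" using G(4) by (simp add: of_nat_add[symmetric] del: of_nat_add)
  then show ?thesis unfolding f0 e0 e1 e1' using le by simp
qed

end

theorem theorem3p4:
  fixes R :: "('a, 'b) ring_scheme" and \<mm> I J :: "'a set" and d :: nat
  assumes "noetherian_local_ring R \<mm>"
    and "krull_dim R = enat d" and "d > 0"
    and "infinite (carrier (R Quot \<mm>))"
    and "P_primary R \<mm> I"
    and "minimal_reduction R d I J"
  shows "special_fiber_multiplicity R \<mm> d I \<le>
    real_of_int (hilbert_coeff R d I 1 - hilbert_coeff R d I 0 - hilbert_coeff R d J 1
      + int (colength R I) + int (min_gens R I) - int d + 1)"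
  using noetherian_local_ring.special_fiber_multiplicity_le[OF assms(1-3,5,6)] .

end
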